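(* Consider the Hamiltonian system $$-\Delta u=|x|^a v^\delta,\qquad -\Delta v=|x|^b u^\mu ,$$ and let $\mathcal H_0$ be the critical hyperbola in the plane $(\delta,\mu)$ defined by $$\frac{N+a}{\delta+1}+\frac{N+b}{\mu+1}=N-2 .$$ Then: (i) The system admits a radial ground state (G.S.), unique up to the scaling $(u,v)\mapsto(\theta^{\gamma}u(\theta r),\theta^{\xi}v(\theta r))$, $\theta>0$, if and only if $(\delta,\mu)$ is above $\mathcal H_0$ or on $\mathcal H_0$. (ii) The radial Dirichlet problem in a ball has a solution if and only if $(\delta,\mu)$ is under $\mathcal H_0$. (iii) On $\mathcal H_0$ the G.S. has the following behaviour at $\infty$: assuming for example $\delta>\frac{N+a}{N-2}$, then $\lim_{r\to\infty}r^{N-2}u(r)=\alpha>0$, and $$\lim_{r\to\infty}r^{(N-2)\mu-(2+b)}v=\beta>0\quad\text{if }\mu<\tfrac{N+b}{N-2},$$ $$\lim_{r\to\infty}r^{N-2}v=\beta>0\quad\text{if }\mu>\tfrac{N+b}{N-2},$$ $$\lim_{r\to\infty}r^{N-2}|\ln r|^{-1}v=\beta>0\quad\text{if }\mu=\tfrac{N+b}{N-2}.$$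
   Context: Here $N>2$, $a,b>-2$, $\delta,\mu>0$ and $D=\delta\mu-1>0$ are standing assumptions, and $$\gamma=\frac{(2+a)+(2+b)\delta}{D},\qquad \xi=\frac{(2+b)+(2+a)\mu}{D}.$$ "$(\delta,\mu)$ is above $\mathcal H_0$" means $\frac{N+a}{\delta+1}+\frac{N+b}{\mu+1}<N-2$ and "under $\mathcal H_0$" means $\frac{N+a}{\delta+1}+\frac{N+b}{\mu+1}>N-2$. A positive radial solution $r=|x|\mapsto(u(r),v(r))$ on $(0,R)$ is regular at $0$ if $u,v\in C^2(0,R)\cap C([0,R))$. A radial ground state (G.S.) is a radial solution, positive on $(0,\infty)$ and regular at $0$. A solution of the radial Dirichlet problem in a ball $B(0,R)$ is a radial solution, regular at $0$, positive on $[0,R)$, with $u(R)=v(R)=0$. *)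

theory Defs
  imports "HOL-Analysis.Analysis"
begin

definition laplacian :: "('a::euclidean_space \<Rightarrow> real) \<Rightarrow> 'a \<Rightarrow> real" where
  "laplacian f x = (\<Sum>e\<in>Basis. deriv (deriv (\<lambda>t. f (x + t *\<^sub>R e))) 0)"

definition C2_on :: "(real \<Rightarrow> real) \<Rightarrow> real set \<Rightarrow> bool" where
  "C2_on f S \<longleftrightarrow> f C1_differentiable_on S \<and> deriv f C1_differentiable_on S"

(* Solutions are given by their radial profiles u, v; the end point R may be infinite.
   The Laplacian is the one of the space 'a, applied to x \<mapsto> u |x|; the argument E only
   serves to fix this space. Only the punctured ball is concerned: behaviour at 0 is
   imposed separately. *)
definition positive_radial_solution ::
  "'a::euclidean_space itself \<Rightarrow> real \<Rightarrow> real \<Rightarrow> real \<Rightarrow> real \<Rightarrow> ereal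
    \<Rightarrow> (real \<Rightarrow> real) \<Rightarrow> (real \<Rightarrow> real) \<Rightarrow> bool" where
  "positive_radial_solution E a b \<delta> \<mu> R u v \<longleftrightarrow>
     C2_on u (einterval 0 R) \<and> C2_on v (einterval 0 R) \<and>
     (\<forall>r\<in>einterval 0 R. 0 < u r \<and> 0 < v r) \<and>
     (\<forall>x::'a. norm x \<in> einterval 0 R \<longrightarrow>
        - laplacian (\<lambda>y::'a. u (norm y)) x = norm x powr a * v (norm x) powr \<delta> \<and>
        - laplacian (\<lambda>y::'a. v (norm y)) x = norm x powr b * u (norm x) powr \<mu>)"

definition regular_at_0 :: "ereal \<Rightarrow> (real \<Rightarrow> real) \<Rightarrow> (real \<Rightarrow> real) \<Rightarrow> bool" where
  "regular_at_0 R u v \<longleftrightarrow>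
     C2_on u (einterval 0 R) \<and> C2_on v (einterval 0 R) \<and>
     continuous_on {r. 0 \<le> r \<and> ereal r < R} u \<and>
     continuous_on {r. 0 \<le> r \<and> ereal r < R} v"

definition radial_ground_state ::
  "'a::euclidean_space itself \<Rightarrow> real \<Rightarrow> real \<Rightarrow> real \<Rightarrow> real
    \<Rightarrow> (real \<Rightarrow> real) \<Rightarrow> (real \<Rightarrow> real) \<Rightarrow> bool" where
  "radial_ground_state E a b \<delta> \<mu> u v \<longleftrightarrow>
     positive_radial_solution E a b \<delta> \<mu> \<infinity> u v \<and> regular_at_0 \<infinity> u v"

(* Continuity up to r = R is what makes u R = v R = 0 a boundary condition. *)
definition radial_dirichlet_solution ::
  "'a::euclidean_space itself \<Rightarrow> real \<Rightarrow> real \<Rightarrow> real \<Rightarrow> real \<Rightarrow> real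
    \<Rightarrow> (real \<Rightarrow> real) \<Rightarrow> (real \<Rightarrow> real) \<Rightarrow> bool" where
  "radial_dirichlet_solution E a b \<delta> \<mu> R u v \<longleftrightarrow>
     positive_radial_solution E a b \<delta> \<mu> (ereal R) u v \<and> regular_at_0 (ereal R) u v \<and>
     0 < u 0 \<and> 0 < v 0 \<and>
     continuous_on {0..R} u \<and> continuous_on {0..R} v \<and> u R = 0 \<and> v R = 0"

definition critical_hyperbola :: "real \<Rightarrow> real \<Rightarrow> real \<Rightarrow> (real \<times> real) set" where
  "critical_hyperbola N a b = {(\<delta>, \<mu>). (N + a) / (\<delta> + 1) + (N + b) / (\<mu> + 1) = N - 2}"

definition above_hyperbola :: "real \<Rightarrow> real \<Rightarrow> real \<Rightarrow> (real \<times> real) set" where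
  "above_hyperbola N a b = {(\<delta>, \<mu>). (N + a) / (\<delta> + 1) + (N + b) / (\<mu> + 1) < N - 2}"

definition under_hyperbola :: "real \<Rightarrow> real \<Rightarrow> real \<Rightarrow> (real \<times> real) set" where
  "under_hyperbola N a b = {(\<delta>, \<mu>). (N + a) / (\<delta> + 1) + (N + b) / (\<mu> + 1) > N - 2}"

definition scaling_gamma :: "real \<Rightarrow> real \<Rightarrow> real \<Rightarrow> real \<Rightarrow> real" where
  "scaling_gamma a b \<delta> \<mu> = ((2 + a) + (2 + b) * \<delta>) / (\<delta> * \<mu> - 1)"

definition scaling_xi :: "real \<Rightarrow> real \<Rightarrow> real \<Rightarrow> real \<Rightarrow> real" where
  "scaling_xi a b \<delta> \<mu> = ((2 + b) + (2 + a) * \<mu>) / (\<delta> * \<mu> - 1)"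

end

theory Submission
  imports Defs
begin

text \<open>
  Put n = N, p = r^(n-1) u' and q = r^(n-1) v'. For radial functions the system becomes the
  first-order system u' = r^(1-n) p, p' = - r^(n-1+a) v^\<delta>, v' = r^(1-n) q, q' = - r^(n-1+b) u^\<mu>, and a
  solution that stays bounded at the origin has p, q \<rightarrow> 0 there
  (no_fundamental_singularity, flux_form). This is the locale radial_system; it is
  symmetric under exchanging (u, a, \<delta>) with (v, b, \<mu>), and most facts are proved for u only.

  Parts (i) and (ii) express one alternative. Shooting produces, for all
  exponents, either a ground state or a Dirichlet solution in some ball (shooting_dichotomy), and
  each of the two objects restricts the sign of
  \<sigma> = (N+a)/(\<delta>+1) + (N+b)/(\<mu>+1) - (N-2). The reason is the Pohozaev energy E: it vanishes at the
  origin and E' = \<sigma> r^(1-n) p q with p q > 0. At the boundary of a ball E is positive, so a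
  Dirichlet solution needs \<sigma> > 0 (dirichlet_imp_excess_pos). A ground state decays at least like
  r^(-\<gamma>), r^(-\<xi>), and if \<sigma> > 0 this makes E tend to 0 at infinity, which an increasing energy
  with E > 0 cannot do; hence \<sigma> \<le> 0 (excess_nonpos). Scaling moves a Dirichlet solution to any ball.

  The shooting itself rests on monotonicity. With u(0) = 1 and v(0) = s, the integral equations
  give u as a decreasing function of v and v as a decreasing function of u, so that v is a
  fixed point of an increasing map, obtained by iteration from above. The fixed point increases with s, u
  vanishes first for large s and v vanishes first for small s, and at the threshold neither happens.
  The same sign structure gives uniqueness: if two ground states agree in u(0) and differ in v(0),
  the difference of the second components never shrinks, although both tend to 0.

  For (iii), \<sigma> = 0 forces E = 0. In t = ln r put U = r^\<gamma> u, V = r^\<xi> v, x = - U'/U, y = - V'/V. This is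
  an autonomous flow (locale critical_flow) with the first integral E = 0. The plane is cut into the four sign
  quadrants of (x, y). The functions x u and y v solve the linearised equations, whose sign structure makes the
  quadrants with x y < 0 either transient or final, and E = 0 excludes that any quadrant but
  x, y > 0 is final, or that this one is left again. From then on U and V decrease to 0, and x \<rightarrow> \<xi> follows when \<delta> > (N+a)/(N-2); the
  exponential rate makes r^(N-2) u converge (U_fundamental_decay). Integrating the equation of v
  with this asymptotics of u gives the three cases for v.
\<close>

section \<open>Calculus on the real line\<close>

lemma first_zero:
  fixes f :: "real \<Rightarrow> real"
  assumes "a \<le> b" and cont: "continuous_on {a..b} f" and "f a > 0" and "f b \<le> 0"
  obtains c where "a < c" "c \<le> b" "f c = 0" "\<And>t. a \<le> t \<Longrightarrow> t < c \<Longrightarrow> f t > 0"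
proof -
  define S where "S = {t \<in> {a..b}. f t \<le> 0}"
  have "closed S" unfolding S_def
    using continuous_closed_preimage[OF cont, of "{..0}"]
    by (simp add: vimage_def Int_def conj_commute)
  moreover have "bdd_below S" "S \<noteq> {}" using assms by (auto simp: S_def)
  ultimately have "Inf S \<in> S" using closed_contains_Inf by blast
  then obtain m where m: "m \<in> S" "\<And>t. t \<in> S \<Longrightarrow> m \<le> t"
    using cInf_lower[OF _ \<open>bdd_below S\<close>] by blast
  then have mab: "a \<le> m" "m \<le> b" "f m \<le> 0" by (auto simp: S_def)
  have less: "f t > 0" if "a \<le> t" "t < m" for t
    using m(2)[of t] that mab by (force simp: S_def)
  have "a < m" using mab assms(3) by (metis less_eq_real_def not_less)
  have "f m = 0"
  proof (rule ccontr)
    assume "f m \<noteq> 0"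
    with mab have n: "f m < 0" by simp
    have "continuous_on {a..m} f" using cont mab by (auto intro: continuous_on_subset)
    then obtain z where z: "a \<le> z" "z \<le> m" "f z = 0"
      using IVT2'[of f m 0 a] n assms(3) mab by auto
    with n less[of z] show False by (cases "z = m") auto
  qed
  show ?thesis by (rule that[OF \<open>a < m\<close> mab(2) \<open>f m = 0\<close> less])
qed

lemma deriv_nonneg_imp_le:
  fixes f :: "real \<Rightarrow> real"
  assumes "a \<le> b" "continuous_on {a..b} f"
    and "\<And>t. a < t \<Longrightarrow> t < b \<Longrightarrow> (f has_real_derivative f' t) (at t)"
    and "\<And>t. a < t \<Longrightarrow> t < b \<Longrightarrow> 0 \<le> f' t"
  shows "f a \<le> f b"
  using DERIV_nonneg_imp_increasing_open[of a b f] assms by blast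

lemma deriv_pos_imp_less:
  fixes f :: "real \<Rightarrow> real"
  assumes "a < b" "continuous_on {a..b} f"
    and "\<And>t. a < t \<Longrightarrow> t < b \<Longrightarrow> (f has_real_derivative f' t) (at t)"
    and "\<And>t. a < t \<Longrightarrow> t < b \<Longrightarrow> 0 < f' t"
  shows "f a < f b"
  using DERIV_pos_imp_increasing_open[of a b f] assms by blast

lemma deriv_nonneg_imp_le_closed:
  fixes f :: "real \<Rightarrow> real"
  assumes "a \<le> b"
    and "\<And>t. a \<le> t \<Longrightarrow> t \<le> b \<Longrightarrow> (f has_real_derivative f' t) (at t)"
    and "\<And>t. a \<le> t \<Longrightarrow> t \<le> b \<Longrightarrow> 0 \<le> f' t"
  shows "f a \<le> f b"
  using DERIV_nonneg_imp_nondecreasing[of a b f] assms by blast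

lemma incr_bounded_tendsto:
  fixes f :: "real \<Rightarrow> real"
  assumes mono: "\<And>s t. T \<le> s \<Longrightarrow> s \<le> t \<Longrightarrow> f s \<le> f t"
    and bdd: "\<And>t. T \<le> t \<Longrightarrow> f t \<le> M"
  obtains l where "(f \<longlongrightarrow> l) at_top" "\<And>t. T \<le> t \<Longrightarrow> f t \<le> l"
proof -
  have b: "bdd_above (f ` {T..})" using bdd by (auto intro!: bdd_aboveI)
  define l where "l = (SUP t\<in>{T..}. f t)"
  have le: "f t \<le> l" if "T \<le> t" for t
    unfolding l_def by (rule cSUP_upper) (use that b in auto)
  have "(f \<longlongrightarrow> l) at_top"
  proof (rule increasing_tendsto)
    show "\<forall>\<^sub>F n in at_top. f n \<le> l" using le eventually_ge_at_top by (rule eventually_mono[rotated])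
    fix x assume "x < l"
    then obtain s where "s \<ge> T" "x < f s" unfolding l_def using less_cSUP_iff[OF _ b] by auto
    then have "\<forall>n\<ge>s. x < f n" using mono by (meson less_le_trans)
    then show "\<forall>\<^sub>F n in at_top. x < f n" by (auto simp: eventually_at_top_linorder)
  qed
  with le that show ?thesis by blast
qed

lemma decr_bounded_tendsto:
  fixes f :: "real \<Rightarrow> real"
  assumes "\<And>s t. T \<le> s \<Longrightarrow> s \<le> t \<Longrightarrow> f t \<le> f s"
    and "\<And>t. T \<le> t \<Longrightarrow> M \<le> f t"
  obtains l where "(f \<longlongrightarrow> l) at_top" "\<And>t. T \<le> t \<Longrightarrow> l \<le> f t"
proof -
  obtain l where "((\<lambda>t. - f t) \<longlongrightarrow> l) at_top" "\<And>t. T \<le> t \<Longrightarrow> - f t \<le> l"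
    using incr_bounded_tendsto[of T "\<lambda>t. - f t" "- M"] assms by auto
  then have "(f \<longlongrightarrow> - l) at_top" "\<And>t. T \<le> t \<Longrightarrow> - l \<le> f t"
    using tendsto_minus[of "\<lambda>t. - f t" l at_top] by (auto simp: minus_le_iff)
  with that show ?thesis by blast
qed

lemma continuous_on_tendsto_at_left:
  fixes f :: "real \<Rightarrow> real"
  assumes "continuous_on {0..R} f" "R > 0" shows "(f \<longlongrightarrow> f R) (at_left R)"
proof -
  have "(f \<longlongrightarrow> f R) (at R within {0..R})"
    using assms(1) unfolding continuous_on_def by (rule bspec) (use assms(2) in simp)
  moreover have "at R within {0..R} = at_left R"
    by (rule at_within_nhd[of _ "{0<..}"]) (use assms in auto)
  ultimately show ?thesis by simp
qed

text \<open>By the mean value theorem, a derivative close to c \<noteq> 0 makes f grow linearly.\<close>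
lemma bounded_imp_deriv_limit_zero:
  fixes f :: "real \<Rightarrow> real"
  assumes d: "\<And>t. (f has_real_derivative f' t) (at t)"
    and lim: "(f' \<longlongrightarrow> c) at_top" and bdd: "\<And>t. \<bar>f t\<bar> \<le> M"
  shows "c = 0"
proof (rule ccontr)
  assume "c \<noteq> 0"
  then have "\<forall>\<^sub>F t in at_top. \<bar>f' t - c\<bar> < \<bar>c\<bar> / 2"
    using tendstoD[OF lim, of "\<bar>c\<bar> / 2"] by (simp add: dist_real_def)
  then obtain T where T: "\<And>t. t \<ge> T \<Longrightarrow> \<bar>f' t - c\<bar> < \<bar>c\<bar> / 2"
    by (auto simp: eventually_at_top_linorder)
  define h where "h = (4 * M + 4) / \<bar>c\<bar>"
  have "M \<ge> 0" using bdd[of 0] by linarith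
  then have h: "h > 0" using \<open>c \<noteq> 0\<close> by (simp add: h_def)
  obtain z where z: "z > T" "f (T + h) - f T = h * f' z"
    using MVT2[of T "T + h" f f'] d h by auto
  have "\<bar>f' z\<bar> > \<bar>c\<bar> / 2" using T[of z] z by linarith
  then have "h * (\<bar>c\<bar> / 2) < h * \<bar>f' z\<bar>" using h by simp
  also have "\<dots> = \<bar>f (T + h) - f T\<bar>" using z h by (simp add: abs_mult)
  also have "\<dots> \<le> 2 * M" using bdd[of "T + h"] bdd[of T] by linarith
  finally have "h * (\<bar>c\<bar> / 2) < 2 * M" .
  moreover have "h * (\<bar>c\<bar> / 2) = 2 * M + 2" using \<open>c \<noteq> 0\<close> by (simp add: h_def)
  ultimately show False by simp
qed

text \<open>A function that decreases at a definite rate whenever it is at least c must fall below c, and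
  can then not cross this level again.\<close>
lemma eventually_below_of_deriv_neg:
  fixes f :: "real \<Rightarrow> real"
  assumes d: "\<And>t. (f has_real_derivative f' t) (at t)"
    and neg: "\<And>t. t \<ge> T \<Longrightarrow> f t \<ge> c \<Longrightarrow> f' t \<le> - k" and k: "k > 0"
  shows "\<forall>\<^sub>F t in at_top. f t < c"
proof -
  have cont: "continuous_on A f" for A
    using d by (meson DERIV_isCont continuous_at_imp_continuous_on)
  have "\<exists>t1\<ge>T. f t1 < c"
  proof (rule ccontr)
    assume "\<not> ?thesis"
    then have ge: "\<And>t. t \<ge> T \<Longrightarrow> f t \<ge> c" by force
    define h where "h = (f T - c + 1) / k"
    have h: "h > 0" using ge[of T] k by (simp add: h_def)
    obtain z where z: "z > T" "f (T + h) - f T = h * f' z"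
      using MVT2[of T "T + h" f f'] d h by auto
    have "h * f' z \<le> h * (- k)" using neg[of z] ge[of z] z h by (intro mult_left_mono) auto
    also have "\<dots> = - (f T - c + 1)" using k by (simp add: h_def)
    finally have "f (T + h) < c" using z by linarith
    with ge[of "T + h"] h show False by simp
  qed
  then obtain t1 where t1: "t1 \<ge> T" "f t1 < c" by blast
  have "f t < c" if "t \<ge> t1" for t
  proof (rule ccontr)
    assume "\<not> f t < c"
    have cont': "continuous_on {t1..t} (\<lambda>r. c - f r)" by (intro continuous_intros cont)
    have "0 < c - f t1" "c - f t \<le> 0" using t1 \<open>\<not> f t < c\<close> by auto
    then obtain s where "t1 < s" "s \<le> t" "c - f s = 0"
        "\<And>r. t1 \<le> r \<Longrightarrow> r < s \<Longrightarrow> 0 < c - f r"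
      using first_zero[OF \<open>t \<ge> t1\<close> cont'] by blast
    then have s: "t1 < s" "f s = c" "\<And>r. t1 \<le> r \<Longrightarrow> r < s \<Longrightarrow> f r < c" by auto
    have "f' s < 0" using neg[of s] s t1 k by simp
    from DERIV_neg_dec_left[OF d this] obtain e where e: "e > 0" "\<And>h. 0 < h \<Longrightarrow> h < e \<Longrightarrow> f s < f (s - h)"
      by blast
    define h where "h = min (e / 2) (s - t1)"
    have "h > 0" "h < e" "t1 \<le> s - h" using e s by (auto simp: h_def)
    then show False using e(2)[of h] s(3)[of "s - h"] s(2) by auto
  qed
  then show ?thesis by (auto simp: eventually_at_top_linorder)
qed

text \<open>The equation f' = k f - g expels solutions from its equilibrium g / k at the rate exp (k t). A function that
  is still below M after time L therefore started at most M exp (- k L) above it.\<close>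
lemma repelling_bound:
  fixes f :: "real \<Rightarrow> real"
  assumes d: "\<And>s. (f has_real_derivative f' s) (at s)"
    and ge: "\<And>s. t \<le> s \<Longrightarrow> s \<le> t + L \<Longrightarrow> f' s \<ge> k * f s - g"
    and "k > 0" "L \<ge> 0" "g \<ge> 0" "f (t + L) \<le> M"
  shows "f t \<le> g / k + M * exp (- k * L)"
proof -
  define h where "h s = (f s - g / k) * exp (- k * (s - t))" for s
  have dh: "(h has_real_derivative exp (- k * (s - t)) * (f' s - k * f s + g)) (at s)" for s
    unfolding h_def using \<open>k > 0\<close>
    by (auto intro!: derivative_eq_intros d simp: field_simps)
  have "h t \<le> h (t + L)"
  proof (rule deriv_nonneg_imp_le_closed[OF _ dh])
    show "0 \<le> exp (- k * (s - t)) * (f' s - k * f s + g)" if "t \<le> s" "s \<le> t + L" for s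
      using ge[OF that] by simp
  qed (use \<open>L \<ge> 0\<close> in simp)
  then have "f t - g / k \<le> (f (t + L) - g / k) * exp (- k * L)" by (simp add: h_def)
  also have "\<dots> \<le> M * exp (- k * L)"
  proof (rule mult_right_mono)
    have "0 \<le> g / k" using assms by simp
    then show "f (t + L) - g / k \<le> M" using \<open>f (t + L) \<le> M\<close> by linarith
  qed simp
  finally show ?thesis by simp
qed

lemma repelling_bound_infinite:
  fixes f :: "real \<Rightarrow> real"
  assumes d: "\<And>s. (f has_real_derivative f' s) (at s)"
    and ge: "\<And>s. t \<le> s \<Longrightarrow> f' s \<ge> k * f s - g"
    and "k > 0" "g \<ge> 0" and bdd: "\<And>s. f s \<le> M"
  shows "f t \<le> g / k"
proof -
  have lim: "((\<lambda>L. g / k + M * exp (- k * L)) \<longlongrightarrow> g / k + M * 0) at_top"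
    using \<open>k > 0\<close> by (intro tendsto_intros filterlim_compose[OF exp_at_bot]
       filterlim_tendsto_neg_mult_at_bot[OF tendsto_const _ filterlim_ident]) auto
  have "\<forall>\<^sub>F L in at_top. f t \<le> g / k + M * exp (- k * L)"
    using eventually_ge_at_top[of 0]
    by eventually_elim (rule repelling_bound[OF d], use assms in auto)
  from tendsto_lowerbound[OF lim this] show ?thesis by simp
qed

text \<open>L'Hospital's rule for 0/0 at infinity: since g' < 0, the functions f - (l + \<epsilon>) g and
  - f - (- l + \<epsilon>) g are eventually increasing with limit 0, hence nonpositive.\<close>
lemma tendsto_ratio_at_top_of_zero:
  fixes f g :: "real \<Rightarrow> real"
  assumes d: "\<forall>\<^sub>F t in at_top. (f has_real_derivative f' t) (at t)"
      "\<forall>\<^sub>F t in at_top. (g has_real_derivative g' t) (at t)"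
    and neg: "\<forall>\<^sub>F t in at_top. g' t < 0" "\<forall>\<^sub>F t in at_top. g t > 0"
    and lim: "(f \<longlongrightarrow> 0) at_top" "(g \<longlongrightarrow> 0) at_top"
    and ratio: "((\<lambda>t. f' t / g' t) \<longlongrightarrow> l) at_top"
  shows "((\<lambda>t. f t / g t) \<longlongrightarrow> l) at_top"
proof -
  have side: "\<forall>\<^sub>F t in at_top. F t \<le> (l + e) * g t"
    if F: "\<forall>\<^sub>F t in at_top. (F has_real_derivative F' t) (at t)" "(F \<longlongrightarrow> 0) at_top"
      "((\<lambda>t. F' t / g' t) \<longlongrightarrow> l) at_top" and "e > 0" for F F' l and e :: real
  proof -
    have "\<forall>\<^sub>F t in at_top. F' t / g' t < l + e" using F(3) by (rule order_tendstoD) (use \<open>e > 0\<close> in simp)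
    with F(1) d(2) neg have "\<forall>\<^sub>F t in at_top. (F has_real_derivative F' t) (at t) \<and>
      (g has_real_derivative g' t) (at t) \<and> F' t \<ge> (l + e) * g' t"
    proof eventually_elim
      case (elim t) then show ?case by (auto simp: divide_less_eq)
    qed
    then obtain T where T: "\<And>t. t \<ge> T \<Longrightarrow> (F has_real_derivative F' t) (at t)"
      "\<And>t. t \<ge> T \<Longrightarrow> (g has_real_derivative g' t) (at t)" "\<And>t. t \<ge> T \<Longrightarrow> F' t \<ge> (l + e) * g' t"
      by (auto simp: eventually_at_top_linorder)
    have dh: "((\<lambda>t. F t - (l + e) * g t) has_real_derivative F' t - (l + e) * g' t) (at t)" if "t \<ge> T" for t
      using T that by (auto intro!: derivative_eq_intros)
    have mono: "F t - (l + e) * g t \<le> F s - (l + e) * g s" if "T \<le> t" "t \<le> s" for t s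
    proof (rule deriv_nonneg_imp_le_closed[OF that(2) dh])
      show "0 \<le> F' r - (l + e) * g' r" if "t \<le> r" for r
        using T(3)[of r] that \<open>T \<le> t\<close> by simp
    qed (use that in simp)
    have "((\<lambda>t. F t - (l + e) * g t) \<longlongrightarrow> 0 - (l + e) * 0) at_top"
      using F lim by (intro tendsto_intros)
    then have "F t - (l + e) * g t \<le> 0" if "T \<le> t" for t
      using mono[OF that]
      by (intro tendsto_lowerbound[where F = at_top and f = "\<lambda>t. F t - (l + e) * g t" and x = 0])
         (auto simp: eventually_at_top_linorder)
    then show ?thesis by (auto simp: eventually_at_top_linorder)
  qed
  show ?thesis
  proof (rule tendstoI)
    fix e :: real assume "e > 0"
    have "\<forall>\<^sub>F t in at_top. f t \<le> (l + e/2) * g t"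
      using side[OF d(1) lim(1) ratio] \<open>e > 0\<close> by simp
    moreover have "\<forall>\<^sub>F t in at_top. - f t \<le> (- l + e/2) * g t"
    proof (rule side)
      show "\<forall>\<^sub>F t in at_top. ((\<lambda>t. - f t) has_real_derivative - f' t) (at t)"
        using d(1) by eventually_elim (auto intro!: derivative_eq_intros)
      show "((\<lambda>t. - f t) \<longlongrightarrow> 0) at_top" using tendsto_minus[OF lim(1)] by simp
      show "((\<lambda>t. - f' t / g' t) \<longlongrightarrow> - l) at_top" using tendsto_minus[OF ratio] by simp
    qed (use \<open>e > 0\<close> in auto)
    ultimately show "\<forall>\<^sub>F t in at_top. dist (f t / g t) l < e" using neg(2)
    proof eventually_elim
      case (elim t)
      then have "f t / g t \<le> l + e/2" "l - e/2 \<le> f t / g t"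
        by (auto simp: field_simps)
      with \<open>e > 0\<close> show ?case by (simp add: dist_real_def abs_less_iff) 
    qed
  qed
qed

section \<open>Radial solutions in flux form and the Pohozaev energy\<close>

text \<open>Here n is the dimension and p, q are the fluxes r^(n-1) u', r^(n-1) v'. The condition p = q = 0 at the origin
  replaces regularity there. The endpoint R is extended so that balls and the whole space are treated together.\<close>
locale radial_system =
  fixes n a b \<delta> \<mu> :: real and R :: ereal and u v p q :: "real \<Rightarrow> real"
  assumes n: "n > 2" and ab: "a > -2" "b > -2" and \<delta>\<mu>: "\<delta> > 0" "\<mu> > 0"
    and cont: "continuous_on {r. 0 \<le> r \<and> ereal r < R} u" "continuous_on {r. 0 \<le> r \<and> ereal r < R} v"
      "continuous_on {r. 0 \<le> r \<and> ereal r < R} p" "continuous_on {r. 0 \<le> r \<and> ereal r < R} q"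
    and pq0: "p 0 = 0" "q 0 = 0"
    and pos: "0 \<le> r \<Longrightarrow> ereal r < R \<Longrightarrow> 0 < u r" "0 \<le> r \<Longrightarrow> ereal r < R \<Longrightarrow> 0 < v r"
    and du: "0 < r \<Longrightarrow> ereal r < R \<Longrightarrow> (u has_real_derivative r powr (1 - n) * p r) (at r)"
    and dv: "0 < r \<Longrightarrow> ereal r < R \<Longrightarrow> (v has_real_derivative r powr (1 - n) * q r) (at r)"
    and dp: "0 < r \<Longrightarrow> ereal r < R \<Longrightarrow> (p has_real_derivative - (r powr (n - 1 + a) * v r powr \<delta>)) (at r)"
    and dq: "0 < r \<Longrightarrow> ereal r < R \<Longrightarrow> (q has_real_derivative - (r powr (n - 1 + b) * u r powr \<mu>)) (at r)"

lemma radial_system_swap: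
  "radial_system n a b \<delta> \<mu> R u v p q \<Longrightarrow> radial_system n b a \<mu> \<delta> R v u q p"
proof -
  assume "radial_system n a b \<delta> \<mu> R u v p q"
  then interpret radial_system n a b \<delta> \<mu> R u v p q .
  show ?thesis
    by unfold_locales (rule n ab \<delta>\<mu> cont pq0 pos du dv dp dq; assumption)+
qed

lemma continuous_on_powr_const:
  fixes k :: real
  assumes "k > 0" "S \<subseteq> {0..}" shows "continuous_on S (\<lambda>s. s powr k)"
  using assms by (intro continuous_on_powr' continuous_intros) auto

lemma deriv_powr_antideriv:
  fixes s k m :: real
  assumes "s > 0" "k > 0" shows "((\<lambda>s. m * s powr k / k) has_real_derivative m * s powr (k - 1)) (at s)"
  using assms by (auto intro!: derivative_eq_intros)

lemma deriv_powr_comp: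
  fixes f :: "real \<Rightarrow> real"
  assumes "(f has_real_derivative d) (at s)" "f s > 0"
  shows "((\<lambda>s. f s powr k) has_real_derivative k * f s powr (k - 1) * d) (at s)"
  using DERIV_chain2[OF has_real_derivative_powr[OF assms(2)] assms(1)] .

context radial_system
begin

lemma cont_sub:
  assumes "0 \<le> s" "ereal t < R"
  shows "continuous_on {s..t} u" "continuous_on {s..t} v" "continuous_on {s..t} p" "continuous_on {s..t} q"
proof -
  have "{s..t} \<subseteq> {r. 0 \<le> r \<and> ereal r < R}"
    using assms by (auto intro: le_less_trans[of _ "ereal t"])
  then show "continuous_on {s..t} u" "continuous_on {s..t} v" "continuous_on {s..t} p" "continuous_on {s..t} q"
    using cont continuous_on_subset by blast+
qed

lemma less_R: "s \<le> t \<Longrightarrow> ereal t < R \<Longrightarrow> ereal s < R"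
  by (rule le_less_trans[of _ "ereal t"]) auto

text \<open>The flux at r is minus the integral of s^(n-1+a) v^\<delta> over (0, r); this and the next lemma
  compare it with the integral for constant v^\<delta>.\<close>
lemma flux_ge:
  assumes r: "0 \<le> r" "ereal r < R" and m: "\<And>s. 0 < s \<Longrightarrow> s < r \<Longrightarrow> m \<le> v s powr \<delta>"
  shows "m * r powr (n + a) / (n + a) \<le> - p r"
proof -
  have "- p 0 - m * 0 powr (n + a) / (n + a) \<le> - p r - m * r powr (n + a) / (n + a)"
  proof (rule deriv_nonneg_imp_le[OF r(1)])
    show "continuous_on {0..r} (\<lambda>s. - p s - m * s powr (n + a) / (n + a))"
      using n ab by (intro continuous_intros cont_sub r continuous_on_powr_const) auto
    fix s assume s: "0 < s" "s < r"
    then have "ereal s < R" using r less_R[of s r] by simp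
    with s show "((\<lambda>s. - p s - m * s powr (n + a) / (n + a)) has_real_derivative
        s powr (n - 1 + a) * (v s powr \<delta> - m)) (at s)"
      using n ab by (intro DERIV_cong[OF DERIV_diff[OF DERIV_minus[OF dp] deriv_powr_antideriv]])
        (auto simp: algebra_simps)
    show "0 \<le> s powr (n - 1 + a) * (v s powr \<delta> - m)" using m[OF s] by simp
  qed
  then show ?thesis using n ab pq0 by simp
qed

lemma flux_le:
  assumes r: "0 \<le> r" "ereal r < R" and m: "\<And>s. 0 < s \<Longrightarrow> s < r \<Longrightarrow> v s powr \<delta> \<le> m"
  shows "- p r \<le> m * r powr (n + a) / (n + a)"
proof -
  have "p 0 + m * 0 powr (n + a) / (n + a) \<le> p r + m * r powr (n + a) / (n + a)"
  proof (rule deriv_nonneg_imp_le[OF r(1)])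
    show "continuous_on {0..r} (\<lambda>s. p s + m * s powr (n + a) / (n + a))"
      using n ab by (intro continuous_intros cont_sub r continuous_on_powr_const) auto
    fix s assume s: "0 < s" "s < r"
    then have "ereal s < R" using r less_R[of s r] by simp
    with s show "((\<lambda>s. p s + m * s powr (n + a) / (n + a)) has_real_derivative
        s powr (n - 1 + a) * (m - v s powr \<delta>)) (at s)"
      using n ab by (intro DERIV_cong[OF DERIV_add[OF dp deriv_powr_antideriv]])
        (auto simp: algebra_simps)
    show "0 \<le> s powr (n - 1 + a) * (m - v s powr \<delta>)" using m[OF s] by simp
  qed
  then show ?thesis using n ab pq0 by simp
qed

lemma p_neg: assumes r: "0 < r" "ereal r < R" shows "p r < 0"
proof -
  have "- p 0 < - p r"
  proof (rule deriv_pos_imp_less[OF r(1)])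
    show "continuous_on {0..r} (\<lambda>s. - p s)" by (intro continuous_intros cont_sub r) auto
    fix s assume s: "0 < s" "s < r"
    then have sR: "ereal s < R" using r less_R[of s r] by simp
    show "((\<lambda>s. - p s) has_real_derivative s powr (n - 1 + a) * v s powr \<delta>) (at s)"
      using DERIV_minus[OF dp[OF s(1) sR]] by simp
    show "0 < s powr (n - 1 + a) * v s powr \<delta>" using s sR pos(2)[of s] by simp
  qed
  then show ?thesis using pq0 by simp
qed

lemma p_antimono: assumes r: "0 \<le> s" "s \<le> r" "ereal r < R" shows "p r \<le> p s"
proof -
  have "- p s \<le> - p r"
  proof (rule deriv_nonneg_imp_le[OF r(2)])
    show "continuous_on {s..r} (\<lambda>s. - p s)" by (intro continuous_intros cont_sub r) 
    fix t assume t: "s < t" "t < r"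
    then have tR: "ereal t < R" using r less_R[of t r] by simp
    show "((\<lambda>s. - p s) has_real_derivative t powr (n - 1 + a) * v t powr \<delta>) (at t)"
      using DERIV_minus[OF dp[OF _ tR]] t r by simp
  qed simp
  then show ?thesis by simp
qed

lemma u_antimono: assumes r: "0 \<le> s" "s \<le> r" "ereal r < R" shows "u r \<le> u s"
proof -
  have "- u s \<le> - u r"
  proof (rule deriv_nonneg_imp_le[OF r(2)])
    show "continuous_on {s..r} (\<lambda>s. - u s)" by (intro continuous_intros cont_sub r) 
    fix t assume t: "s < t" "t < r"
    then have tR: "ereal t < R" using r less_R[of t r] by simp
    show "((\<lambda>s. - u s) has_real_derivative - (t powr (1 - n) * p t)) (at t)"
      using DERIV_minus[OF du[OF _ tR]] t r by simp
    show "0 \<le> - (t powr (1 - n) * p t)" using p_neg[OF _ tR] t r by (simp add: mult_le_0_iff)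
  qed
  then show ?thesis by simp
qed

lemma swapped: "radial_system n b a \<mu> \<delta> R v u q p"
  by (rule radial_system_swap) unfold_locales

lemma v_antimono: assumes r: "0 \<le> s" "s \<le> r" "ereal r < R" shows "v r \<le> v s"
  using radial_system.u_antimono[OF swapped r] .

lemma flux_upper: assumes r: "0 \<le> r" "ereal r < R"
  shows "- p r \<le> v 0 powr \<delta> * r powr (n + a) / (n + a)"
proof (rule flux_le[OF r])
  fix s assume s: "0 < s" "s < r"
  then have "ereal s < R" using less_R[of s r] r by simp
  then show "v s powr \<delta> \<le> v 0 powr \<delta>"
    using pos(2)[of s] v_antimono[of 0 s] s \<delta>\<mu> by (intro powr_mono2) auto
qed

text \<open>The Pohozaev functional. Its last two terms are those that turn the derivative into
  a multiple of the single product u' v'.\<close>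
definition energy :: "real \<Rightarrow> real" where
  "energy r = r powr (2 - n) * p r * q r
     + r powr (n + b) * u r powr (\<mu> + 1) / (\<mu> + 1) + r powr (n + a) * v r powr (\<delta> + 1) / (\<delta> + 1)
     + (n + a) / (\<delta> + 1) * v r * p r + (n + b) / (\<mu> + 1) * u r * q r"

text \<open>Positive, zero or negative according to whether (\<delta>, \<mu>) is under, on or above the
  critical hyperbola.\<close>
definition excess :: real where "excess = (n + a) / (\<delta> + 1) + (n + b) / (\<mu> + 1) + 2 - n"

lemma energy_deriv:
  assumes r: "0 < r" "ereal r < R"
  shows "(energy has_real_derivative excess * (r powr (1 - n) * p r * q r)) (at r)"
proof -
  have u: "u r > 0" "v r > 0" using pos[of r] r by auto
  have d1: "((\<lambda>r. r powr (2 - n) * p r * q r) has_real_derivative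
      (2 - n) * r powr (1 - n) * p r * q r
      - r powr (1 + a) * v r powr \<delta> * q r - r powr (1 + b) * u r powr \<mu> * p r) (at r)"
    using r by (auto intro!: derivative_eq_intros dp dq simp: algebra_simps simp flip: powr_add)
  have d2: "((\<lambda>r. r powr (n + b) * u r powr (\<mu> + 1) / (\<mu> + 1)) has_real_derivative
      (n + b) / (\<mu> + 1) * r powr (n - 1 + b) * u r powr (\<mu> + 1) + r powr (1 + b) * u r powr \<mu> * p r) (at r)"
  proof -
    have F: "((\<lambda>r. r powr (n + b) * u r powr (\<mu> + 1)) has_real_derivative
        (\<mu> + 1) * u r powr (\<mu> + 1 - 1) * (r powr (1 - n) * p r) * r powr (n + b)
        + (n + b) * r powr (n + b - 1) * u r powr (\<mu> + 1)) (at r)"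
      using DERIV_mult[OF has_real_derivative_powr[OF r(1), of "n + b"] deriv_powr_comp[OF du[OF r] u(1), of "\<mu> + 1"]]
      by (simp add: add.commute)
    have E0: "r powr (n + b) * r powr (1 - n) = r powr (1 + b)" by (simp add: add.commute flip: powr_add)
    have E1: "(\<mu> + 1) * u r powr (\<mu> + 1 - 1) * (r powr (1 - n) * p r) * r powr (n + b)
        = (\<mu> + 1) * (r powr (1 + b) * u r powr \<mu> * p r)" using E0 by (simp add: mult_ac)
    have E2: "n + b - 1 = n - 1 + b" by simp
    have "((\<lambda>r. r powr (n + b) * u r powr (\<mu> + 1)) has_real_derivative
        (\<mu> + 1) * (r powr (1 + b) * u r powr \<mu> * p r) + (n + b) * r powr (n - 1 + b) * u r powr (\<mu> + 1)) (at r)"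
      using F unfolding E1 E2 .
    from DERIV_cdivide[OF this, of "\<mu> + 1"] show ?thesis
      by (rule DERIV_cong) (use \<delta>\<mu> in \<open>simp add: field_simps\<close>)
  qed
  have d3: "((\<lambda>r. r powr (n + a) * v r powr (\<delta> + 1) / (\<delta> + 1)) has_real_derivative
      (n + a) / (\<delta> + 1) * r powr (n - 1 + a) * v r powr (\<delta> + 1) + r powr (1 + a) * v r powr \<delta> * q r) (at r)"
  proof -
    have F: "((\<lambda>r. r powr (n + a) * v r powr (\<delta> + 1)) has_real_derivative
        (\<delta> + 1) * v r powr (\<delta> + 1 - 1) * (r powr (1 - n) * q r) * r powr (n + a)
        + (n + a) * r powr (n + a - 1) * v r powr (\<delta> + 1)) (at r)"
      using DERIV_mult[OF has_real_derivative_powr[OF r(1), of "n + a"] deriv_powr_comp[OF dv[OF r] u(2), of "\<delta> + 1"]]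
      by (simp add: add.commute)
    have E0: "r powr (n + a) * r powr (1 - n) = r powr (1 + a)" by (simp add: add.commute flip: powr_add)
    have E1: "(\<delta> + 1) * v r powr (\<delta> + 1 - 1) * (r powr (1 - n) * q r) * r powr (n + a)
        = (\<delta> + 1) * (r powr (1 + a) * v r powr \<delta> * q r)" using E0 by (simp add: mult_ac)
    have E2: "n + a - 1 = n - 1 + a" by simp
    have "((\<lambda>r. r powr (n + a) * v r powr (\<delta> + 1)) has_real_derivative
        (\<delta> + 1) * (r powr (1 + a) * v r powr \<delta> * q r) + (n + a) * r powr (n - 1 + a) * v r powr (\<delta> + 1)) (at r)"
      using F unfolding E1 E2 .
    from DERIV_cdivide[OF this, of "\<delta> + 1"] show ?thesis
      by (rule DERIV_cong) (use \<delta>\<mu> in \<open>simp add: field_simps\<close>)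
  qed
  have d4: "((\<lambda>r. k * v r * p r) has_real_derivative
      k * (r powr (1 - n) * p r * q r) - k * r powr (n - 1 + a) * v r powr (\<delta> + 1)) (at r)" for k
    using r u by (auto intro!: derivative_eq_intros dv dp simp: powr_add algebra_simps)
  have d5: "((\<lambda>r. k * u r * q r) has_real_derivative
      k * (r powr (1 - n) * p r * q r) - k * r powr (n - 1 + b) * u r powr (\<mu> + 1)) (at r)" for k
    using r u by (auto intro!: derivative_eq_intros du dq simp: powr_add algebra_simps)
  show ?thesis
    unfolding energy_def[abs_def] excess_def
    by (rule DERIV_cong[OF DERIV_add[OF DERIV_add[OF DERIV_add[OF DERIV_add[OF d1 d2] d3] d4] d5]])
       (simp add: algebra_simps)
qed

lemma energy_0: "energy 0 = 0" by (simp add: energy_def pq0)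

text \<open>Only the product p q needs an argument at the origin, because of its singular factor; there
  |p| is at most a multiple of r^(n+a) and a > -2.\<close>
lemma energy_continuous:
  assumes r: "0 \<le> r" "ereal r < R" shows "continuous_on {0..r} energy"
proof -
  have flux: "continuous_on {0..r} (\<lambda>s. s powr (2 - n) * p s * q s)"
    unfolding continuous_on_def
  proof (intro ballI)
    fix s assume s: "s \<in> {0..r}"
    then have sR: "ereal s < R" using less_R[of s r] r by simp
    show "((\<lambda>s. s powr (2 - n) * p s * q s) \<longlongrightarrow> s powr (2 - n) * p s * q s) (at s within {0..r})"
    proof (cases "s = 0")
      case False
      have "(p \<longlongrightarrow> p s) (at s within {0..r})" "(q \<longlongrightarrow> q s) (at s within {0..r})"
        using cont_sub(3,4)[OF order_refl r(2)] s by (auto simp: continuous_on_def)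
      then show ?thesis using False by (intro tendsto_intros) auto
    next
      case True
      have q0: "(q \<longlongrightarrow> 0) (at 0 within {0..r})"
      proof -
        have "(q \<longlongrightarrow> q 0) (at 0 within {0..r})"
          using cont_sub(4)[OF order_refl r(2)] r(1) unfolding continuous_on_def by force
        then show ?thesis by (simp add: pq0)
      qed
      define C where "C = v 0 powr \<delta> / (n + a) * r powr (2 + a)"
      have bound: "\<bar>s powr (2 - n) * p s * q s\<bar> \<le> \<bar>q s\<bar> * C" if s: "s \<in> {0..r}" for s
      proof (cases "s = 0")
        case False
        then have s: "0 < s" "s \<le> r" "ereal s < R" using that less_R[of s r] r by auto
        have "- p s \<le> v 0 powr \<delta> * s powr (n + a) / (n + a)" using flux_upper[of s] s by simp
        then have "s powr (2 - n) * (- p s) \<le> s powr (2 - n) * (v 0 powr \<delta> * s powr (n + a) / (n + a))"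
          by (intro mult_left_mono) auto
        also have "\<dots> = v 0 powr \<delta> / (n + a) * (s powr (2 - n) * s powr (n + a))" by simp
        also have "s powr (2 - n) * s powr (n + a) = s powr (2 + a)" by (simp flip: powr_add)
        also have "v 0 powr \<delta> / (n + a) * s powr (2 + a) \<le> C"
          unfolding C_def using s n ab by (intro mult_left_mono powr_mono2) auto
        finally have "\<bar>s powr (2 - n) * p s\<bar> \<le> C" using p_neg[of s] s by (simp add: abs_mult)
        then show ?thesis by (subst abs_mult) (metis mult.commute mult_left_mono abs_ge_zero)
      qed (simp add: pq0)
      have "((\<lambda>s. s powr (2 - n) * p s * q s) \<longlongrightarrow> 0) (at 0 within {0..r})"
        by (rule Lim_null_comparison[OF _ tendsto_mult_left_zero[OF tendsto_rabs_zero[OF q0], of C]])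
          (use bound in \<open>auto simp: eventually_at_filter\<close>)
      then show ?thesis using True pq0 by simp
    qed
  qed
  have pw: "continuous_on {0..r} (\<lambda>s. u s powr (\<mu> + 1))" "continuous_on {0..r} (\<lambda>s. v s powr (\<delta> + 1))"
    using \<delta>\<mu> r(2) pos less_R
    by (intro continuous_on_powr' cont_sub continuous_on_const ballI conjI impI; force intro: less_imp_le)+
  have w: "continuous_on {0..r} (\<lambda>s. s powr (n + a))" "continuous_on {0..r} (\<lambda>s. s powr (n + b))"
    using n ab by (auto intro!: continuous_on_powr_const)
  show ?thesis unfolding energy_def[abs_def]
    by (rule continuous_on_add flux continuous_on_divide continuous_on_mult pw w continuous_on_const
        cont_sub[OF order_refl r(2)] | use \<delta>\<mu> in force)+
qed

lemma pq_pos: "0 < r \<Longrightarrow> ereal r < R \<Longrightarrow> 0 < r powr (1 - n) * p r * q r"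
  using p_neg[of r] radial_system.p_neg[OF swapped, of r] by (simp add: mult_neg_neg zero_less_mult_iff mult.assoc)

lemma energy_mono:
  assumes "excess \<ge> 0" "0 \<le> s" "s \<le> r" "ereal r < R" shows "energy s \<le> energy r"
proof (rule deriv_nonneg_imp_le[OF assms(3)])
  have "ereal r < R" "0 \<le> r" using assms by auto
  from continuous_on_subset[OF energy_continuous[OF this(2,1)]] assms
  show "continuous_on {s..r} energy" by auto
  fix t assume t: "s < t" "t < r"
  then have tR: "0 < t" "ereal t < R" using assms less_R[of t r] by auto
  show "(energy has_real_derivative excess * (t powr (1 - n) * p t * q t)) (at t)" using energy_deriv tR by blast
  show "0 \<le> excess * (t powr (1 - n) * p t * q t)"
    by (rule mult_nonneg_nonneg[OF assms(1) less_imp_le[OF pq_pos[OF tR]]])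
qed

lemma energy_antimono:
  assumes "excess \<le> 0" "0 \<le> s" "s \<le> r" "ereal r < R" shows "energy r \<le> energy s"
proof -
  have "- energy s \<le> - energy r"
  proof (rule deriv_nonneg_imp_le[OF assms(3)])
    have "ereal r < R" "0 \<le> r" using assms by auto
    from continuous_on_subset[OF energy_continuous[OF this(2,1)]] assms
    show "continuous_on {s..r} (\<lambda>r. - energy r)" by (intro continuous_intros) auto
    fix t assume t: "s < t" "t < r"
    then have tR: "0 < t" "ereal t < R" using assms less_R[of t r] by auto
    show "((\<lambda>r. - energy r) has_real_derivative - (excess * (t powr (1 - n) * p t * q t))) (at t)"
      using DERIV_minus[OF energy_deriv] tR by blast
    show "0 \<le> - (excess * (t powr (1 - n) * p t * q t))"
      using mult_nonpos_nonneg[OF assms(1) less_imp_le[OF pq_pos[OF tR]]] by simp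
  qed
  then show ?thesis by simp
qed

lemma energy_pos:
  assumes "excess > 0" "0 < r" "ereal r < R" shows "energy r > 0"
proof -
  have "energy 0 < energy r"
  proof (rule deriv_pos_imp_less[OF assms(2)])
    show "continuous_on {0..r} energy" using energy_continuous assms by auto
    fix t assume t: "0 < t" "t < r"
    then have tR: "0 < t" "ereal t < R" using assms less_R[of t r] by auto
    show "(energy has_real_derivative excess * (t powr (1 - n) * p t * q t)) (at t)" using energy_deriv tR by blast
    show "0 < excess * (t powr (1 - n) * p t * q t)"
      by (rule mult_pos_pos[OF assms(1) pq_pos[OF tR]])
  qed
  then show ?thesis by (simp add: energy_0)
qed

text \<open>For excess \<le> 0 the energy would be nonpositive. But near the boundary of the ball the terms with u and v
  vanish, and r^(2-n) p q stays bounded away from 0 since p and q are negative and decreasing.\<close>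
lemma dirichlet_imp_excess_pos:
  assumes \<rho>: "R = ereal \<rho>" "\<rho> > 0" and lim: "(u \<longlongrightarrow> 0) (at_left \<rho>)" "(v \<longlongrightarrow> 0) (at_left \<rho>)"
  shows "excess > 0"
proof (rule ccontr)
  assume "\<not> excess > 0"
  then have E: "energy r \<le> 0" if "0 < r" "r < \<rho>" for r
    using energy_antimono[of 0 r] that \<rho> by (simp add: energy_0)
  interpret sw: radial_system n b a \<mu> \<delta> R v u q p by (rule swapped)
  define k where "k = \<rho> powr (2 - n) * (p (\<rho> / 2) * q (\<rho> / 2))"
  have "k > 0" using p_neg[of "\<rho> / 2"] sw.p_neg[of "\<rho> / 2"] \<rho> by (simp add: k_def mult_neg_neg)
  define M1 where "M1 = (n + a) / (\<delta> + 1) * (v 0 powr \<delta> * \<rho> powr (n + a) / (n + a))"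
  define M2 where "M2 = (n + b) / (\<mu> + 1) * (u 0 powr \<mu> * \<rho> powr (n + b) / (n + b))"
  have "k \<le> M1 * v r + M2 * u r" if r: "\<rho> / 2 < r" "r < \<rho>" for r
  proof -
    have r0: "0 < r" "ereal r < R" using r \<rho> by auto
    have uv: "u r > 0" "v r > 0" using pos r0 by auto
    have "(- p r) * (- q r) \<ge> (- p (\<rho> / 2)) * (- q (\<rho> / 2))"
      using p_antimono[of "\<rho>/2" r] sw.p_antimono[of "\<rho>/2" r] p_neg[of "\<rho>/2"] sw.p_neg[of "\<rho>/2"] r r0 \<rho>
      by (intro mult_mono) auto
    then have prq: "p r * q r \<ge> p (\<rho> / 2) * q (\<rho> / 2)" by simp
    have prn: "r powr (2 - n) \<ge> \<rho> powr (2 - n)" using r r0 n by (intro powr_mono2') auto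
    have pqn: "0 \<le> p (\<rho> / 2) * q (\<rho> / 2)"
      using p_neg[of "\<rho>/2"] sw.p_neg[of "\<rho>/2"] \<rho> by (auto intro!: mult_nonpos_nonpos intro: less_imp_le)
    have "k \<le> r powr (2 - n) * (p r * q r)" unfolding k_def by (rule mult_mono[OF prn prq powr_ge_zero pqn])
    moreover have "(n + a) / (\<delta> + 1) * v r * (- p r) \<le> M1 * v r"
    proof -
      have "- p r \<le> v 0 powr \<delta> * r powr (n + a) / (n + a)" using flux_upper[of r] r0 by simp
      also have "\<dots> \<le> v 0 powr \<delta> * \<rho> powr (n + a) / (n + a)"
        using r r0 n ab by (intro divide_right_mono mult_left_mono powr_mono2) auto
      finally have "(n + a) / (\<delta> + 1) * v r * (- p r) \<le> (n + a) / (\<delta> + 1) * v r * (v 0 powr \<delta> * \<rho> powr (n + a) / (n + a))"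
        using uv n ab \<delta>\<mu> by (intro mult_left_mono) auto
      then show ?thesis using n ab by (simp add: M1_def mult_ac)
    qed
    moreover have "(n + b) / (\<mu> + 1) * u r * (- q r) \<le> M2 * u r"
    proof -
      have "- q r \<le> u 0 powr \<mu> * r powr (n + b) / (n + b)" using sw.flux_upper[of r] r0 by simp
      also have "\<dots> \<le> u 0 powr \<mu> * \<rho> powr (n + b) / (n + b)"
        using r r0 n ab by (intro divide_right_mono mult_left_mono powr_mono2) auto
      finally have "(n + b) / (\<mu> + 1) * u r * (- q r) \<le> (n + b) / (\<mu> + 1) * u r * (u 0 powr \<mu> * \<rho> powr (n + b) / (n + b))"
        using uv n ab \<delta>\<mu> by (intro mult_left_mono) auto
      then show ?thesis using n ab by (simp add: M2_def mult_ac)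
    qed
    moreover have "r powr (n + b) * u r powr (\<mu> + 1) / (\<mu> + 1) \<ge> 0" "r powr (n + a) * v r powr (\<delta> + 1) / (\<delta> + 1) \<ge> 0"
      using \<delta>\<mu> by auto
    ultimately show ?thesis using E[of r] r r0 unfolding energy_def by (simp add: mult.assoc)
  qed
  moreover have "\<forall>\<^sub>F r in at_left \<rho>. \<rho> / 2 < r \<and> r < \<rho>"
    using eventually_at_left_real[of "\<rho> / 2" \<rho>] \<rho> by simp
  ultimately have ev: "\<forall>\<^sub>F r in at_left \<rho>. k \<le> M1 * v r + M2 * u r" by (auto elim: eventually_mono)
  have "((\<lambda>r. M1 * v r + M2 * u r) \<longlongrightarrow> M1 * 0 + M2 * 0) (at_left \<rho>)" by (intro tendsto_intros lim)
  from tendsto_lowerbound[OF this ev] \<open>k > 0\<close> show False by simp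
qed

end

section \<open>Ground states\<close>

locale ground_state = radial_system n a b \<delta> \<mu> \<infinity> u v p q
  for n a b \<delta> \<mu> u v p q +
  assumes superlinear: "\<delta> * \<mu> > 1"

lemma (in ground_state) swapped_ground_state: "ground_state n b a \<mu> \<delta> v u q p"
  unfolding ground_state_def ground_state_axioms_def using swapped superlinear by (simp add: mult.commute)

lemma scaling_xi_eq: "scaling_xi a b \<delta> \<mu> = scaling_gamma b a \<mu> \<delta>"
  by (simp add: scaling_xi_def scaling_gamma_def mult.commute)

lemma scaling_pos:
  assumes "a > -2" "b > -2" "\<delta> > 0" "\<delta> * \<mu> > (1::real)" shows "scaling_gamma a b \<delta> \<mu> > 0"
  using assms by (simp add: scaling_gamma_def add_pos_pos)

lemma scaling_gamma_xi:
  assumes "\<delta> * \<mu> \<noteq> (1::real)"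
  shows "\<delta> * scaling_xi a b \<delta> \<mu> = scaling_gamma a b \<delta> \<mu> + 2 + a"
    and "\<mu> * scaling_gamma a b \<delta> \<mu> = scaling_xi a b \<delta> \<mu> + 2 + b"
  using assms by (simp_all add: scaling_xi_def scaling_gamma_def field_simps)

context ground_state
begin

abbreviation \<gamma> where "\<gamma> \<equiv> scaling_gamma a b \<delta> \<mu>"
abbreviation \<xi> where "\<xi> \<equiv> scaling_xi a b \<delta> \<mu>"

lemma \<gamma>\<xi>_pos: "\<gamma> > 0" "\<xi> > 0"
  using scaling_pos[of a b \<delta> \<mu>] scaling_pos[of b a \<mu> \<delta>] ab \<delta>\<mu> superlinear
  by (auto simp: scaling_xi_eq mult.commute)

text \<open>If u stayed above l > 0, then - v' would be at least a multiple of r^(1+b), and b > -2 would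
  make v negative in the end.\<close>
lemma u_tendsto_zero: "(u \<longlongrightarrow> 0) at_top"
proof -
  interpret sw: radial_system n b a \<mu> \<delta> \<infinity> v u q p by (rule swapped)
  obtain l where l: "(u \<longlongrightarrow> l) at_top" "\<And>r. 0 \<le> r \<Longrightarrow> l \<le> u r"
    by (rule decr_bounded_tendsto[of 0 u 0]) (use u_antimono pos in \<open>auto intro: less_imp_le\<close>)
  have "l \<ge> 0"
    by (rule tendsto_lowerbound[OF l(1)]) (use pos in \<open>auto simp: eventually_at_top_linorder intro!: exI[of _ 0] intro: less_imp_le\<close>)
  moreover have "\<not> l > 0"
  proof
    assume "l > 0"
    define c where "c = l powr \<mu> / (n + b)"
    have "c > 0" using \<open>l > 0\<close> n ab by (simp add: c_def)
    define r where "r = (v 0 * (2 + b) / c) powr (1 / (2 + b))"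
    have v0: "v 0 > 0" using pos(2)[of 0] by simp
    have "r > 0" using v0 ab \<open>c > 0\<close> by (simp add: r_def)
    have rp: "r powr (2 + b) = v 0 * (2 + b) / c" using v0 ab \<open>c > 0\<close> by (simp add: r_def powr_powr)
    have "- v 0 - c * 0 powr (2 + b) / (2 + b) \<le> - v r - c * r powr (2 + b) / (2 + b)"
    proof (rule deriv_nonneg_imp_le[OF less_imp_le[OF \<open>r > 0\<close>]])
      show "continuous_on {0..r} (\<lambda>s. - v s - c * s powr (2 + b) / (2 + b))"
        using ab by (intro continuous_intros cont_sub continuous_on_powr_const) auto
      fix s assume s: "0 < s" "s < r"
      show "((\<lambda>s. - v s - c * s powr (2 + b) / (2 + b)) has_real_derivative
          - (s powr (1 - n) * q s) - c * s powr (2 + b - 1)) (at s)"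
        using s ab by (intro DERIV_diff DERIV_minus dv deriv_powr_antideriv) auto
      have "l powr \<mu> * s powr (n + b) / (n + b) \<le> - q s"
        using s l(2) \<open>l > 0\<close> \<delta>\<mu> by (intro sw.flux_ge powr_mono2) auto
      then have "s powr (1 - n) * (l powr \<mu> * s powr (n + b) / (n + b)) \<le> s powr (1 - n) * - q s"
        by (intro mult_left_mono) auto
      moreover have "s powr (1 - n) * s powr (n + b) = s powr (2 + b - 1)" by (simp add: algebra_simps flip: powr_add)
      then have "s powr (1 - n) * (l powr \<mu> * s powr (n + b) / (n + b)) = c * s powr (2 + b - 1)"
        by (simp add: c_def)
      ultimately show "0 \<le> - (s powr (1 - n) * q s) - c * s powr (2 + b - 1)" by simp
    qed
    then have "v r \<le> 0" using rp ab \<open>c > 0\<close> by simp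
    with pos(2)[of r] \<open>r > 0\<close> show False by simp
  qed
  ultimately show ?thesis using l(1) by simp
qed

text \<open>The quantity r u' + (n - 2) u is decreasing. If it were ever negative, - u' would exceed c / r and u
  would become negative at a logarithmic rate.\<close>
lemma flux_le_u: assumes r: "0 < r" shows "- (r powr (2 - n) * p r) \<le> (n - 2) * u r"
proof (rule ccontr)
  define k where "k r = r powr (2 - n) * p r + (n - 2) * u r" for r
  assume "\<not> ?thesis"
  then have "k r < 0" by (simp add: k_def)
  define c where "c = - k r"
  have "c > 0" using \<open>k r < 0\<close> by (simp add: c_def)
  have dk: "(k has_real_derivative - (s powr (1 + a) * v s powr \<delta>)) (at s)" if s: "s > 0" for s
  proof -
    have F: "((\<lambda>r. r powr (2 - n) * p r + (n - 2) * u r) has_real_derivative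
       ((2 - n) * s powr (2 - n - 1) * p s + - (s powr (n - 1 + a) * v s powr \<delta>) * s powr (2 - n))
        + (n - 2) * (s powr (1 - n) * p s)) (at s)"
      using s by (intro DERIV_add DERIV_mult DERIV_cmult dp du has_real_derivative_powr) auto
    have "s powr (n - 1 + a) * s powr (2 - n) = s powr (1 + a)" by (simp flip: powr_add)
    then have E1: "- (s powr (n - 1 + a) * v s powr \<delta>) * s powr (2 - n) = - (s powr (1 + a) * v s powr \<delta>)"
      by (simp add: mult_ac)
    have E2: "2 - n - 1 = 1 - n" by simp
    show ?thesis unfolding k_def[abs_def]
      by (rule DERIV_cong[OF F[unfolded E1 E2]]) (simp add: algebra_simps)
  qed
  have k_le: "k s \<le> - c" if "r \<le> s" for s
  proof -
    have "- k r \<le> - k s"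
      by (rule deriv_nonneg_imp_le_closed[OF that DERIV_minus[OF dk]]) (use r that in auto)
    then show ?thesis by (simp add: c_def)
  qed
  \<comment> \<open>at this radius the bound u r - c ln (s / r) for u s has reached 0\<close>
  define s where "s = r * exp (u r / c)"
  have u0: "u r > 0" using pos(1)[of r] r by simp
  have "r \<le> s" using u0 \<open>c > 0\<close> r by (simp add: s_def)
  have "- u r - c * ln r \<le> - u s - c * ln s"
  proof (rule deriv_nonneg_imp_le_closed[OF \<open>r \<le> s\<close>])
    fix t assume t: "r \<le> t" "t \<le> s"
    then have "t > 0" using r by simp
    then show "((\<lambda>t. - u t - c * ln t) has_real_derivative - (t powr (1 - n) * p t) - c * (1 / t)) (at t)"
      using DERIV_ln_divide by (intro DERIV_diff DERIV_minus du DERIV_cmult) auto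
    have "t powr (2 - n) * p t + (n - 2) * u t \<le> - c" using k_le[OF t(1)] by (simp add: k_def)
    moreover have "(n - 2) * u t \<ge> 0" using n pos(1)[of t] \<open>t > 0\<close> by simp
    ultimately have "t powr (2 - n) * p t \<le> - c" by linarith
    moreover have "t powr (2 - n) = t * t powr (1 - n)" using \<open>t > 0\<close> by (simp add: powr_mult_base)
    ultimately have "t * (t powr (1 - n) * p t) \<le> - c" by (simp add: mult.assoc)
    then show "0 \<le> - (t powr (1 - n) * p t) - c * (1 / t)" using \<open>t > 0\<close> by (simp add: field_simps)
  qed
  moreover have "ln s = ln r + u r / c" using r by (simp add: s_def ln_mult)
  ultimately have "u s \<le> 0" using \<open>c > 0\<close> by (simp add: algebra_simps)
  with pos(1)[of s] \<open>r \<le> s\<close> r show False by simp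
qed

text \<open>Since v is decreasing, the flux on [r, 2 r] is at least the one with v frozen at 2 r, and
  u(r) is at least the decrease of u over this interval.\<close>
lemma u_ge_v_double:
  assumes r: "0 < r"
  shows "(2 powr (2 + a) - 1) / ((n + a) * (2 + a)) * r powr (2 + a) * v (2 * r) powr \<delta> \<le> u r"
proof -
  define m where "m = v (2 * r) powr \<delta> / (n + a)"
  have le: "r \<le> 2 * r" using r by simp
  have "- u r - m * r powr (2 + a) / (2 + a) \<le> - u (2 * r) - m * (2 * r) powr (2 + a) / (2 + a)"
  proof (rule deriv_nonneg_imp_le_closed[OF le])
    fix s assume s: "r \<le> s" "s \<le> 2 * r"
    then have s0: "s > 0" using r by simp
    show "((\<lambda>s. - u s - m * s powr (2 + a) / (2 + a)) has_real_derivative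
          - (s powr (1 - n) * p s) - m * s powr (2 + a - 1)) (at s)"
      using s0 ab by (intro DERIV_diff DERIV_minus du deriv_powr_antideriv) auto
    have "v (2 * r) powr \<delta> * s powr (n + a) / (n + a) \<le> - p s"
    proof (rule flux_ge)
      fix t assume "0 < t" "t < s"
      then show "v (2 * r) powr \<delta> \<le> v t powr \<delta>"
        using v_antimono[of t "2 * r"] pos(2)[of "2 * r"] s s0 \<delta>\<mu> by (intro powr_mono2) auto
    qed (use s0 in auto)
    then have "s powr (1 - n) * (v (2 * r) powr \<delta> * s powr (n + a) / (n + a)) \<le> s powr (1 - n) * - p s"
      by (intro mult_left_mono) auto
    moreover have "s powr (1 - n) * s powr (n + a) = s powr (2 + a - 1)" by (simp add: algebra_simps flip: powr_add)
    then have "s powr (1 - n) * (v (2 * r) powr \<delta> * s powr (n + a) / (n + a)) = m * s powr (2 + a - 1)"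
      by (simp add: m_def)
    ultimately show "0 \<le> - (s powr (1 - n) * p s) - m * s powr (2 + a - 1)" by simp
  qed
  then have "m * (2 powr (2 + a) * r powr (2 + a)) / (2 + a) - m * r powr (2 + a) / (2 + a) \<le> u r"
    using pos(1)[of "2 * r"] r by (simp add: powr_mult)
  moreover have "m * (2 powr (2 + a) * r powr (2 + a)) / (2 + a) - m * r powr (2 + a) / (2 + a)
     = (2 powr (2 + a) - 1) / ((n + a) * (2 + a)) * r powr (2 + a) * v (2 * r) powr \<delta>"
  proof -
    have "m * (2 powr (2 + a) * r powr (2 + a)) / (2 + a) - m * r powr (2 + a) / (2 + a)
       = (2 powr (2 + a) - 1) * r powr (2 + a) * m / (2 + a)"
      by (subst diff_divide_distrib[symmetric]) (simp add: algebra_simps)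
    then show ?thesis by (simp add: m_def)
  qed
  ultimately show ?thesis by simp
qed

text \<open>Using the lower bound of u by v and that of v by u, W = r^\<gamma> u satisfies W(4 r)^(\<delta> \<mu>) \<le> K W(r).
  As \<delta> \<mu> > 1, a bound M with K \<le> M^(\<delta> \<mu> - 1) is inherited from each scale to the next.\<close>
lemma u_decay: "\<exists>M. \<forall>r>0. r powr \<gamma> * u r \<le> M"
proof -
  interpret sw: ground_state n b a \<mu> \<delta> v u q p by (rule swapped_ground_state)
  define e where "e = \<delta> * \<mu>"
  have e: "e > 1" using superlinear by (simp add: e_def)
  define ca where "ca = (2 powr (2 + a) - 1) / ((n + a) * (2 + a))"
  define cb where "cb = (2 powr (2 + b) - 1) / ((n + b) * (2 + b))"
  have "ca > 0" "cb > 0" using n ab by (simp_all add: ca_def cb_def)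
  define c where "c = ca * (cb * 2 powr (2 + b)) powr \<delta>"
  have "c > 0" using \<open>ca > 0\<close> \<open>cb > 0\<close> by (simp add: c_def)
  define W where "W r = r powr \<gamma> * u r" for r
  have W: "W r > 0" if "r > 0" for r using pos(1)[of r] that by (simp add: W_def)
  define K where "K = 4 powr (\<gamma> * e) / c"
  have "K > 0" using \<open>c > 0\<close> by (simp add: K_def)
  have \<gamma>e: "\<gamma> * e = \<gamma> + (2 + a + (2 + b) * \<delta>)"
    using superlinear by (simp add: e_def scaling_gamma_def field_simps)
  have step: "W (4 * r) powr e \<le> K * W r" if r: "r > 0" for r
  proof -
    have u4: "u (4 * r) > 0" and v2: "v (2 * r) > 0" using pos[of "4 * r"] pos[of "2 * r"] r by auto
    have "cb * (2 * r) powr (2 + b) * u (2 * (2 * r)) powr \<mu> \<le> v (2 * r)"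
      using sw.u_ge_v_double[of "2 * r"] r by (simp add: cb_def)
    then have "(cb * 2 powr (2 + b) * r powr (2 + b) * u (4 * r) powr \<mu>) powr \<delta> \<le> v (2 * r) powr \<delta>"
      using r u4 \<open>cb > 0\<close> \<delta>\<mu> by (intro powr_mono2) (auto simp: powr_mult mult.assoc)
    moreover have "(cb * 2 powr (2 + b) * r powr (2 + b) * u (4 * r) powr \<mu>) powr \<delta>
       = (cb * 2 powr (2 + b)) powr \<delta> * r powr ((2 + b) * \<delta>) * u (4 * r) powr e"
      using r u4 \<open>cb > 0\<close> by (simp add: powr_mult powr_powr e_def mult.commute)
    ultimately have "ca * r powr (2 + a) * ((cb * 2 powr (2 + b)) powr \<delta> * r powr ((2 + b) * \<delta>) * u (4 * r) powr e)
        \<le> ca * r powr (2 + a) * v (2 * r) powr \<delta>"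
      using \<open>ca > 0\<close> by (intro mult_left_mono) auto
    also have "\<dots> \<le> u r" using u_ge_v_double[OF r] by (simp add: ca_def)
    finally have "r powr \<gamma> * (ca * r powr (2 + a) * ((cb * 2 powr (2 + b)) powr \<delta> * r powr ((2 + b) * \<delta>) * u (4 * r) powr e)) \<le> W r"
      unfolding W_def by (intro mult_left_mono) auto
    moreover have "r powr \<gamma> * (ca * r powr (2 + a) * ((cb * 2 powr (2 + b)) powr \<delta> * r powr ((2 + b) * \<delta>) * u (4 * r) powr e))
        = c * r powr (\<gamma> * e) * u (4 * r) powr e"
      unfolding \<gamma>e c_def by (simp add: powr_add mult_ac)
    ultimately have "c * r powr (\<gamma> * e) * u (4 * r) powr e \<le> W r" by simp
    moreover have "W (4 * r) powr e = K * (c * r powr (\<gamma> * e) * u (4 * r) powr e)"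
      using r u4 \<open>c > 0\<close> by (simp add: W_def K_def powr_mult powr_powr)
    ultimately show ?thesis using \<open>K > 0\<close> by simp
  qed
  define M where "M = max (4 powr \<gamma> * u 0) (K powr (1 / (e - 1)))"
  have u0: "u 0 > 0" using pos(1)[of 0] by simp
  have "M > 0" using u0 by (simp add: M_def less_max_iff_disj)
  have KM: "K \<le> M powr (e - 1)"
  proof -
    have "K = (K powr (1 / (e - 1))) powr (e - 1)" using e \<open>K > 0\<close> by (simp add: powr_powr)
    also have "\<dots> \<le> M powr (e - 1)" using e by (intro powr_mono2) (auto simp: M_def)
    finally show ?thesis .
  qed
  have base: "W r \<le> M" if r: "0 < r" "r \<le> 4" for r
  proof -
    have "W r \<le> 4 powr \<gamma> * u 0"
      unfolding W_def using r u_antimono[of 0 r] pos(1)[of r] \<gamma>\<xi>_pos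
      by (intro mult_mono powr_mono2) auto
    then show ?thesis by (simp add: M_def)
  qed
  have "\<forall>r. 0 < r \<and> r \<le> 4 ^ (k + 1) \<longrightarrow> W r \<le> M" for k :: nat
  proof (induction k)
    case 0 then show ?case using base by simp
  next
    case (Suc k)
    show ?case
    proof (intro allI impI)
      fix r :: real assume r: "0 < r \<and> r \<le> 4 ^ (Suc k + 1)"
      then have r4: "W (r / 4) \<le> M" "r / 4 > 0" using Suc by auto
      show "W r \<le> M"
      proof (rule ccontr)
        assume "\<not> W r \<le> M"
        then have "M powr e < W r powr e" using e \<open>M > 0\<close> by (intro powr_less_mono2) auto
        also have "\<dots> \<le> K * W (r / 4)" using step[OF r4(2)] by simp
        also have "\<dots> \<le> M powr (e - 1) * M"
          using KM r4 W[OF r4(2)] \<open>K > 0\<close> by (intro mult_mono) auto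
        also have "\<dots> = M powr e" using \<open>M > 0\<close> by (simp add: powr_diff)
        finally show False by simp
      qed
    qed
  qed
  moreover have "\<exists>k. r \<le> 4 ^ (k + 1)" for r :: real
  proof -
    obtain k :: nat where "r < 4 ^ k" using real_arch_pow[of 4 r] by auto
    also have "(4::real) ^ k \<le> 4 ^ (k + 1)" by simp
    finally show ?thesis by (auto intro: less_imp_le)
  qed
  ultimately show ?thesis unfolding W_def by blast
qed

lemma excess_eq: "excess * ((\<delta> + 1) * (\<mu> + 1)) = (\<delta> * \<mu> - 1) * (\<gamma> + \<xi> - (n - 2))"
proof -
  have "excess * ((\<delta> + 1) * (\<mu> + 1)) = (n + a) * (\<mu> + 1) + (n + b) * (\<delta> + 1) + (2 - n) * ((\<delta> + 1) * (\<mu> + 1))"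
  proof -
    have "excess * ((\<delta> + 1) * (\<mu> + 1)) = (n + a) / (\<delta> + 1) * ((\<delta> + 1) * (\<mu> + 1))
       + (n + b) / (\<mu> + 1) * ((\<delta> + 1) * (\<mu> + 1)) + (2 - n) * ((\<delta> + 1) * (\<mu> + 1))"
      by (simp only: excess_def distrib_right[symmetric]) simp
    then show ?thesis using \<delta>\<mu> by simp
  qed
  moreover have "(\<delta> * \<mu> - 1) * \<gamma> = (2 + a) + (2 + b) * \<delta>" "(\<delta> * \<mu> - 1) * \<xi> = (2 + b) + (2 + a) * \<mu>"
    using superlinear by (simp_all add: scaling_gamma_def scaling_xi_def)
  ultimately show ?thesis by (simp add: algebra_simps)
qed

text \<open>All terms of the energy are bounded by r^(n - 2 - \<gamma> - \<xi>), and this exponent is negative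
  exactly when the excess is positive. The energy would be positive, increasing and tend to 0.\<close>
lemma excess_nonpos: "excess \<le> 0"
proof (rule ccontr)
  assume "\<not> excess \<le> 0"
  then have ex: "excess > 0" by simp
  interpret sw: ground_state n b a \<mu> \<delta> v u q p by (rule swapped_ground_state)
  have sw_eq: "sw.\<gamma> = \<xi>" by (simp add: scaling_xi_eq)
  have "(\<delta> * \<mu> - 1) * (\<gamma> + \<xi> - (n - 2)) > 0"
    using ex \<delta>\<mu> unfolding excess_eq[symmetric] by simp
  then have k: "n - 2 - \<gamma> - \<xi> < 0" using superlinear by (simp add: zero_less_mult_iff)
  obtain M1 where M1: "\<And>r. r > 0 \<Longrightarrow> r powr \<gamma> * u r \<le> M1" using u_decay by blast
  obtain M2 where M2: "\<And>r. r > 0 \<Longrightarrow> r powr \<xi> * v r \<le> M2" using sw.u_decay sw_eq by auto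
  define k where "k = n - 2 - \<gamma> - \<xi>"
  define C where "C = (n - 2)\<^sup>2 * (M1 * M2) + M1 powr (\<mu> + 1) / (\<mu> + 1) + M2 powr (\<delta> + 1) / (\<delta> + 1)"
  have bound: "energy r \<le> C * r powr k" if r: "r > 0" for r
  proof -
    have uv: "u r > 0" "v r > 0" using pos[of r] r by auto
    have pq: "p r < 0" "q r < 0" using p_neg[of r] sw.p_neg[of r] r by auto
    have Wu: "u r \<le> M1 * r powr (- \<gamma>)" and Wv: "v r \<le> M2 * r powr (- \<xi>)"
      using M1[OF r] M2[OF r] r by (simp_all add: powr_minus field_simps)
    have "0 < r powr \<gamma> * u r" "0 < r powr \<xi> * v r" using uv r by simp_all
    with M1[OF r] M2[OF r] have M: "M1 > 0" "M2 > 0" by linarith+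
    have "r powr (2 - n) * p r * q r \<le> (n - 2)\<^sup>2 * (M1 * M2) * r powr k"
    proof -
      have "(- (r powr (2 - n) * p r)) * (- (r powr (2 - n) * q r)) \<le> ((n - 2) * u r) * ((n - 2) * v r)"
        using flux_le_u[OF r] sw.flux_le_u[OF r] pq n uv
        by (intro mult_mono) (auto intro!: mult_nonneg_nonpos intro: less_imp_le)
      then have le1: "r powr (n - 2) * ((r powr (2 - n) * p r) * (r powr (2 - n) * q r)) \<le> r powr (n - 2) * ((n - 2)\<^sup>2 * (u r * v r))"
        by (intro mult_left_mono) (auto simp: power2_eq_square mult_ac)
      have one: "r powr (n - 2) * r powr (2 - n) = 1" using r by (simp flip: powr_add)
      have "r powr (n - 2) * ((r powr (2 - n) * p r) * (r powr (2 - n) * q r))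
          = (r powr (n - 2) * r powr (2 - n)) * (r powr (2 - n) * p r * q r)" by (simp only: mult_ac)
      then have "r powr (2 - n) * p r * q r = r powr (n - 2) * ((r powr (2 - n) * p r) * (r powr (2 - n) * q r))"
        by (simp only: one mult_1)
      also note le1
      also have "u r * v r \<le> (M1 * r powr (- \<gamma>)) * (M2 * r powr (- \<xi>))"
        using Wu Wv uv M by (intro mult_mono) auto
      then have "r powr (n - 2) * ((n - 2)\<^sup>2 * (u r * v r)) \<le> r powr (n - 2) * ((n - 2)\<^sup>2 * ((M1 * r powr (- \<gamma>)) * (M2 * r powr (- \<xi>))))"
        by (intro mult_left_mono) auto
      also have "\<dots> = (n - 2)\<^sup>2 * (M1 * M2) * (r powr (n - 2) * r powr (- \<gamma>) * r powr (- \<xi>))"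
        by (simp only: mult_ac)
      also have "r powr (n - 2) * r powr (- \<gamma>) * r powr (- \<xi>) = r powr k"
        by (simp add: k_def flip: powr_add)
      finally show ?thesis .
    qed
    moreover have "r powr (n + b) * u r powr (\<mu> + 1) / (\<mu> + 1) \<le> M1 powr (\<mu> + 1) / (\<mu> + 1) * r powr k"
    proof -
      have "u r powr (\<mu> + 1) \<le> (M1 * r powr (- \<gamma>)) powr (\<mu> + 1)"
        using Wu uv \<delta>\<mu> by (intro powr_mono2) auto
      also have "\<dots> = M1 powr (\<mu> + 1) * r powr (- \<gamma> * (\<mu> + 1))" using M r by (simp add: powr_mult powr_powr)
      finally have "r powr (n + b) * u r powr (\<mu> + 1) \<le> r powr (n + b) * (M1 powr (\<mu> + 1) * r powr (- \<gamma> * (\<mu> + 1)))"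
        by (intro mult_left_mono) auto
      moreover have "n + b + - \<gamma> * (\<mu> + 1) = k"
        using scaling_gamma_xi(2)[of \<delta> \<mu> a b] superlinear by (simp add: k_def algebra_simps)
      then have "r powr k = r powr (n + b) * r powr (- \<gamma> * (\<mu> + 1))" by (metis powr_add)
      ultimately have "r powr (n + b) * u r powr (\<mu> + 1) \<le> M1 powr (\<mu> + 1) * r powr k" by (simp add: mult_ac)
      from divide_right_mono[OF this, of "\<mu> + 1"] show ?thesis using \<delta>\<mu> by simp
    qed
    moreover have "r powr (n + a) * v r powr (\<delta> + 1) / (\<delta> + 1) \<le> M2 powr (\<delta> + 1) / (\<delta> + 1) * r powr k"
    proof -
      have "v r powr (\<delta> + 1) \<le> (M2 * r powr (- \<xi>)) powr (\<delta> + 1)"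
        using Wv uv \<delta>\<mu> by (intro powr_mono2) auto
      also have "\<dots> = M2 powr (\<delta> + 1) * r powr (- \<xi> * (\<delta> + 1))" using M r by (simp add: powr_mult powr_powr)
      finally have "r powr (n + a) * v r powr (\<delta> + 1) \<le> r powr (n + a) * (M2 powr (\<delta> + 1) * r powr (- \<xi> * (\<delta> + 1)))"
        by (intro mult_left_mono) auto
      moreover have "n + a + - \<xi> * (\<delta> + 1) = k"
        using scaling_gamma_xi(1)[of \<delta> \<mu> a b] superlinear by (simp add: k_def algebra_simps)
      then have "r powr k = r powr (n + a) * r powr (- \<xi> * (\<delta> + 1))" by (metis powr_add)
      ultimately have "r powr (n + a) * v r powr (\<delta> + 1) \<le> M2 powr (\<delta> + 1) * r powr k" by (simp add: mult_ac)
      from divide_right_mono[OF this, of "\<delta> + 1"] show ?thesis using \<delta>\<mu> by simp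
    qed
    moreover have "(n + a) / (\<delta> + 1) * v r * p r \<le> 0" "(n + b) / (\<mu> + 1) * u r * q r \<le> 0"
      using n ab \<delta>\<mu> uv pq
      by (auto intro!: mult_nonneg_nonpos mult_nonneg_nonneg divide_nonpos_pos divide_nonneg_pos)
    ultimately show ?thesis unfolding energy_def C_def by (simp add: algebra_simps)
  qed
  have lim: "((\<lambda>r. C * r powr k) \<longlongrightarrow> C * 0) at_top"
    using \<open>n - 2 - \<gamma> - \<xi> < 0\<close> by (intro tendsto_intros tendsto_neg_powr filterlim_ident) (simp add: k_def)
  have "\<forall>\<^sub>F r in at_top. energy 1 \<le> C * r powr k"
    using eventually_ge_at_top[of 1]
  proof eventually_elim
    case (elim r)
    then have "energy 1 \<le> energy r" using energy_mono[of 1 r] ex by simp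
    with bound[of r] elim show ?case by simp
  qed
  from tendsto_lowerbound[OF lim this] have "energy 1 \<le> 0" by simp
  with energy_pos[OF ex, of 1] show False by simp
qed

lemma energy_zero: "excess = 0 \<Longrightarrow> r \<ge> 0 \<Longrightarrow> energy r = 0"
  using energy_mono[of 0 r] energy_antimono[of 0 r] by (simp add: energy_0)

end

section \<open>Comparison, uniqueness and scaling\<close>

lemma powr_lipschitz:
  fixes k :: real
  assumes "0 < m" "k > 0" "m \<le> x" "x \<le> M" "m \<le> y" "y \<le> M"
  shows "\<bar>x powr k - y powr k\<bar> \<le> k * (m powr (k - 1) + M powr (k - 1)) * \<bar>x - y\<bar>"
proof -
  have bd: "z powr (k - 1) \<le> m powr (k - 1) + M powr (k - 1)" if "m \<le> z" "z \<le> M" for z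
  proof (cases "k \<ge> 1")
    case True
    then have "z powr (k - 1) \<le> M powr (k - 1)" using that assms by (intro powr_mono2) auto
    then show ?thesis by (simp add: add_increasing)
  next
    case False
    then have "z powr (k - 1) \<le> m powr (k - 1)" using that assms by (intro powr_mono2') auto
    then show ?thesis by (simp add: add_increasing2)
  qed
  have le: "\<bar>x powr k - y powr k\<bar> \<le> k * (m powr (k - 1) + M powr (k - 1)) * \<bar>x - y\<bar>"
    if "x < y" "m \<le> x" "y \<le> M" for x y
  proof -
    have "((\<lambda>z. z powr k) has_real_derivative k * z powr (k - 1)) (at z)" if "x \<le> z" for z
      using that \<open>m \<le> x\<close> assms by (intro has_real_derivative_powr) auto
    then obtain z where z: "x < z" "z < y" "y powr k - x powr k = (y - x) * (k * z powr (k - 1))"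
      using MVT2[OF \<open>x < y\<close>, of "\<lambda>z. z powr k" "\<lambda>z. k * z powr (k - 1)"] by blast
    have "\<bar>x powr k - y powr k\<bar> = \<bar>y powr k - x powr k\<bar>" by simp
    also have "\<dots> = k * z powr (k - 1) * \<bar>x - y\<bar>" using z assms \<open>x < y\<close> by (simp add: abs_mult)
    also have "\<dots> \<le> k * (m powr (k - 1) + M powr (k - 1)) * \<bar>x - y\<bar>"
      using bd[of z] z that assms by (intro mult_right_mono mult_left_mono) auto
    finally show ?thesis .
  qed
  show ?thesis
  proof (cases x y rule: linorder_cases)
    case less then show ?thesis using le assms by simp
  next
    case greater
    then have "\<bar>y powr k - x powr k\<bar> \<le> k * (m powr (k - 1) + M powr (k - 1)) * \<bar>y - x\<bar>" using le assms by blast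
    then show ?thesis by (simp add: abs_minus_commute)
  qed simp
qed

text \<open>A larger v gives a more negative flux of u. Applied alternately to u and v, this
  shows that an initial difference in v alone never shrinks.\<close>
lemma compare_half:
  assumes s1: "radial_system n a b \<delta> \<mu> R u v p q" and s2: "radial_system n a b \<delta> \<mu> R u' v' p' q'"
    and r: "0 \<le> r" "ereal r < R" and le: "\<And>t. 0 \<le> t \<Longrightarrow> t \<le> r \<Longrightarrow> v t \<le> v' t"
  shows "u 0 - u' 0 \<le> u r - u' r"
proof -
  interpret s1: radial_system n a b \<delta> \<mu> R u v p q by fact
  interpret s2: radial_system n a b \<delta> \<mu> R u' v' p' q' by fact
  have pp: "p' t \<le> p t" if t: "0 \<le> t" "t \<le> r" for t
  proof -
    have tR: "ereal t < R" using t r s1.less_R by blast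
    have "p 0 - p' 0 \<le> p t - p' t"
    proof (rule deriv_nonneg_imp_le[OF t(1)])
      show "continuous_on {0..t} (\<lambda>t. p t - p' t)"
        by (intro continuous_intros s1.cont_sub s2.cont_sub tR order_refl)
      fix z assume z: "0 < z" "z < t"
      then have zR: "ereal z < R" using tR s1.less_R[of z t] by simp
      show "((\<lambda>t. p t - p' t) has_real_derivative
         - (z powr (n - 1 + a) * v z powr \<delta>) - - (z powr (n - 1 + a) * v' z powr \<delta>)) (at z)"
        by (intro DERIV_diff s1.dp s2.dp z zR)
      have "v z powr \<delta> \<le> v' z powr \<delta>"
        using le[of z] z t s1.pos(2)[of z] zR s1.\<delta>\<mu> by (intro powr_mono2) auto
      then show "0 \<le> - (z powr (n - 1 + a) * v z powr \<delta>) - - (z powr (n - 1 + a) * v' z powr \<delta>)"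
        by (simp add: mult_left_mono)
    qed
    then show ?thesis using s1.pq0 s2.pq0 by simp
  qed
  show ?thesis
  proof (rule deriv_nonneg_imp_le[OF r(1), where f = "\<lambda>t. u t - u' t"])
    show "continuous_on {0..r} (\<lambda>t. u t - u' t)"
      by (intro continuous_intros s1.cont_sub s2.cont_sub r order_refl)
    fix z assume z: "0 < z" "z < r"
    then have zR: "ereal z < R" using r s1.less_R[of z r] by simp
    show "((\<lambda>t. u t - u' t) has_real_derivative z powr (1 - n) * p z - z powr (1 - n) * p' z) (at z)"
      by (intro DERIV_diff s1.du s2.du z zR)
    show "0 \<le> z powr (1 - n) * p z - z powr (1 - n) * p' z"
      using pp[of z] z by (simp add: mult_left_mono)
  qed
qed

text \<open>One half of a Gronwall estimate. The weight exp (k (r^(2+a) + r^(2+b))) is adapted to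
  the equation: its derivative dominates r^(1+a), which is what the kernel r^(1-n) s^(n-1+a) integrates to, so the
  difference of u is smaller than that of v by a factor 1 / k.\<close>
lemma gronwall_half:
  assumes s1: "radial_system n a b \<delta> \<mu> R u v p q" and s2: "radial_system n a b \<delta> \<mu> R u' v' p' q'"
    and s: "0 \<le> s" "ereal s < R" and init: "u 0 = u' 0"
    and lip: "\<And>t. 0 < t \<Longrightarrow> t \<le> s \<Longrightarrow> \<bar>v t powr \<delta> - v' t powr \<delta>\<bar> \<le> L * \<bar>v t - v' t\<bar>"
    and bd: "\<And>t. 0 < t \<Longrightarrow> t \<le> s \<Longrightarrow> \<bar>v t - v' t\<bar> \<le> c * exp (k * (t powr (2 + a) + t powr (2 + b)))"
    and L: "L \<ge> 0" and c: "c \<ge> 0" and k: "k > 0"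
  shows "u s - u' s \<le> L * c / ((n + a) * k * (2 + a)) * exp (k * (s powr (2 + a) + s powr (2 + b)))"
proof -
  interpret s1: radial_system n a b \<delta> \<mu> R u v p q by fact
  interpret s2: radial_system n a b \<delta> \<mu> R u' v' p' q' by fact
  have na: "n + a > 0" "2 + a > 0" "2 + b > 0" using s1.n s1.ab by auto
  define \<rho> where "\<rho> t = t powr (2 + a) + t powr (2 + b)" for t
  have \<rho>_mono: "\<rho> t \<le> \<rho> r" if "0 \<le> t" "t \<le> r" for t r
    unfolding \<rho>_def using that na by (intro add_mono powr_mono2) auto
  have pp: "p t - p' t \<le> L * c * exp (k * \<rho> t) * t powr (n + a) / (n + a)" if t: "0 < t" "t \<le> s" for t
  proof -
    have tR: "ereal t < R" using t s s1.less_R by blast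
    define m where "m = L * c * exp (k * \<rho> t)"
    have "m * 0 powr (n + a) / (n + a) - (p 0 - p' 0) \<le> m * t powr (n + a) / (n + a) - (p t - p' t)"
    proof (rule deriv_nonneg_imp_le[OF less_imp_le[OF t(1)]])
      show "continuous_on {0..t} (\<lambda>t. m * t powr (n + a) / (n + a) - (p t - p' t))"
        using na by (intro continuous_intros s1.cont_sub s2.cont_sub tR order_refl continuous_on_powr_const) auto
      fix z assume z: "0 < z" "z < t"
      then have zR: "ereal z < R" using tR s1.less_R[of z t] by simp
      show "((\<lambda>t. m * t powr (n + a) / (n + a) - (p t - p' t)) has_real_derivative
         m * z powr (n + a - 1) - (- (z powr (n - 1 + a) * v z powr \<delta>) - - (z powr (n - 1 + a) * v' z powr \<delta>))) (at z)"
        by (intro DERIV_diff s1.dp s2.dp z zR deriv_powr_antideriv na)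
      have "\<bar>v z powr \<delta> - v' z powr \<delta>\<bar> \<le> L * \<bar>v z - v' z\<bar>" using lip z t by auto
      also have "\<dots> \<le> L * (c * exp (k * \<rho> z))" using bd[of z] z t L by (intro mult_left_mono) (auto simp: \<rho>_def)
      also have "\<dots> \<le> m" unfolding m_def using \<rho>_mono[of z t] z k L c by (simp add: mult_left_mono mult.assoc)
      finally have "v' z powr \<delta> - v z powr \<delta> \<le> m" by linarith
      then have "z powr (n + a - 1) * (v' z powr \<delta> - v z powr \<delta>) \<le> z powr (n + a - 1) * m"
        by (rule mult_left_mono) simp
      moreover have "n - 1 + a = n + a - 1" by simp
      ultimately show "0 \<le> m * z powr (n + a - 1) - (- (z powr (n - 1 + a) * v z powr \<delta>) - - (z powr (n - 1 + a) * v' z powr \<delta>))"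
        by (simp add: algebra_simps)
    qed
    then show ?thesis using s1.pq0 s2.pq0 by (simp add: m_def)
  qed
  define B where "B = L * c / ((n + a) * k * (2 + a))"
  have B: "B \<ge> 0" using L c na k by (simp add: B_def)
  have "B * exp (k * \<rho> 0) - (u 0 - u' 0) \<le> B * exp (k * \<rho> s) - (u s - u' s)"
  proof (rule deriv_nonneg_imp_le[OF s(1)])
    have c1: "continuous_on {0..s} \<rho>" unfolding \<rho>_def
      using na by (intro continuous_intros continuous_on_powr_const) auto
    show "continuous_on {0..s} (\<lambda>t. B * exp (k * \<rho> t) - (u t - u' t))"
      by (intro continuous_intros c1 s1.cont_sub s2.cont_sub s order_refl)
    fix z assume z: "0 < z" "z < s"
    then have zR: "ereal z < R" using s s1.less_R[of z s] by simp
    define d where "d = (2 + a) * z powr (1 + a) + (2 + b) * z powr (1 + b)"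
    have "(\<rho> has_real_derivative (2 + a) * z powr (2 + a - 1) + (2 + b) * z powr (2 + b - 1)) (at z)"
      unfolding \<rho>_def by (intro DERIV_add has_real_derivative_powr z)
    moreover have "2 + a - 1 = 1 + a" "2 + b - 1 = 1 + b" by auto
    ultimately have d\<rho>: "(\<rho> has_real_derivative d) (at z)" by (simp add: d_def)
    show "((\<lambda>t. B * exp (k * \<rho> t) - (u t - u' t)) has_real_derivative
       B * (exp (k * \<rho> z) * (k * d)) - (z powr (1 - n) * p z - z powr (1 - n) * p' z)) (at z)"
      by (intro DERIV_diff DERIV_cmult DERIV_fun_exp s1.du s2.du z zR d\<rho>)
    have "z powr (1 - n) * (p z - p' z) \<le> z powr (1 - n) * (L * c * exp (k * \<rho> z) * z powr (n + a) / (n + a))"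
      using pp[of z] z by (intro mult_left_mono) auto
    also have "\<dots> = L * c / (n + a) * exp (k * \<rho> z) * (z powr (1 - n) * z powr (n + a))" by simp
    also have "z powr (1 - n) * z powr (n + a) = z powr (1 + a)" by (simp add: algebra_simps flip: powr_add)
    also have "L * c / (n + a) * exp (k * \<rho> z) * z powr (1 + a) = B * (exp (k * \<rho> z) * (k * ((2 + a) * z powr (1 + a))))"
      using na k by (simp add: B_def)
    also have "\<dots> \<le> B * (exp (k * \<rho> z) * (k * d))"
      using B k na by (intro mult_left_mono) (auto simp: d_def)
    finally show "0 \<le> B * (exp (k * \<rho> z) * (k * d)) - (z powr (1 - n) * p z - z powr (1 - n) * p' z)"
      by (simp add: right_diff_distrib)
  qed
  then have "u s - u' s \<le> B * exp (k * \<rho> s) - B * exp (k * \<rho> 0)" using init by simp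
  moreover have "B * exp (k * \<rho> 0) \<ge> 0" using B by simp
  ultimately show ?thesis by (simp add: B_def \<rho>_def)
qed

text \<open>Up to a radius below R both solutions are bounded away from 0, where powers are Lipschitz even for
  exponents below 1. With a large weight the two half estimates contract the weighted difference.\<close>
lemma radial_system_unique:
  assumes s1: "radial_system n a b \<delta> \<mu> R u v p q" and s2: "radial_system n a b \<delta> \<mu> R u' v' p' q'"
    and init: "u 0 = u' 0" "v 0 = v' 0" and r: "0 \<le> r" "ereal r < R"
  shows "u r = u' r \<and> v r = v' r"
proof -
  interpret s1: radial_system n a b \<delta> \<mu> R u v p q by fact
  interpret s2: radial_system n a b \<delta> \<mu> R u' v' p' q' by fact
  have na: "n + a > 0" "2 + a > 0" "2 + b > 0" "n + b > 0" using s1.n s1.ab by auto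
  define m where "m = min (min (u r) (v r)) (min (u' r) (v' r))"
  define M where "M = max (u 0) (v 0)"
  have m: "m > 0" using s1.pos s2.pos r by (auto simp: m_def)
  have in_mM: "m \<le> u t" "u t \<le> M" "m \<le> v t" "v t \<le> M" "m \<le> u' t" "u' t \<le> M" "m \<le> v' t" "v' t \<le> M"
    if t: "0 \<le> t" "t \<le> r" for t
  proof -
    have tR: "ereal t < R" using t r s1.less_R by blast
    show "m \<le> u t" "u t \<le> M" "m \<le> v t" "v t \<le> M" "m \<le> u' t" "u' t \<le> M" "m \<le> v' t" "v' t \<le> M"
      using s1.u_antimono[OF t r(2)] s1.v_antimono[OF t r(2)] s2.u_antimono[OF t r(2)] s2.v_antimono[OF t r(2)]
        s1.u_antimono[OF order_refl t(1) tR] s1.v_antimono[OF order_refl t(1) tR]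
        s2.u_antimono[OF order_refl t(1) tR] s2.v_antimono[OF order_refl t(1) tR] init
      by (auto simp: m_def M_def)
  qed
  define L where "L = \<delta> * (m powr (\<delta> - 1) + M powr (\<delta> - 1)) + \<mu> * (m powr (\<mu> - 1) + M powr (\<mu> - 1))"
  have "0 \<le> \<delta> * (m powr (\<delta> - 1) + M powr (\<delta> - 1))" "0 \<le> \<mu> * (m powr (\<mu> - 1) + M powr (\<mu> - 1))"
    using s1.\<delta>\<mu> by (auto intro!: mult_nonneg_nonneg)
  then have L1: "\<delta> * (m powr (\<delta> - 1) + M powr (\<delta> - 1)) \<le> L" "\<mu> * (m powr (\<mu> - 1) + M powr (\<mu> - 1)) \<le> L" "L \<ge> 0"
    by (simp_all add: L_def)
  have lip: "\<bar>v t powr \<delta> - v' t powr \<delta>\<bar> \<le> L * \<bar>v t - v' t\<bar>" "\<bar>u t powr \<mu> - u' t powr \<mu>\<bar> \<le> L * \<bar>u t - u' t\<bar>"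
    if t: "0 < t" "t \<le> r" for t
    using powr_lipschitz[OF m s1.\<delta>\<mu>(1), of "v t" M "v' t"] powr_lipschitz[OF m s1.\<delta>\<mu>(2), of "u t" M "u' t"] in_mM[of t] t
      mult_right_mono[OF L1(1), of "\<bar>v t - v' t\<bar>"] mult_right_mono[OF L1(2), of "\<bar>u t - u' t\<bar>"]
    by auto
  define C where "C = L / ((n + a) * (2 + a)) + L / ((n + b) * (2 + b))"
  have C: "C \<ge> 0" using L1 na by (simp add: C_def)
  \<comment> \<open>any k > C makes the factor C / k of the contraction less than 1\<close>
  define k where "k = 2 * C + 1"
  have k: "k > 0" using C by (simp add: k_def)
  define \<rho> where "\<rho> t = t powr (2 + a) + t powr (2 + b)" for t
  define W where "W t = exp (- k * \<rho> t) * (\<bar>u t - u' t\<bar> + \<bar>v t - v' t\<bar>)" for t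
  have c1: "continuous_on {0..r} \<rho>" unfolding \<rho>_def
    using na by (intro continuous_intros continuous_on_powr_const) auto
  have "continuous_on {0..r} W" unfolding W_def
    by (intro continuous_intros c1 s1.cont_sub s2.cont_sub r order_refl)
  then obtain s where s: "s \<in> {0..r}" "\<And>t. t \<in> {0..r} \<Longrightarrow> W t \<le> W s"
    using continuous_attains_sup[of "{0..r}" W] r by auto
  define c where "c = W s"
  have c0: "c \<ge> 0" by (simp add: c_def W_def)
  have bd: "\<bar>u t - u' t\<bar> + \<bar>v t - v' t\<bar> \<le> c * exp (k * \<rho> t)" if "0 \<le> t" "t \<le> r" for t
  proof -
    have "W t \<le> c" using s that by (simp add: c_def)
    then show ?thesis by (simp add: W_def exp_minus field_simps)
  qed
  have bdu: "\<bar>u t - u' t\<bar> \<le> c * exp (k * (t powr (2 + b) + t powr (2 + a)))"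
    and bdv: "\<bar>v t - v' t\<bar> \<le> c * exp (k * (t powr (2 + a) + t powr (2 + b)))" if "0 < t" "t \<le> s" for t
    using bd[of t] that s by (auto simp: \<rho>_def add.commute)
  have sR: "0 \<le> s" "ereal s < R" using s r s1.less_R[of s r] by auto
  have st: "t \<le> r" if "t \<le> s" for t using s that by auto
  have "\<bar>u s - u' s\<bar> \<le> L * c / ((n + a) * k * (2 + a)) * exp (k * \<rho> s)"
    using gronwall_half[OF s1 s2 sR init(1) lip(1)[OF _ st] bdv L1(3) c0 k]
      gronwall_half[OF s2 s1 sR init(1)[symmetric] _ _ L1(3) c0 k] lip(1)[OF _ st] bdv
    by (auto simp: \<rho>_def abs_le_iff abs_minus_commute)
  moreover have "\<bar>v s - v' s\<bar> \<le> L * c / ((n + b) * k * (2 + b)) * exp (k * \<rho> s)"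
    using gronwall_half[OF s1.swapped s2.swapped sR init(2) lip(2)[OF _ st] bdu L1(3) c0 k]
      gronwall_half[OF s2.swapped s1.swapped sR init(2)[symmetric] _ _ L1(3) c0 k] lip(2)[OF _ st] bdu
    by (auto simp: \<rho>_def abs_le_iff abs_minus_commute add.commute)
  ultimately have "\<bar>u s - u' s\<bar> + \<bar>v s - v' s\<bar>
     \<le> (L * c / ((n + a) * k * (2 + a)) + L * c / ((n + b) * k * (2 + b))) * exp (k * \<rho> s)"
    by (simp add: distrib_right)
  also have "L * c / ((n + a) * k * (2 + a)) + L * c / ((n + b) * k * (2 + b)) = c * C / k"
  proof -
    have "L * c / ((n + a) * k * (2 + a)) = c / k * (L / ((n + a) * (2 + a)))"
      "L * c / ((n + b) * k * (2 + b)) = c / k * (L / ((n + b) * (2 + b)))" by (simp_all add: mult_ac)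
    then show ?thesis by (simp only: C_def distrib_left[symmetric]) simp
  qed
  finally have "c \<le> c * C / k"
    by (simp add: c_def W_def exp_minus field_simps)
  then have "c * k \<le> c * C" using k by (simp add: field_simps)
  then have "c * (C + 1) \<le> 0" by (simp add: k_def algebra_simps)
  then have "c = 0" using c0 C by (simp add: mult_le_0_iff)
  then show ?thesis using bd[of r] r by auto
qed

lemma radial_system_scale:
  assumes s1: "radial_system n a b \<delta> \<mu> R u v p q" and \<theta>: "\<theta> > 0" and sup: "\<delta> * \<mu> > 1"
    and R': "\<And>r. ereal r < R' \<longleftrightarrow> ereal (\<theta> * r) < R"
  defines "g \<equiv> scaling_gamma a b \<delta> \<mu>" and "x \<equiv> scaling_xi a b \<delta> \<mu>"
  shows "radial_system n a b \<delta> \<mu> R' (\<lambda>r. \<theta> powr g * u (\<theta> * r)) (\<lambda>r. \<theta> powr x * v (\<theta> * r))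
     (\<lambda>r. \<theta> powr (g + 2 - n) * p (\<theta> * r)) (\<lambda>r. \<theta> powr (x + 2 - n) * q (\<theta> * r))"
proof -
  have half: "continuous_on {r. 0 \<le> r \<and> ereal r < R'} (\<lambda>r. \<theta> powr g * u (\<theta> * r)) \<and>
     continuous_on {r. 0 \<le> r \<and> ereal r < R'} (\<lambda>r. \<theta> powr (g + 2 - n) * p (\<theta> * r)) \<and>
     (\<forall>r. 0 < r \<longrightarrow> ereal r < R' \<longrightarrow>
       ((\<lambda>r. \<theta> powr g * u (\<theta> * r)) has_real_derivative r powr (1 - n) * (\<theta> powr (g + 2 - n) * p (\<theta> * r))) (at r) \<and>
       ((\<lambda>r. \<theta> powr (g + 2 - n) * p (\<theta> * r)) has_real_derivative
           - (r powr (n - 1 + a) * (\<theta> powr x * v (\<theta> * r)) powr \<delta>)) (at r))"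
    if s1: "radial_system n a b \<delta> \<mu> R u v p q" and gx: "\<delta> * x = g + 2 + a" for a b \<delta> \<mu> u v p q g x
  proof -
    interpret s1: radial_system n a b \<delta> \<mu> R u v p q by fact
    have img: "(*) \<theta> ` {r. 0 \<le> r \<and> ereal r < R'} \<subseteq> {r. 0 \<le> r \<and> ereal r < R}" using R' \<theta> by auto
    have "continuous_on {r. 0 \<le> r \<and> ereal r < R'} (\<lambda>r. u (\<theta> * r))"
      "continuous_on {r. 0 \<le> r \<and> ereal r < R'} (\<lambda>r. p (\<theta> * r))"
      using img by (auto intro!: continuous_on_compose2[OF s1.cont(1)] continuous_on_compose2[OF s1.cont(3)] continuous_intros)
    then have c: "continuous_on {r. 0 \<le> r \<and> ereal r < R'} (\<lambda>r. \<theta> powr g * u (\<theta> * r))"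
      "continuous_on {r. 0 \<le> r \<and> ereal r < R'} (\<lambda>r. \<theta> powr (g + 2 - n) * p (\<theta> * r))"
      by (auto intro!: continuous_intros)
    have d: "((\<lambda>r. \<theta> powr g * u (\<theta> * r)) has_real_derivative r powr (1 - n) * (\<theta> powr (g + 2 - n) * p (\<theta> * r))) (at r)"
      "((\<lambda>r. \<theta> powr (g + 2 - n) * p (\<theta> * r)) has_real_derivative
           - (r powr (n - 1 + a) * (\<theta> powr x * v (\<theta> * r)) powr \<delta>)) (at r)" if r: "0 < r" "ereal r < R'" for r
    proof -
      have tr: "0 < \<theta> * r" "ereal (\<theta> * r) < R" using r R' \<theta> by auto
      have lin: "((\<lambda>r. \<theta> * r) has_real_derivative \<theta>) (at r)" by (auto intro!: derivative_eq_intros)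
      have D: "((\<lambda>r. \<theta> powr g * u (\<theta> * r)) has_real_derivative \<theta> powr g * ((\<theta> * r) powr (1 - n) * p (\<theta> * r) * \<theta>)) (at r)"
        by (intro DERIV_cmult DERIV_chain2[OF s1.du[OF tr] lin])
      have E1: "\<theta> powr g * ((\<theta> * r) powr (1 - n) * p (\<theta> * r) * \<theta>)
          = (\<theta> powr g * \<theta> powr (1 - n) * \<theta> powr 1) * (r powr (1 - n) * p (\<theta> * r))"
        using \<theta> r by (simp add: powr_mult)
      have E2: "\<theta> powr g * \<theta> powr (1 - n) * \<theta> powr 1 = \<theta> powr (g + 2 - n)"
        by (simp only: powr_add[symmetric]) (simp add: algebra_simps)
      show "((\<lambda>r. \<theta> powr g * u (\<theta> * r)) has_real_derivative r powr (1 - n) * (\<theta> powr (g + 2 - n) * p (\<theta> * r))) (at r)"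
        by (rule DERIV_cong[OF D]) (simp only: E1 E2, simp only: mult_ac)
      have D': "((\<lambda>r. \<theta> powr (g + 2 - n) * p (\<theta> * r)) has_real_derivative
         \<theta> powr (g + 2 - n) * (- ((\<theta> * r) powr (n - 1 + a) * v (\<theta> * r) powr \<delta>) * \<theta>)) (at r)"
        by (intro DERIV_cmult DERIV_chain2[OF s1.dp[OF tr] lin])
      have F1: "\<theta> powr (g + 2 - n) * (- ((\<theta> * r) powr (n - 1 + a) * v (\<theta> * r) powr \<delta>) * \<theta>)
          = (\<theta> powr (g + 2 - n) * \<theta> powr (n - 1 + a) * \<theta> powr 1) * (- (r powr (n - 1 + a) * v (\<theta> * r) powr \<delta>))"
        using \<theta> r by (simp add: powr_mult)
      have F2: "\<theta> powr (g + 2 - n) * \<theta> powr (n - 1 + a) * \<theta> powr 1 = \<theta> powr (x * \<delta>)"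
        using gx by (simp only: powr_add[symmetric]) (simp add: algebra_simps)
      have F3: "(\<theta> powr x * v (\<theta> * r)) powr \<delta> = \<theta> powr (x * \<delta>) * v (\<theta> * r) powr \<delta>"
        using s1.pos(2)[of "\<theta> * r"] tr by (simp add: powr_mult powr_powr)
      show "((\<lambda>r. \<theta> powr (g + 2 - n) * p (\<theta> * r)) has_real_derivative
           - (r powr (n - 1 + a) * (\<theta> powr x * v (\<theta> * r)) powr \<delta>)) (at r)"
        by (rule DERIV_cong[OF D']) (simp only: F1 F2 F3, simp only: mult_ac mult_minus_right)
    qed
    show ?thesis using c d by blast
  qed
  interpret s1: radial_system n a b \<delta> \<mu> R u v p q by fact
  have ne: "\<delta> * \<mu> \<noteq> 1" using sup by simp
  have h1: "\<delta> * x = g + 2 + a" "\<mu> * g = x + 2 + b"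
    using scaling_gamma_xi[OF ne] by (simp_all add: g_def x_def)
  note H1 = half[OF s1 h1(1)] and H2 = half[OF s1.swapped h1(2)]
  show ?thesis
  proof unfold_locales
    show "0 < \<theta> powr g * u (\<theta> * r)" "0 < \<theta> powr x * v (\<theta> * r)" if "0 \<le> r" "ereal r < R'" for r
      using s1.pos[of "\<theta> * r"] R' that \<theta> by simp_all
  qed (use H1 H2 s1.n s1.ab s1.\<delta>\<mu> s1.pq0 in auto)
qed

text \<open>The difference of the second components never shrinks, but both ground states tend to 0.\<close>
lemma ground_state_not_less:
  assumes s1: "ground_state n a b \<delta> \<mu> u v p q" and s2: "ground_state n a b \<delta> \<mu> u' v' p' q'"
    and init: "u 0 = u' 0"
  shows "\<not> v 0 < v' 0"
proof
  interpret s1: ground_state n a b \<delta> \<mu> u v p q by fact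
  interpret s2: ground_state n a b \<delta> \<mu> u' v' p' q' by fact
  interpret w1: ground_state n b a \<mu> \<delta> v u q p by (rule s1.swapped_ground_state)
  interpret w2: ground_state n b a \<mu> \<delta> v' u' q' p' by (rule s2.swapped_ground_state)
  note r1 = s1.radial_system_axioms and r2 = s2.radial_system_axioms
  assume less: "v 0 < v' 0"
  have step: "v' 0 - v 0 \<le> v' r - v r" if r: "0 \<le> r" "\<And>t. 0 \<le> t \<Longrightarrow> t \<le> r \<Longrightarrow> v t \<le> v' t" for r
  proof -
    have "u' t \<le> u t" if "0 \<le> t" "t \<le> r" for t
      using compare_half[OF r1 r2, of t] that r init by auto
    then show ?thesis using compare_half[OF s2.swapped s1.swapped, of r] r by auto
  qed
  have pos: "v r < v' r" if r: "0 \<le> r" for r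
  proof (rule ccontr)
    assume "\<not> v r < v' r"
    then have le: "v' r - v r \<le> 0" by simp
    have c: "continuous_on {0..r} (\<lambda>t. v' t - v t)"
      by (intro continuous_intros s1.cont_sub s2.cont_sub) auto
    have p: "0 < v' 0 - v 0" using less by simp
    obtain t where t: "0 < t" "v' t - v t = 0" "\<And>s. 0 \<le> s \<Longrightarrow> s < t \<Longrightarrow> 0 < v' s - v s"
      using first_zero[OF r c p le] by blast
    have "v s \<le> v' s" if "0 \<le> s" "s \<le> t" for s
      using t(2) t(3)[of s] that by (cases "s = t") auto
    with step[of t] t less show False by simp
  qed
  have "v' 0 - v 0 \<le> v' r - v r" if "0 \<le> r" for r using step[OF that] pos by (meson less_imp_le)
  then have ev: "\<forall>\<^sub>F r in at_top. v' 0 - v 0 \<le> v' r - v r"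
    by (auto simp: eventually_at_top_linorder)
  have "((\<lambda>r. v' r - v r) \<longlongrightarrow> 0 - 0) at_top"
    by (intro tendsto_diff w1.u_tendsto_zero w2.u_tendsto_zero)
  from tendsto_lowerbound[OF this ev] less show False by simp
qed

text \<open>Scaling equalises u(0); then v(0) agrees by the comparison, and the solutions coincide.\<close>
theorem ground_state_unique:
  assumes s1: "ground_state n a b \<delta> \<mu> u v p q" and s2: "ground_state n a b \<delta> \<mu> u' v' p' q'"
  shows "\<exists>\<theta>>0. \<forall>r\<ge>0. u' r = \<theta> powr scaling_gamma a b \<delta> \<mu> * u (\<theta> * r) \<and>
                     v' r = \<theta> powr scaling_xi a b \<delta> \<mu> * v (\<theta> * r)"
proof -
  interpret s1: ground_state n a b \<delta> \<mu> u v p q by fact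
  interpret s2: ground_state n a b \<delta> \<mu> u' v' p' q' by fact
  define \<theta> where "\<theta> = (u' 0 / u 0) powr (1 / s1.\<gamma>)"
  have u0: "u 0 > 0" "u' 0 > 0" using s1.pos s2.pos by auto
  have \<theta>: "\<theta> > 0" "\<theta> powr s1.\<gamma> = u' 0 / u 0" using u0 s1.\<gamma>\<xi>_pos by (simp_all add: \<theta>_def powr_powr)
  let ?u = "\<lambda>r. \<theta> powr s1.\<gamma> * u (\<theta> * r)" and ?v = "\<lambda>r. \<theta> powr s1.\<xi> * v (\<theta> * r)"
  let ?p = "\<lambda>r. \<theta> powr (s1.\<gamma> + 2 - n) * p (\<theta> * r)" and ?q = "\<lambda>r. \<theta> powr (s1.\<xi> + 2 - n) * q (\<theta> * r)"
  have rs: "radial_system n a b \<delta> \<mu> \<infinity> ?u ?v ?p ?q"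
    by (rule radial_system_scale[OF s1.radial_system_axioms \<theta>(1) s1.superlinear]) simp
  then have s3: "ground_state n a b \<delta> \<mu> ?u ?v ?p ?q"
    by (simp add: ground_state_def ground_state_axioms_def s1.superlinear)
  have init: "?u 0 = u' 0" using \<theta> u0 by simp
  have "?v 0 = v' 0"
    using ground_state_not_less[OF s3 s2 init] ground_state_not_less[OF s2 s3 init[symmetric]] by linarith
  then have "?u r = u' r \<and> ?v r = v' r" if "0 \<le> r" for r
    using radial_system_unique[OF rs s2.radial_system_axioms init _ that] by simp
  then show ?thesis using \<theta>(1) by (intro exI[of _ \<theta>]) auto
qed

section \<open>The radial potential\<close>

text \<open>Uniformly bounded nonnegative densities on the whole line, so that pointwise limits can be taken under the
  integral on every interval.\<close>
definition admissible :: "real \<Rightarrow> (real \<Rightarrow> real) \<Rightarrow> bool" where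
  "admissible C g \<longleftrightarrow> g \<in> borel_measurable borel \<and> (\<forall>s. 0 \<le> g s \<and> g s \<le> C)"

definition weighted_integral :: "real \<Rightarrow> (real \<Rightarrow> real) \<Rightarrow> real \<Rightarrow> real" where
  "weighted_integral k g r = integral {0..r} (\<lambda>s. s powr k * g s)"

text \<open>The solution w of (r^(n-1) w')' = r^(n-1+a) g with w(0) = 0 and vanishing flux at 0, after exchanging the order of the
  two integrations. It contains only integrals that converge absolutely for a > -2.\<close>
definition radial_potential :: "real \<Rightarrow> real \<Rightarrow> (real \<Rightarrow> real) \<Rightarrow> real \<Rightarrow> real" where
  "radial_potential n a g r =
     (weighted_integral (1 + a) g r - r powr (2 - n) * weighted_integral (n - 1 + a) g r) / (n - 2)"

lemma weighted_integrable:
  assumes "admissible C g" "k > -1" shows "(\<lambda>s. s powr k * g s) integrable_on {0..r}"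
proof (cases "r \<ge> 0")
  case True
  have "g \<in> borel_measurable borel" using assms by (simp add: admissible_def)
  then have "g \<in> borel_measurable (lebesgue_on {0..r})"
    by (intro measurable_restrict_space1 measurable_completion) simp
  moreover have "bounded (g ` {0..r})"
    using assms by (auto simp: admissible_def intro!: boundedI[where B = C])
  moreover have "(\<lambda>s. s powr k) absolutely_integrable_on {0..r}"
    using assms True by (intro nonnegative_absolutely_integrable_1 integrable_on_powr_from_0) auto
  ultimately have "(\<lambda>s. g s * s powr k) absolutely_integrable_on {0..r}"
    by (intro absolutely_integrable_bounded_measurable_product_real) auto
  then show ?thesis using set_lebesgue_integral_eq_integral(1) by (force simp: mult.commute)
next
  case False
  then have "{0..r} = {}" by simp
  then show ?thesis by (simp only: integrable_on_empty)
qed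

lemma weighted_integral_neg: "r \<le> 0 \<Longrightarrow> weighted_integral k g r = 0"
  by (cases "r = 0") (simp_all add: weighted_integral_def)

lemma weighted_integral_nonneg:
  assumes "admissible C g" "k > -1" shows "0 \<le> weighted_integral k g r"
  unfolding weighted_integral_def using assms
  by (intro integral_nonneg weighted_integrable[OF assms]) (auto simp: admissible_def)

lemma weighted_integral_le:
  assumes "admissible C g" "k > -1" "r \<ge> 0"
  shows "weighted_integral k g r \<le> C * r powr (k + 1) / (k + 1)"
proof -
  have h: "((\<lambda>s. C * s powr k) has_integral C * (r powr (k + 1) / (k + 1))) {0..r}"
    using assms by (intro has_integral_mult_right has_integral_powr_from_0) auto
  have "weighted_integral k g r \<le> integral {0..r} (\<lambda>s. C * s powr k)"
    unfolding weighted_integral_def using h assms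
    by (intro integral_le weighted_integrable[OF assms(1,2)])
       (auto simp: admissible_def mult.commute[of C] intro!: mult_left_mono has_integral_integrable)
  then show ?thesis using integral_unique[OF h] by simp
qed

lemma weighted_integral_const:
  assumes "k > -1" "r \<ge> 0" shows "weighted_integral k (\<lambda>_. m) r = m * r powr (k + 1) / (k + 1)"
  using integral_unique[OF has_integral_mult_right[OF has_integral_powr_from_0[OF assms], of m]]
  by (simp add: weighted_integral_def mult.commute)

lemma weighted_integral_continuous:
  assumes "admissible C g" "k > -1" shows "continuous_on {0..R} (weighted_integral k g)"
  unfolding weighted_integral_def[abs_def]
  by (rule indefinite_integral_continuous_1) (rule weighted_integrable[OF assms])

lemma weighted_integral_isCont:
  assumes "admissible C g" "k > -1" "r > 0" shows "isCont (weighted_integral k g) r"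
  using continuous_on_interior[OF weighted_integral_continuous[OF assms(1,2), of "r + 1"], of r] assms(3)
  by simp

lemma weighted_integral_continuous_Ici:
  assumes "admissible C g" "k > -1" shows "continuous_on {0..} (weighted_integral k g)"
  unfolding continuous_on_eq_continuous_within
proof
  fix r :: real assume r: "r \<in> {0..}"
  show "continuous (at r within {0..}) (weighted_integral k g)"
  proof (cases "r = 0")
    case True
    have "continuous (at 0 within {0..1}) (weighted_integral k g)"
      using weighted_integral_continuous[OF assms, of 1] by (simp add: continuous_on_eq_continuous_within)
    moreover have "at 0 within {0..1::real} = at 0 within {0..}"
      by (rule at_within_nhd[of _ "{..<1}"]) auto
    ultimately show ?thesis using True by simp
  next
    case False
    then show ?thesis using weighted_integral_isCont[OF assms, of r] r by (auto intro: continuous_at_imp_continuous_at_within)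
  qed
qed

text \<open>The weight may be singular at 0, so the fundamental theorem of calculus is applied on [r/2, 2r].\<close>
lemma weighted_integral_deriv:
  assumes g: "admissible C g" "k > -1" and c: "continuous_on {0..} g" and r: "r > 0"
  shows "(weighted_integral k g has_real_derivative r powr k * g r) (at r)"
proof -
  let ?h = "\<lambda>s. s powr k * g s"
  have ch: "continuous_on {r/2..2*r} ?h"
    using r by (intro continuous_intros continuous_on_subset[OF c]) auto
  have "((\<lambda>x. integral {r/2..x} ?h) has_real_derivative ?h r) (at r within {r/2..2*r})"
    using r by (intro integral_has_real_derivative ch) auto
  then have "((\<lambda>x. integral {r/2..x} ?h) has_real_derivative ?h r) (at r)"
    using r by (subst (asm) at_within_interior) auto
  then have "((\<lambda>x. integral {0..r/2} ?h + integral {r/2..x} ?h) has_real_derivative 0 + ?h r) (at r)"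
    by (intro DERIV_add DERIV_const)
  then have "((\<lambda>x. integral {0..r/2} ?h + integral {r/2..x} ?h) has_real_derivative ?h r) (at r)" by simp
  then show ?thesis
  proof (rule has_field_derivative_transform_within_open[where S = "{r/2<..}"])
    fix x assume "x \<in> {r/2<..}"
    then show "integral {0..r/2} ?h + integral {r/2..x} ?h = weighted_integral k g x"
      unfolding weighted_integral_def using r
      by (intro Henstock_Kurzweil_Integration.integral_combine weighted_integrable[OF g]) auto
  qed (use r in auto)
qed

lemma weighted_integral_limit:
  assumes g: "\<And>i::nat. admissible C (g i)" and k: "k > -1" and lim: "\<And>s. (\<lambda>i. g i s) \<longlonglongrightarrow> h s"
  shows "(\<lambda>i. weighted_integral k (g i) r) \<longlonglongrightarrow> weighted_integral k h r"
  unfolding weighted_integral_def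
proof (rule dominated_convergence)
  show "(\<lambda>s. s powr k * g i s) integrable_on {0..r}" for i by (rule weighted_integrable[OF g k])
  have "admissible (max 0 C) (\<lambda>_. max 0 C)" by (simp add: admissible_def)
  then show "(\<lambda>s. s powr k * max 0 C) integrable_on {0..r}" using weighted_integrable k by blast
  show "norm (s powr k * g i s) \<le> s powr k * max 0 C" for i s
    using g[of i] by (auto simp: admissible_def abs_mult intro!: mult_left_mono intro: order_trans)
  show "(\<lambda>i. s powr k * g i s) \<longlonglongrightarrow> s powr k * h s" for s by (intro tendsto_intros lim)
qed

locale potential =
  fixes n a :: real
  assumes n: "n > 2" and a: "a > -2"
begin

abbreviation "K \<equiv> radial_potential n a"
abbreviation "J \<equiv> weighted_integral (n - 1 + a)"

lemma exps: "1 + a > -1" "n - 1 + a > -1" using n a by auto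

lemma K_neg: "r \<le> 0 \<Longrightarrow> K g r = 0" by (simp add: radial_potential_def weighted_integral_neg)

text \<open>The kernel s^(1+a) - r^(2-n) s^(n-1+a) is nonnegative for s \<le> r.\<close>
lemma K_mono:
  assumes g: "admissible C g" and h: "admissible C' h" and le: "\<And>s. 0 \<le> s \<Longrightarrow> s \<le> r \<Longrightarrow> g s \<le> h s"
  shows "K g r \<le> K h r"
proof (cases "r > 0")
  case True
  have int: "(\<lambda>s. s powr k * (h s - g s)) integrable_on {0..r}"
    "integral {0..r} (\<lambda>s. s powr k * (h s - g s)) = weighted_integral k h r - weighted_integral k g r" if "k > -1" for k
    using integrable_diff[OF weighted_integrable[OF h that, of r] weighted_integrable[OF g that, of r]]
      integral_diff[OF weighted_integrable[OF h that, of r] weighted_integrable[OF g that, of r]]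
    by (simp_all add: weighted_integral_def right_diff_distrib)
  have "r powr (2 - n) * (J h r - J g r) = integral {0..r} (\<lambda>s. r powr (2 - n) * (s powr (n - 1 + a) * (h s - g s)))"
    using int[OF exps(2)] by simp
  also have "\<dots> \<le> integral {0..r} (\<lambda>s. s powr (1 + a) * (h s - g s))"
  proof (rule integral_le)
    show "(\<lambda>s. r powr (2 - n) * (s powr (n - 1 + a) * (h s - g s))) integrable_on {0..r}"
      using int[OF exps(2)] by (intro integrable_on_mult_right)
    show "(\<lambda>s. s powr (1 + a) * (h s - g s)) integrable_on {0..r}" using int[OF exps(1)] by simp
    fix s assume s: "s \<in> {0..r}"
    have "r powr (2 - n) * s powr (n - 1 + a) \<le> s powr (1 + a)"
    proof (cases "s = 0")
      case False
      then have "r powr (2 - n) \<le> s powr (2 - n)" using s n by (intro powr_mono2') auto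
      then have "r powr (2 - n) * s powr (n - 1 + a) \<le> s powr (2 - n) * s powr (n - 1 + a)" by (intro mult_right_mono) auto
      also have "\<dots> = s powr (1 + a)" by (simp flip: powr_add)
      finally show ?thesis .
    qed simp
    then have "r powr (2 - n) * s powr (n - 1 + a) * (h s - g s) \<le> s powr (1 + a) * (h s - g s)"
      using le[of s] s by (intro mult_right_mono) auto
    then show "r powr (2 - n) * (s powr (n - 1 + a) * (h s - g s)) \<le> s powr (1 + a) * (h s - g s)" by (simp add: mult.assoc)
  qed
  also have "\<dots> = weighted_integral (1 + a) h r - weighted_integral (1 + a) g r" by (rule int(2)[OF exps(1)])
  finally have "weighted_integral (1 + a) g r - r powr (2 - n) * J g r \<le> weighted_integral (1 + a) h r - r powr (2 - n) * J h r"
    by (simp add: right_diff_distrib)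
  then show ?thesis unfolding radial_potential_def using n by (intro divide_right_mono) auto
qed (simp add: K_neg)

lemma K_const: "K (\<lambda>_. m) 1 = m / ((2 + a) * (n + a))"
proof -
  have "K (\<lambda>_. m) 1 = (m / (2 + a) - m / (n + a)) / (n - 2)"
    using exps by (simp add: radial_potential_def weighted_integral_const algebra_simps)
  also have "m / (2 + a) - m / (n + a) = m * (n - 2) / ((2 + a) * (n + a))"
    using n a by (simp add: field_simps)
  finally show ?thesis using n by simp
qed

lemma K_nonneg: assumes "admissible C g" shows "0 \<le> K g r"
proof -
  have "admissible 0 (\<lambda>_. 0)" by (simp add: admissible_def)
  moreover have "K (\<lambda>_. 0) r = 0" by (simp add: radial_potential_def weighted_integral_def)
  ultimately show ?thesis using K_mono[of 0 "\<lambda>_. 0" C g r] assms by (simp add: admissible_def)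
qed

lemma K_upper: assumes "admissible C g" "r \<ge> 0" shows "K g r \<le> C * r powr (2 + a) / (2 + a) / (n - 2)"
proof -
  have "weighted_integral (1 + a) g r - r powr (2 - n) * J g r \<le> C * r powr (1 + a + 1) / (1 + a + 1)"
    using weighted_integral_le[OF assms(1) exps(1) assms(2)] weighted_integral_nonneg[OF assms(1) exps(2), of r]
    by (smt (verit) mult_nonneg_nonneg powr_ge_zero)
  moreover have "1 + a + 1 = 2 + a" by simp
  ultimately have "weighted_integral (1 + a) g r - r powr (2 - n) * J g r \<le> C * r powr (2 + a) / (2 + a)" by simp
  then show ?thesis unfolding radial_potential_def using n by (intro divide_right_mono) auto
qed

lemma K_isCont: assumes "admissible C g" "r > 0" shows "isCont (K g) r"
  unfolding radial_potential_def[abs_def]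
  using assms n weighted_integral_isCont[OF assms(1) exps(1) assms(2)] weighted_integral_isCont[OF assms(1) exps(2) assms(2)]
  by (intro continuous_intros) auto

lemma K_continuous: assumes "admissible C g" shows "continuous_on {0..} (K g)"
  unfolding continuous_on_eq_continuous_within
proof
  fix r :: real assume r: "r \<in> {0..}"
  show "continuous (at r within {0..}) (K g)"
  proof (cases "r = 0")
    case False
    then show ?thesis using K_isCont[OF assms, of r] r by (auto intro: continuous_at_imp_continuous_at_within)
  next
    case True
    have "continuous_on {0..} (\<lambda>r. r powr (2 + a))" using a by (intro continuous_on_powr_const) auto
    then have "((\<lambda>r. r powr (2 + a)) \<longlongrightarrow> 0 powr (2 + a)) (at 0 within {0..})"
      unfolding continuous_on_def by (rule bspec) simp
    then have "((\<lambda>r. r powr (2 + a)) \<longlongrightarrow> 0) (at 0 within {0..})" by simp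
    from tendsto_mult_right_zero[OF this, of "C / (2 + a) / (n - 2)"]
    have "((\<lambda>r. C / (2 + a) / (n - 2) * r powr (2 + a)) \<longlongrightarrow> 0) (at 0 within {0..})" .
    then have "(K g \<longlongrightarrow> 0) (at 0 within {0..})"
    proof (rule Lim_null_comparison[rotated])
      show "\<forall>\<^sub>F r in at 0 within {0..}. norm (K g r) \<le> C / (2 + a) / (n - 2) * r powr (2 + a)"
        using K_upper[OF assms] K_nonneg[OF assms] by (auto simp: eventually_at_filter)
    qed
    then show ?thesis using True by (simp add: continuous_within K_neg)
  qed
qed

lemma K_measurable: assumes "admissible C g" shows "K g \<in> borel_measurable borel"
proof -
  have "continuous_on UNIV (\<lambda>r. K g (max 0 r))"
    by (rule continuous_on_compose2[OF K_continuous[OF assms]]) (auto intro!: continuous_intros)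
  then have "(\<lambda>r. K g (max 0 r)) \<in> borel_measurable borel" by (rule borel_measurable_continuous_onI)
  moreover have "K g (max 0 r) = K g r" for r by (cases "r \<ge> 0") (auto simp: K_neg max_def)
  ultimately show ?thesis by simp
qed

lemma K_limit:
  assumes "\<And>i::nat. admissible C (g i)" "\<And>s. (\<lambda>i. g i s) \<longlonglongrightarrow> h s"
  shows "(\<lambda>i. K (g i) r) \<longlonglongrightarrow> K h r"
  unfolding radial_potential_def using n
  by (intro tendsto_intros weighted_integral_limit[OF assms(1) _ assms(2)] exps) auto

lemma K_deriv:
  assumes g: "admissible C g" and c: "continuous_on {0..} g" and r: "r > 0"
  shows "(K g has_real_derivative r powr (1 - n) * J g r) (at r)"
proof -
  have F: "((\<lambda>r. weighted_integral (1 + a) g r - r powr (2 - n) * J g r) has_real_derivative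
     r powr (1 + a) * g r - ((2 - n) * r powr (2 - n - 1) * J g r + r powr (n - 1 + a) * g r * r powr (2 - n))) (at r)"
    by (intro DERIV_diff DERIV_mult weighted_integral_deriv[OF g _ c r] has_real_derivative_powr r exps)
  have "r powr (n - 1 + a) * r powr (2 - n) = r powr (1 + a)" by (simp flip: powr_add)
  then have E1: "r powr (n - 1 + a) * g r * r powr (2 - n) = r powr (1 + a) * g r" by (simp add: mult_ac)
  have E2: "2 - n - 1 = 1 - n" by simp
  have "((\<lambda>r. weighted_integral (1 + a) g r - r powr (2 - n) * J g r) has_real_derivative
      (n - 2) * (r powr (1 - n) * J g r)) (at r)"
    by (rule DERIV_cong[OF F[unfolded E1 E2]]) (simp add: algebra_simps)
  from DERIV_cdivide[OF this, of "n - 2"] show ?thesis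
    unfolding radial_potential_def[abs_def] using n by simp
qed

end

section \<open>Shooting\<close>

text \<open>Truncating the nonlinearity lets solutions continue beyond their zeros, so that all of them
  are defined for every radius.\<close>
definition pos_powr :: "real \<Rightarrow> real \<Rightarrow> real" where "pos_powr k x = max 0 x powr k"

lemma pos_powr_mono: "k > 0 \<Longrightarrow> x \<le> y \<Longrightarrow> pos_powr k x \<le> pos_powr k y"
  unfolding pos_powr_def by (intro powr_mono2) auto

lemma pos_powr_nonneg: "0 \<le> pos_powr k x" by (simp add: pos_powr_def)

lemma pos_powr_pos: "x > 0 \<Longrightarrow> pos_powr k x = x powr k" by (simp add: pos_powr_def)

lemma pos_powr_continuous: assumes "k > 0" shows "continuous_on UNIV (pos_powr k)"
  unfolding pos_powr_def[abs_def]
  using assms by (intro continuous_on_powr' continuous_intros) auto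

lemma pos_powr_admissible:
  assumes "k > 0" "w \<in> borel_measurable borel" "\<And>r. w r \<le> C"
  shows "admissible (pos_powr k C) (\<lambda>r. pos_powr k (w r))"
proof -
  have "pos_powr k \<in> borel_measurable borel"
    by (rule borel_measurable_continuous_onI[OF pos_powr_continuous[OF assms(1)]])
  then have "(\<lambda>r. pos_powr k (w r)) \<in> borel_measurable borel" using measurable_compose[OF assms(2)] by blast
  then show ?thesis using assms by (auto simp: admissible_def pos_powr_nonneg intro: pos_powr_mono)
qed

locale half_system = potential n a for n a :: real +
  fixes \<delta> :: real
  assumes \<delta>: "\<delta> > 0"
begin

text \<open>The solution, with value c at the origin, of the first equation for a given second component w;
  it decreases when w increases.\<close>
definition U where "U c w r = c - K (\<lambda>s. pos_powr \<delta> (w s)) r"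

context
  fixes w :: "real \<Rightarrow> real" and C :: real
  assumes w: "w \<in> borel_measurable borel" "\<And>r. w r \<le> C"
begin

lemma adm: "admissible (pos_powr \<delta> C) (\<lambda>r. pos_powr \<delta> (w r))"
  by (rule pos_powr_admissible[OF \<delta> w])

lemma U_le: "U c w r \<le> c" using K_nonneg[OF adm] by (simp add: U_def)

lemma U_measurable: "U c w \<in> borel_measurable borel"
  unfolding U_def[abs_def] using K_measurable[OF adm] by simp

lemma U_continuous: "continuous_on {0..} (U c w)"
  unfolding U_def[abs_def] by (intro continuous_intros K_continuous[OF adm])

lemma U_lower: "r \<ge> 0 \<Longrightarrow> c - pos_powr \<delta> C * r powr (2 + a) / (2 + a) / (n - 2) \<le> U c w r"
  using K_upper[OF adm] by (simp add: U_def)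

end

lemma U_nonpos: "r \<le> 0 \<Longrightarrow> U c w r = c" by (simp add: U_def K_neg)

lemma U_antimono:
  assumes "w \<in> borel_measurable borel" "\<And>r. w r \<le> C" "w' \<in> borel_measurable borel" "\<And>r. w' r \<le> C'"
    and "\<And>s. 0 \<le> s \<Longrightarrow> s \<le> r \<Longrightarrow> w s \<le> w' s" and "c' \<le> c"
  shows "U c' w' r \<le> U c w r"
  using K_mono[OF adm[OF assms(1,2)] adm[OF assms(3,4)], of r] assms(5,6) \<delta>
  by (force simp: U_def intro: pos_powr_mono)

lemma U_limit:
  assumes "\<And>i::nat. w i \<in> borel_measurable borel" "\<And>i r. w i r \<le> C" "\<And>r. (\<lambda>i. w i r) \<longlonglongrightarrow> w' r" "c \<longlonglongrightarrow> c'"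
  shows "(\<lambda>i. U (c i) (w i) r) \<longlonglongrightarrow> U c' w' r"
proof -
  have "(\<lambda>i. pos_powr \<delta> (w i s)) \<longlonglongrightarrow> pos_powr \<delta> (w' s)" for s
    using pos_powr_continuous[OF \<delta>] assms(3)[of s]
    by (intro isCont_tendsto_compose[of _ "pos_powr \<delta>"]) (auto simp: continuous_on_eq_continuous_at)
  then show ?thesis unfolding U_def
    by (intro tendsto_intros K_limit[OF adm[OF assms(1,2)]] assms(4))
qed

context
  fixes w :: "real \<Rightarrow> real" and C :: real
  assumes w: "w \<in> borel_measurable borel" "\<And>r. w r \<le> C" "continuous_on {0..} w"
begin

lemma pw_continuous: "continuous_on {0..} (\<lambda>r. pos_powr \<delta> (w r))"
  by (rule continuous_on_compose2[OF pos_powr_continuous[OF \<delta>] w(3)]) auto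

lemma U_deriv: "r > 0 \<Longrightarrow> (U c w has_real_derivative r powr (1 - n) * - J (\<lambda>s. pos_powr \<delta> (w s)) r) (at r)"
  unfolding U_def[abs_def]
  by (rule DERIV_cong[OF DERIV_diff[OF DERIV_const K_deriv[OF adm[OF w(1,2)] pw_continuous]]]) auto

lemma J_deriv: "r > 0 \<Longrightarrow> ((\<lambda>r. - J (\<lambda>s. pos_powr \<delta> (w s)) r) has_real_derivative - (r powr (n - 1 + a) * pos_powr \<delta> (w r))) (at r)"
  by (rule DERIV_minus[OF weighted_integral_deriv[OF adm[OF w(1,2)] exps(2) pw_continuous]])

lemma U_decreasing: "0 \<le> s \<Longrightarrow> s \<le> r \<Longrightarrow> U c w r \<le> U c w s"
proof -
  assume "0 \<le> s" "s \<le> r"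
  then have "- U c w s \<le> - U c w r"
  proof (intro deriv_nonneg_imp_le[where f = "\<lambda>r. - U c w r"])
    show "continuous_on {s..r} (\<lambda>r. - U c w r)"
      using \<open>0 \<le> s\<close> by (intro continuous_intros continuous_on_subset[OF U_continuous[OF w(1,2)]]) auto
    fix t assume "s < t"
    then show "((\<lambda>r. - U c w r) has_real_derivative - (t powr (1 - n) * - J (\<lambda>s. pos_powr \<delta> (w s)) t)) (at t)"
      using \<open>0 \<le> s\<close> by (intro DERIV_minus U_deriv) auto
    show "0 \<le> - (t powr (1 - n) * - J (\<lambda>s. pos_powr \<delta> (w s)) t)"
      using weighted_integral_nonneg[OF adm[OF w(1,2)] exps(2), of t] by simp
  qed auto
  then show ?thesis by simp
qed

text \<open>At a zero of U where w is still positive the flux is negative, so U becomes negative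
  while w is positive; unlike the zero itself, this is an open condition.\<close>
lemma U_crosses:
  assumes R: "R > 0" "U c w R = 0" and wR: "w R > 0"
  shows "\<exists>r>0. U c w r < 0 \<and> w r > 0"
proof -
  let ?g = "\<lambda>s. pos_powr \<delta> (w s)"
  have "\<forall>\<^sub>F r in at R. w r > 0"
  proof -
    have "isCont w R" using continuous_on_interior[OF w(3), of R] R by simp
    then show ?thesis using order_tendstoD(1)[OF _ wR, of w "at R"] by (simp add: isCont_def)
  qed
  then obtain d where d: "d > 0" "\<And>r. r \<noteq> R \<Longrightarrow> dist r R < d \<Longrightarrow> w r > 0" by (auto simp: eventually_at)
  have Jpos: "J ?g R > 0"
  proof -
    define s where "s = max (R / 2) (R - d / 2)"
    have s: "0 < s" "s < R" using R d by (auto simp: s_def)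
    have "J ?g s < J ?g R"
    proof (rule deriv_pos_imp_less[OF s(2)])
      show "continuous_on {s..R} (J ?g)"
        using s by (intro continuous_on_subset[OF weighted_integral_continuous_Ici[OF adm[OF w(1,2)] exps(2)]]) auto
      fix t assume t: "s < t" "t < R"
      show "(J ?g has_real_derivative t powr (n - 1 + a) * ?g t) (at t)"
        using t s by (intro weighted_integral_deriv[OF adm[OF w(1,2)] exps(2) pw_continuous]) auto
      have "w t > 0" using d(2)[of t] t by (auto simp: s_def dist_real_def)
      then show "0 < t powr (n - 1 + a) * ?g t" using t s by (simp add: pos_powr_pos)
    qed
    then show ?thesis using weighted_integral_nonneg[OF adm[OF w(1,2)] exps(2), of s] by linarith
  qed
  have "R powr (1 - n) * - J ?g R < 0" using Jpos R by (simp add: mult_less_0_iff)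
  from DERIV_neg_dec_right[OF U_deriv[OF R(1)] this] obtain e where
    e: "e > 0" "\<And>h. 0 < h \<Longrightarrow> h < e \<Longrightarrow> U c w (R + h) < U c w R" by blast
  define h where "h = min d e / 2"
  have "0 < h" "h < d" "h < e" using d e by (auto simp: h_def)
  then have "U c w (R + h) < 0 \<and> w (R + h) > 0"
    using e(2)[of h] d(2)[of "R + h"] R by (auto simp: dist_real_def)
  then show ?thesis using R \<open>0 < h\<close> by (intro exI[of _ "R + h"]) auto
qed

end

end

locale shooting =
  fixes n a b \<delta> \<mu> :: real
  assumes n: "n > 2" and ab: "a > -2" "b > -2" and \<delta>\<mu>: "\<delta> > 0" "\<mu> > 0"

text \<open>The prefix hu belongs to the equation of u, for which v is the density, and hv to that of v.\<close>
sublocale shooting \<subseteq> hu: half_system n a \<delta>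
  by unfold_locales (rule n ab \<delta>\<mu>)+

sublocale shooting \<subseteq> hv: half_system n b \<mu>
  by unfold_locales (rule n ab \<delta>\<mu>)+

context shooting
begin

definition solution where
  "solution s v \<longleftrightarrow> v \<in> borel_measurable borel \<and> (\<forall>r. v r \<le> s) \<and> v = hv.U s (hu.U 1 v)"

text \<open>Two decreasing maps composed: T s is increasing, and its fixed points are the solutions
  with u(0) = 1 and v(0) = s.\<close>
definition T where "T s v = hv.U s (hu.U 1 v)"

lemma T_facts:
  assumes "v \<in> borel_measurable borel" "\<And>r. v r \<le> C"
  shows "T s v \<in> borel_measurable borel" "T s v r \<le> s"
    "r \<ge> 0 \<Longrightarrow> s - pos_powr \<mu> 1 * r powr (2 + b) / (2 + b) / (n - 2) \<le> T s v r"
  unfolding T_def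
  by (rule hv.U_measurable hv.U_le hv.U_lower, rule hu.U_measurable[OF assms], rule hu.U_le[OF assms], (assumption)?)+

lemma T_mono:
  assumes "v \<in> borel_measurable borel" "\<And>r. v r \<le> C" "v' \<in> borel_measurable borel" "\<And>r. v' r \<le> C'"
    and "\<And>r. v r \<le> v' r" "s \<le> s'"
  shows "T s v r \<le> T s' v' r"
  unfolding T_def
  by (rule hv.U_antimono[OF hu.U_measurable[OF assms(3,4)] hu.U_le[OF assms(3,4)]
        hu.U_measurable[OF assms(1,2)] hu.U_le[OF assms(1,2)] _ assms(6)])
     (rule hu.U_antimono[OF assms(1-4) assms(5)], simp)

lemma T_limit:
  assumes "\<And>i::nat. w i \<in> borel_measurable borel" "\<And>i r. w i r \<le> C" "\<And>r. (\<lambda>i. w i r) \<longlonglongrightarrow> w' r" "s \<longlonglongrightarrow> s'"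
  shows "(\<lambda>i. T (s i) (w i) r) \<longlonglongrightarrow> T s' w' r"
  unfolding T_def
  by (rule hv.U_limit[OF hu.U_measurable[OF assms(1,2)] hu.U_le[OF assms(1,2)] hu.U_limit[OF assms(1-3) tendsto_const] assms(4)])

text \<open>As v \<le> s for every solution, the iterates from the constant s decrease to the largest
  solution.\<close>
fun iter :: "real \<Rightarrow> nat \<Rightarrow> real \<Rightarrow> real" where
  "iter s 0 = (\<lambda>_. s)"
| "iter s (Suc k) = T s (iter s k)"

lemma iter_facts: "iter s k \<in> borel_measurable borel \<and> (\<forall>r. iter s k r \<le> s)"
proof (induction k)
  case (Suc k)
  then have "iter s k \<in> borel_measurable borel" "\<And>r. iter s k r \<le> s" by auto
  from T_facts(1,2)[OF this] show ?case by simp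
qed simp

lemma iter_lower:
  assumes "r \<ge> 0" shows "s - pos_powr \<mu> 1 * r powr (2 + b) / (2 + b) / (n - 2) \<le> iter s k r"
proof (cases k)
  case 0
  have "0 \<le> pos_powr \<mu> 1 * r powr (2 + b) / (2 + b) / (n - 2)"
    using n ab by (intro divide_nonneg_pos mult_nonneg_nonneg pos_powr_nonneg) auto
  then show ?thesis using 0 by simp
next
  case (Suc k)
  then show ?thesis using T_facts(3)[of "iter s k" s] iter_facts[of s k] assms by simp
qed

lemma iter_nonpos: "r \<le> 0 \<Longrightarrow> iter s k r = s"
  by (cases k) (simp_all add: T_def hv.U_nonpos)

lemma iter_decreasing: "iter s (Suc k) r \<le> iter s k r"
proof (induction k arbitrary: r)
  case 0 then show ?case using iter_facts[of s "Suc 0"] by simp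
next
  case (Suc k)
  have "T s (iter s (Suc k)) r \<le> T s (iter s k) r"
    using iter_facts[of s k] iter_facts[of s "Suc k"] Suc by (intro T_mono[where C = s and C' = s]) blast+
  then show ?case by simp
qed

lemma iter_mono_s: "s \<le> s' \<Longrightarrow> iter s k r \<le> iter s' k r"
proof (induction k arbitrary: r)
  case (Suc k)
  show ?case unfolding iter.simps
    by (rule T_mono[where C = s and C' = s']) (use iter_facts[of s k] iter_facts[of s' k] Suc in auto)
qed simp

definition V where "V s r = lim (\<lambda>k. iter s k r)"

lemma iter_tendsto: "(\<lambda>k. iter s k r) \<longlonglongrightarrow> V s r"
proof -
  have dec: "decseq (\<lambda>k. iter s k r)" using iter_decreasing by (intro decseq_SucI)
  have "\<exists>B. \<forall>k. B \<le> iter s k r"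
  proof (cases "r \<ge> 0")
    case True then show ?thesis using iter_lower by blast
  next
    case False
    then have "\<forall>k. s \<le> iter s k r" by (simp add: iter_nonpos)
    then show ?thesis by blast
  qed
  then obtain B where "\<And>k. B \<le> iter s k r" by blast
  with dec show ?thesis unfolding V_def by (metis decseq_convergent limI)
qed

lemma V_le: "V s r \<le> s"
  using LIMSEQ_le_const2[OF iter_tendsto] iter_facts by blast

lemma V_measurable: "V s \<in> borel_measurable borel"
  by (rule borel_measurable_LIMSEQ_real[OF iter_tendsto]) (use iter_facts in auto)

lemma V_solution: "solution s (V s)"
proof -
  have "V s r = T s (V s) r" for r
  proof (rule LIMSEQ_unique)
    show "(\<lambda>k. iter s (Suc k) r) \<longlonglongrightarrow> V s r" using iter_tendsto by (rule LIMSEQ_Suc)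
    show "(\<lambda>k. iter s (Suc k) r) \<longlonglongrightarrow> T s (V s) r" unfolding iter.simps
      by (rule T_limit[where C = s]) (use iter_facts iter_tendsto in auto)
  qed
  then have "V s = hv.U s (hu.U 1 (V s))" unfolding T_def by (rule ext)
  then show ?thesis unfolding solution_def using V_measurable V_le by blast
qed

lemma V_mono: "s \<le> s' \<Longrightarrow> V s r \<le> V s' r"
  by (rule LIMSEQ_le[OF iter_tendsto iter_tendsto]) (use iter_mono_s in blast)

lemma V_lower: "r \<ge> 0 \<Longrightarrow> s - pos_powr \<mu> 1 * r powr (2 + b) / (2 + b) / (n - 2) \<le> V s r"
  using LIMSEQ_le_const[OF iter_tendsto] iter_lower by blast

lemma solution_limit:
  assumes "\<And>i::nat. solution (s i) (v i)" "s \<longlonglongrightarrow> s'" "\<And>i. s i \<le> C" "\<And>r. (\<lambda>i. v i r) \<longlonglongrightarrow> w r"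
  shows "solution s' w"
proof -
  have m: "v i \<in> borel_measurable borel" for i using assms(1)[of i] by (simp add: solution_def)
  have w: "w \<in> borel_measurable borel" by (rule borel_measurable_LIMSEQ_real[OF assms(4) m])
  have le: "v i r \<le> C" for i r
    using assms(1)[of i] assms(3)[of i] by (meson order_trans solution_def)
  have wle: "w r \<le> s'" for r
    by (rule LIMSEQ_le[OF assms(4,2)]) (use assms(1) in \<open>auto simp: solution_def\<close>)
  have "w r = T s' w r" for r
  proof (rule LIMSEQ_unique[OF assms(4)])
    have "(\<lambda>i. T (s i) (v i) r) \<longlonglongrightarrow> T s' w r" by (rule T_limit[OF m le assms(4,2)])
    moreover have "T (s i) (v i) r = v i r" for i using assms(1)[of i] unfolding solution_def T_def by metis
    ultimately show "(\<lambda>i. v i r) \<longlonglongrightarrow> T s' w r" by simp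
  qed
  then show ?thesis using w wle by (auto simp: solution_def T_def)
qed

lemma solution_facts:
  assumes "solution s v"
  defines "u \<equiv> hu.U 1 v"
  shows "v \<in> borel_measurable borel" "v r \<le> s" "u \<in> borel_measurable borel" "u r \<le> 1"
    "continuous_on {0..} u" "continuous_on {0..} v" "v = hv.U s u" "u 0 = 1" "v 0 = s"
proof -
  show v: "v \<in> borel_measurable borel" "\<And>r. v r \<le> s" and eq: "v = hv.U s u"
    using assms by (auto simp: solution_def)
  show u: "u \<in> borel_measurable borel" "\<And>r. u r \<le> 1" unfolding u_def
    by (rule hu.U_measurable[OF v] hu.U_le[OF v])+
  show "continuous_on {0..} u" unfolding u_def by (rule hu.U_continuous[OF v])
  show "continuous_on {0..} v" by (subst eq) (rule hv.U_continuous[OF u])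
  show "u 0 = 1" unfolding u_def by (rule hu.U_nonpos) simp
  show "v 0 = s" by (subst eq) (rule hv.U_nonpos, simp)
qed

lemma solution_decreasing:
  assumes s: "solution s v" and r: "0 \<le> t" "t \<le> r"
  shows "hu.U 1 v r \<le> hu.U 1 v t" "v r \<le> v t"
proof -
  note f = solution_facts[OF s]
  show "hu.U 1 v r \<le> hu.U 1 v t" by (rule hu.U_decreasing[OF f(1,2,6) r])
  have "hv.U s (hu.U 1 v) r \<le> hv.U s (hu.U 1 v) t" by (rule hv.U_decreasing[OF f(3,4,5) r])
  then show "v r \<le> v t" using f(7) by simp
qed

lemma solution_radial_system:
  assumes s: "solution s v" and pos: "\<And>r. 0 \<le> r \<Longrightarrow> ereal r < R \<Longrightarrow> 0 < hu.U 1 v r \<and> 0 < v r"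
  shows "radial_system n a b \<delta> \<mu> R (hu.U 1 v) v (\<lambda>r. - hu.J (\<lambda>s. pos_powr \<delta> (v s)) r)
     (\<lambda>r. - hv.J (\<lambda>s. pos_powr \<mu> (hu.U 1 v s)) r)"
proof -
  note f = solution_facts[OF s]
  have sub: "{r. 0 \<le> r \<and> ereal r < R} \<subseteq> {0..}" by auto
  show ?thesis
  proof unfold_locales
    show "n > 2" "a > -2" "b > -2" "\<delta> > 0" "\<mu> > 0" by (rule n ab \<delta>\<mu>)+
    show "continuous_on {r. 0 \<le> r \<and> ereal r < R} (hu.U 1 v)" "continuous_on {r. 0 \<le> r \<and> ereal r < R} v"
      by (rule continuous_on_subset[OF _ sub], rule f)+
    show "continuous_on {r. 0 \<le> r \<and> ereal r < R} (\<lambda>r. - hu.J (\<lambda>s. pos_powr \<delta> (v s)) r)"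
      by (intro continuous_intros continuous_on_subset[OF weighted_integral_continuous_Ici[OF hu.adm[OF f(1,2)] hu.exps(2)] sub])
    show "continuous_on {r. 0 \<le> r \<and> ereal r < R} (\<lambda>r. - hv.J (\<lambda>s. pos_powr \<mu> (hu.U 1 v s)) r)"
      by (intro continuous_intros continuous_on_subset[OF weighted_integral_continuous_Ici[OF hv.adm[OF f(3,4)] hv.exps(2)] sub])
    show "- hu.J (\<lambda>s. pos_powr \<delta> (v s)) 0 = 0" "- hv.J (\<lambda>s. pos_powr \<mu> (hu.U 1 v s)) 0 = 0"
      by (simp_all add: weighted_integral_neg)
    fix r
    assume "0 < r" "ereal r < R"
    then have p: "0 < hu.U 1 v r" "0 < v r" using pos[of r] by auto
    show "(hu.U 1 v has_real_derivative r powr (1 - n) * - hu.J (\<lambda>s. pos_powr \<delta> (v s)) r) (at r)"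
      by (rule hu.U_deriv[OF f(1,2,6) \<open>0 < r\<close>])
    have "(hv.U s (hu.U 1 v) has_real_derivative r powr (1 - n) * - hv.J (\<lambda>s. pos_powr \<mu> (hu.U 1 v s)) r) (at r)"
      by (rule hv.U_deriv[OF f(3,4,5) \<open>0 < r\<close>])
    then show "(v has_real_derivative r powr (1 - n) * - hv.J (\<lambda>s. pos_powr \<mu> (hu.U 1 v s)) r) (at r)"
      by (simp only: f(7)[symmetric])
    show "((\<lambda>r. - hu.J (\<lambda>s. pos_powr \<delta> (v s)) r) has_real_derivative - (r powr (n - 1 + a) * v r powr \<delta>)) (at r)"
      using hu.J_deriv[OF f(1,2,6) \<open>0 < r\<close>] p by (simp add: pos_powr_pos)
    show "((\<lambda>r. - hv.J (\<lambda>s. pos_powr \<mu> (hu.U 1 v s)) r) has_real_derivative - (r powr (n - 1 + b) * hu.U 1 v r powr \<mu>)) (at r)"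
      using hv.J_deriv[OF f(3,4,5) \<open>0 < r\<close>] p by (simp add: pos_powr_pos)
  qed (use pos in auto)
qed

text \<open>Vanishing of u before v, put in a form that is open under pointwise convergence. For the
  solutions V s it persists when s increases.\<close>
definition u_first where "u_first v \<longleftrightarrow> (\<exists>r>0. hu.U 1 v r < 0 \<and> v r > 0)"
definition v_first where "v_first v \<longleftrightarrow> (\<exists>r>0. v r < 0 \<and> hu.U 1 v r > 0)"

lemma not_both_first: "solution s v \<Longrightarrow> u_first v \<Longrightarrow> \<not> v_first v"
proof
  assume s: "solution s v" and "u_first v" "v_first v"
  then obtain r t where r: "0 < r" "hu.U 1 v r < 0" "v r > 0" and t: "0 < t" "v t < 0" "hu.U 1 v t > 0"
    unfolding u_first_def v_first_def by blast
  show False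
  proof (cases "r \<le> t")
    case True
    then show False using solution_decreasing(1)[OF s, of r t] r t by simp
  next
    case False
    then show False using solution_decreasing(2)[OF s, of t r] r t by simp
  qed
qed

lemma u_first_mono: assumes "s \<le> s'" "u_first (V s)" shows "u_first (V s')"
proof -
  obtain r where r: "0 < r" "hu.U 1 (V s) r < 0" "V s r > 0" using assms unfolding u_first_def by blast
  have "hu.U 1 (V s') r \<le> hu.U 1 (V s) r"
    by (rule hu.U_antimono[OF V_measurable V_le V_measurable V_le V_mono[OF assms(1)] order_refl])
  with r V_mono[OF assms(1), of r] show ?thesis unfolding u_first_def by (intro exI[of _ r]) auto
qed

text \<open>On [0, 1] the decrease of v is bounded by a constant c that does not depend on s. Once s - c is large, the
  potential of v^\<delta> at radius 1 exceeds u(0) = 1.\<close>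
lemma large_u_first: "\<exists>s. u_first (V s)"
proof -
  define c where "c = pos_powr \<mu> 1 / (2 + b) / (n - 2)"
  have c: "c \<ge> 0" unfolding c_def using n ab by (intro divide_nonneg_pos pos_powr_nonneg) auto
  define e where "e = 1 / ((2 + a) * (n + a))"
  have e: "e > 0" using n ab by (simp add: e_def)
  \<comment> \<open>a lower bound m of v on the unit interval with m^\<delta> e = 2, which exceeds u(0) = 1\<close>
  define m where "m = (2 / e) powr (1 / \<delta>)"
  have m: "m > 0" "m powr \<delta> = 2 / e" using e \<delta>\<mu> by (simp_all add: m_def powr_powr)
  define s where "s = m + c"
  have lower: "m \<le> V s r" if "0 \<le> r" "r \<le> 1" for r
  proof -
    have "c * r powr (2 + b) \<le> c * 1" using that c ab by (intro mult_left_mono powr_le1) auto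
    moreover have "s - c * r powr (2 + b) \<le> V s r" using V_lower[OF that(1), of s] by (simp add: c_def)
    ultimately show ?thesis by (simp add: s_def)
  qed
  have "m powr \<delta> * e = hu.K (\<lambda>_. m powr \<delta>) 1" by (simp add: hu.K_const e_def)
  also have "\<dots> \<le> hu.K (\<lambda>r. pos_powr \<delta> (V s r)) 1"
  proof (rule hu.K_mono[OF _ hu.adm[OF V_measurable V_le]])
    show "admissible (m powr \<delta>) (\<lambda>_. m powr \<delta>)" by (simp add: admissible_def)
    fix r :: real assume "0 \<le> r" "r \<le> 1"
    from lower[OF this] show "m powr \<delta> \<le> pos_powr \<delta> (V s r)"
      using pos_powr_mono[OF \<delta>\<mu>(1), of m] m by (simp add: pos_powr_pos)
  qed
  finally have "2 \<le> hu.K (\<lambda>r. pos_powr \<delta> (V s r)) 1" using m e by simp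
  then have "hu.U 1 (V s) 1 < 0" by (simp add: hu.U_def)
  moreover have "V s 1 > 0" using lower[of 1] m by simp
  ultimately have "u_first (V s)" unfolding u_first_def by (intro exI[of _ 1]) simp
  then show ?thesis ..
qed

text \<open>On [0, 1] the component u stays above 1/2 if s is small, and then v loses at least a fixed
  amount e up to radius 1.\<close>
lemma small_v_first: "\<exists>s>0. v_first (V s)"
proof -
  define c where "c = 1 / (2 + a) / (n - 2)"
  have c: "c > 0" using n ab by (simp add: c_def)
  define e where "e = (1/2) powr \<mu> / ((2 + b) * (n + b))"
  have e: "e > 0" using n ab by (simp add: e_def)
  define s where "s = min (e / 2) ((1 / (2 * c)) powr (1 / \<delta>))"
  have s: "s > 0" "s < e" using e c by (auto simp: s_def)
  have "s powr \<delta> \<le> ((1 / (2 * c)) powr (1 / \<delta>)) powr \<delta>" using s \<delta>\<mu> by (intro powr_mono2) (auto simp: s_def)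
  then have sc: "s powr \<delta> \<le> 1 / (2 * c)" using c \<delta>\<mu> by (simp add: powr_powr)
  have lower: "1 / 2 \<le> hu.U 1 (V s) r" if "0 \<le> r" "r \<le> 1" for r
  proof -
    have "pos_powr \<delta> s * c * r powr (2 + a) \<le> 1 / (2 * c) * c * 1"
      using that c ab sc s by (intro mult_mono powr_le1) (auto simp: pos_powr_pos)
    moreover have "1 - pos_powr \<delta> s * c * r powr (2 + a) \<le> hu.U 1 (V s) r"
      using hu.U_lower[OF V_measurable V_le that(1), of 1 s] by (simp add: c_def)
    ultimately show ?thesis using c by simp
  qed
  note f = solution_facts[OF V_solution[of s]]
  have "e = hv.K (\<lambda>_. (1/2) powr \<mu>) 1" by (simp add: hv.K_const e_def)
  also have "\<dots> \<le> hv.K (\<lambda>r. pos_powr \<mu> (hu.U 1 (V s) r)) 1"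
  proof (rule hv.K_mono[OF _ hv.adm[OF f(3,4)]])
    show "admissible ((1/2) powr \<mu>) (\<lambda>_. (1/2) powr \<mu>)" by (simp add: admissible_def)
    fix r :: real assume "0 \<le> r" "r \<le> 1"
    from lower[OF this] show "(1/2) powr \<mu> \<le> pos_powr \<mu> (hu.U 1 (V s) r)"
      using pos_powr_mono[OF \<delta>\<mu>(2), of "1/2"] by (simp add: pos_powr_pos)
  qed
  finally have "hv.U s (hu.U 1 (V s)) 1 < 0" using s by (simp add: hv.U_def)
  then have "V s 1 < 0" using f(7) by simp
  moreover have "hu.U 1 (V s) 1 > 0" using lower[of 1] by simp
  ultimately have "v_first (V s)" unfolding v_first_def by (intro exI[of _ 1]) simp
  with s(1) show ?thesis by blast
qed

text \<open>At the infimum of the values with u_first, the limit of solutions from below cannot have u first, and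
  the one from above cannot have v first. The two limits solve the same initial value
  problem; they can be identified only up to the first zero, where powers with exponents below 1 cease to be Lipschitz.\<close>
lemma threshold:
  "\<exists>s>0. \<exists>v w. solution s v \<and> solution s w \<and> \<not> u_first v \<and> \<not> v_first w"
proof -
  obtain s0 where s0: "s0 > 0" "v_first (V s0)" using small_v_first by blast
  define A where "A = {s. u_first (V s)}"
  have A_lower: "s0 \<le> s" if "s \<in> A" for s
  proof (rule ccontr)
    assume "\<not> s0 \<le> s"
    then have "u_first (V s0)" using u_first_mono[of s s0] that by (simp add: A_def)
    with s0(2) not_both_first[OF V_solution] show False by blast
  qed
  have ne: "A \<noteq> {}" using large_u_first by (simp add: A_def)
  have bb: "bdd_below A" by (rule bdd_belowI[OF A_lower])
  define s where "s = Inf A"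
  have s: "s > 0" using cInf_greatest[OF ne A_lower] s0 by (simp add: s_def)
  have below: "\<not> u_first (V t)" if "t < s" for t
    using that cInf_lower[OF _ bb, of t] by (auto simp: s_def A_def)
  have above: "u_first (V t)" if "s < t" for t
  proof -
    have "Inf A < t" using that by (simp add: s_def)
    then obtain z where "z \<in> A" "z < t" using cInf_less_iff[OF ne bb] by blast
    then show ?thesis using u_first_mono[of z t] by (simp add: A_def)
  qed
  have inv: "(\<lambda>i. inverse (real (Suc i))) \<longlonglongrightarrow> 0" by (rule LIMSEQ_inverse_real_of_nat)
  have inv_mono: "inverse (real (Suc (Suc i))) \<le> inverse (real (Suc i))" for i by (simp add: field_simps)
  let ?l = "\<lambda>i. s - inverse (real (Suc i))" and ?r = "\<lambda>i. s + inverse (real (Suc i))"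
  have limits: "?l \<longlonglongrightarrow> s" "?r \<longlonglongrightarrow> s"
    using tendsto_diff[OF tendsto_const inv, of s] tendsto_add[OF tendsto_const inv, of s] by simp_all
  have "\<exists>w. (\<lambda>i. V (?l i) r) \<longlonglongrightarrow> w" for r
  proof -
    have "incseq (\<lambda>i. V (?l i) r)" using inv_mono by (intro incseq_SucI V_mono) simp
    moreover have "V (?l i) r \<le> s" for i using V_le[of "?l i" r] by (smt (verit) inverse_nonnegative_iff_nonnegative of_nat_0_le_iff)
    ultimately show ?thesis using incseq_convergent by metis
  qed
  then obtain v where v: "\<And>r. (\<lambda>i. V (?l i) r) \<longlonglongrightarrow> v r" by metis
  have "\<exists>w. (\<lambda>i. V (?r i) r) \<longlonglongrightarrow> w" for r
  proof -
    have "decseq (\<lambda>i. V (?r i) r)" using inv_mono by (intro decseq_SucI V_mono) simp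
    moreover have "V s r \<le> V (?r i) r" for i by (intro V_mono) simp
    ultimately show ?thesis using decseq_convergent by metis
  qed
  then obtain w where w: "\<And>r. (\<lambda>i. V (?r i) r) \<longlonglongrightarrow> w r" by metis
  have sol_v: "solution s v"
    by (rule solution_limit[OF V_solution limits(1) _ v, where C = s]) simp
  have sol_w: "solution s w"
  proof (rule solution_limit[OF V_solution limits(2) _ w, where C = "s + 1"])
    show "?r i \<le> s + 1" for i by (simp add: field_simps)
  qed
  have limU: "(\<lambda>i. hu.U 1 (V (t i)) r) \<longlonglongrightarrow> hu.U 1 z r"
    if "\<And>r. (\<lambda>i. V (t i) r) \<longlonglongrightarrow> z r" "\<And>i. t i \<le> s + 1" for t :: "nat \<Rightarrow> real" and z r
    by (rule hu.U_limit[OF V_measurable _ that(1) tendsto_const, where C = "s + 1"])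
       (use V_le that(2) order_trans in blast)
  have "\<not> u_first v"
  proof
    assume "u_first v"
    then obtain r where r: "0 < r" "hu.U 1 v r < 0" "v r > 0" unfolding u_first_def by blast
    have "(\<lambda>i. hu.U 1 (V (?l i)) r) \<longlonglongrightarrow> hu.U 1 v r"
      by (rule limU[OF v]) (smt (verit) inverse_nonnegative_iff_nonnegative of_nat_0_le_iff)
    from order_tendstoD(2)[OF this r(2)] order_tendstoD(1)[OF v r(3)]
    have "\<forall>\<^sub>F i in sequentially. hu.U 1 (V (?l i)) r < 0 \<and> V (?l i) r > 0" by (rule eventually_conj)
    then obtain i where "hu.U 1 (V (?l i)) r < 0 \<and> V (?l i) r > 0" using eventually_happens' by force
    then have "u_first (V (?l i))" using r(1) unfolding u_first_def by blast
    with below[of "?l i"] show False by simp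
  qed
  moreover have "\<not> v_first w"
  proof
    assume "v_first w"
    then obtain r where r: "0 < r" "w r < 0" "hu.U 1 w r > 0" unfolding v_first_def by blast
    have "(\<lambda>i. hu.U 1 (V (?r i)) r) \<longlonglongrightarrow> hu.U 1 w r"
      by (rule limU[OF w]) (simp add: field_simps)
    from order_tendstoD(1)[OF this r(3)] order_tendstoD(2)[OF w r(2)]
    have "\<forall>\<^sub>F i in sequentially. hu.U 1 (V (?r i)) r > 0 \<and> V (?r i) r < 0" by (rule eventually_conj)
    then obtain i where "hu.U 1 (V (?r i)) r > 0 \<and> V (?r i) r < 0" using eventually_happens' by force
    then have "v_first (V (?r i))" using r(1) unfolding v_first_def by blast
    with above[of "?r i"] not_both_first[OF V_solution] show False by simp
  qed
  ultimately show ?thesis using s sol_v sol_w by blast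
qed

text \<open>Up to the first zero of any of the four functions the two threshold solutions coincide. If only one
  component vanished there, U_crosses would put that component first, which one of the two solutions excludes.\<close>
theorem shooting_dichotomy:
  "(\<exists>u v p q. radial_system n a b \<delta> \<mu> \<infinity> u v p q) \<or>
   (\<exists>R>0. \<exists>u v p q. radial_system n a b \<delta> \<mu> (ereal R) u v p q \<and>
      continuous_on {0..R} u \<and> continuous_on {0..R} v \<and> u R = 0 \<and> v R = 0)"
proof -
  obtain s v w where s: "s > 0" and v: "solution s v" "\<not> u_first v" and w: "solution s w" "\<not> v_first w"
    using threshold by blast
  note fv = solution_facts[OF v(1)] and fw = solution_facts[OF w(1)]
  define u where "u = hu.U 1 v"
  define z where "z = hu.U 1 w"
  define m where "m r = min (min (u r) (v r)) (min (z r) (w r))" for r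
  have m0: "m 0 > 0" using s fv(8,9) fw(8,9) by (simp add: m_def u_def z_def)
  have cont: "continuous_on {0..R} u" "continuous_on {0..R} v" "continuous_on {0..R} z" "continuous_on {0..R} w" for R
    unfolding u_def z_def by (rule continuous_on_subset[OF fv(5)] continuous_on_subset[OF fv(6)]
        continuous_on_subset[OF fw(5)] continuous_on_subset[OF fw(6)], simp)+
  have mc: "continuous_on {0..R} m" for R unfolding m_def by (intro continuous_intros cont)
  show ?thesis
  proof (cases "\<forall>r\<ge>0. m r > 0")
    case True
    then have "radial_system n a b \<delta> \<mu> \<infinity> u v (\<lambda>r. - hu.J (\<lambda>s. pos_powr \<delta> (v s)) r)
     (\<lambda>r. - hv.J (\<lambda>s. pos_powr \<mu> (hu.U 1 v s)) r)"
      unfolding u_def by (intro solution_radial_system[OF v(1)]) (auto simp: m_def u_def)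
    then show ?thesis by blast
  next
    case False
    then obtain r where r: "r \<ge> 0" "m r \<le> 0" by force
    obtain R where R: "0 < R" "m R = 0" "\<And>t. 0 \<le> t \<Longrightarrow> t < R \<Longrightarrow> m t > 0"
      using first_zero[OF r(1) mc m0 r(2)] by blast
    have pos: "0 < u t" "0 < v t" "0 < z t" "0 < w t" if "0 \<le> t" "t < R" for t
      using R(3)[OF that] by (auto simp: m_def)
    have rv: "radial_system n a b \<delta> \<mu> (ereal R) u v (\<lambda>r. - hu.J (\<lambda>s. pos_powr \<delta> (v s)) r)
       (\<lambda>r. - hv.J (\<lambda>s. pos_powr \<mu> (hu.U 1 v s)) r)"
      unfolding u_def by (intro solution_radial_system[OF v(1)]) (use pos in \<open>auto simp: u_def\<close>)
    have rw: "radial_system n a b \<delta> \<mu> (ereal R) z w (\<lambda>r. - hu.J (\<lambda>s. pos_powr \<delta> (w s)) r)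
       (\<lambda>r. - hv.J (\<lambda>s. pos_powr \<mu> (hu.U 1 w s)) r)"
      unfolding z_def by (intro solution_radial_system[OF w(1)]) (use pos in \<open>auto simp: z_def\<close>)
    have eq: "u t = z t \<and> v t = w t" if "0 \<le> t" "t < R" for t
      using radial_system_unique[OF rv rw, of t] that fv(8,9) fw(8,9) by (simp add: u_def z_def)
    note lim = continuous_on_tendsto_at_left[OF _ R(1)]
    have ev: "\<forall>\<^sub>F t in at_left R. 0 \<le> t \<and> t < R"
      using eventually_at_left_real[OF R(1)] by eventually_elim auto
    have eqR: "u R = z R" "v R = w R"
    proof -
      have "\<forall>\<^sub>F t in at_left R. u t = z t" "\<forall>\<^sub>F t in at_left R. v t = w t"
        using ev by (eventually_elim, use eq in blast)+
      then show "u R = z R" "v R = w R"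
        using tendsto_unique[OF _ Lim_transform_eventually[OF lim[OF cont(1)]] lim[OF cont(3)]]
          tendsto_unique[OF _ Lim_transform_eventually[OF lim[OF cont(2)]] lim[OF cont(4)]] by auto
    qed
    have nn: "u R \<ge> 0" "v R \<ge> 0" using R(2) by (auto simp: m_def min_def split: if_splits)
    have zero: "u R = 0 \<or> v R = 0" using R(2) eqR by (auto simp: m_def min_def split: if_splits)
    have "\<not> (u R = 0 \<and> v R > 0)"
      using hu.U_crosses[OF fv(1,2,6) R(1), of 1] v(2) by (auto simp: u_def u_first_def)
    moreover have "\<not> (v R = 0 \<and> u R > 0)"
    proof
      assume vR: "v R = 0 \<and> u R > 0"
      then have "hv.U s z R = 0" "z R > 0" using fw(7) eqR by (auto simp: z_def)
      then have "\<exists>r>0. hv.U s z r < 0 \<and> z r > 0"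
        using hv.U_crosses[OF fw(3,4,5) R(1), of s] by (simp add: z_def)
      then have "v_first w" using fw(7) by (simp add: z_def v_first_def)
      with w(2) show False by simp
    qed
    ultimately have "u R = 0" "v R = 0" using nn zero by auto
    then show ?thesis using rv R(1) cont by blast
  qed
qed

end

section \<open>The critical flow in logarithmic variables\<close>

text \<open>The equations of a critical ground state in t = ln r, for U = r^\<gamma> u, V = r^\<xi> v and their
  logarithmic derivatives - x, - y. The energy equation is the vanishing of the Pohozaev energy.
  The bounds on x and y say that - r u' / u and - r v' / v lie between 0 and n - 2 = \<gamma> + \<xi>, and the start condition
  reflects that both quotients vanish at the origin.\<close>
locale critical_flow =
  fixes \<gamma> \<xi> \<delta> \<mu> :: real and x y U V :: "real \<Rightarrow> real"
  assumes pos: "\<gamma> > 0" "\<xi> > 0" "\<delta> > 0" "\<mu> > 0"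
    and superlinear: "\<delta> * \<mu> > 1"
    and UV_pos: "U t > 0" "V t > 0"
    and UV_bounded: "\<exists>M. \<forall>t. U t \<le> M \<and> V t \<le> M"
    and dU: "(U has_real_derivative - x t * U t) (at t)"
    and dV: "(V has_real_derivative - y t * V t) (at t)"
    and dx: "(x has_real_derivative (x t + \<gamma>) * (x t - \<xi>) + V t powr \<delta> / U t) (at t)"
    and dy: "(y has_real_derivative (y t + \<xi>) * (y t - \<gamma>) + U t powr \<mu> / V t) (at t)"
    and energy: "x t * y t = \<gamma> * \<xi> - V t powr \<delta> / U t / (\<delta> + 1) - U t powr \<mu> / V t / (\<mu> + 1)"
    and x_bounds: "- \<gamma> \<le> x t" "x t \<le> \<xi>"
    and y_bounds: "- \<xi> \<le> y t" "y t \<le> \<gamma>"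
    and start: "\<exists>T. \<forall>t\<le>T. x t < 0 \<and> y t < 0"

lemma critical_flow_swap:
  assumes "critical_flow \<gamma> \<xi> \<delta> \<mu> x y U V"
  shows "critical_flow \<xi> \<gamma> \<mu> \<delta> y x V U"
proof -
  interpret critical_flow \<gamma> \<xi> \<delta> \<mu> x y U V by fact
  show ?thesis
    using pos superlinear UV_pos UV_bounded dU dV dx dy energy x_bounds y_bounds start
    by unfold_locales (auto simp: mult.commute algebra_simps)
qed

context critical_flow
begin

definition P where "P t = V t powr \<delta> / U t"
definition Q where "Q t = U t powr \<mu> / V t"

lemma dx': "(x has_real_derivative (x t + \<gamma>) * (x t - \<xi>) + P t) (at t)"
  using dx by (simp add: P_def)
lemma dy': "(y has_real_derivative (y t + \<xi>) * (y t - \<gamma>) + Q t) (at t)"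
  using dy by (simp add: Q_def)
lemma energy': "x t * y t = \<gamma> * \<xi> - P t / (\<delta> + 1) - Q t / (\<mu> + 1)"
  using energy by (simp add: P_def Q_def)

lemma PQ_pos: "P t > 0" "Q t > 0"
  using UV_pos[of t] by (simp_all add: P_def Q_def)

lemma UV_neq: "U t \<noteq> 0" "V t \<noteq> 0" using UV_pos[of t] by auto

lemma dV_powr: "((\<lambda>t. V t powr \<delta>) has_real_derivative - \<delta> * y t * V t powr \<delta>) (at t)"
  using UV_pos[of t]
  by (auto intro!: derivative_eq_intros dV simp: powr_diff)

lemma dP: "(P has_real_derivative P t * (x t - \<delta> * y t)) (at t)"
proof -
  have "((\<lambda>t. V t powr \<delta> / U t) has_real_derivative
     ((- \<delta> * y t * V t powr \<delta>) * U t - V t powr \<delta> * (- x t * U t)) / (U t * U t)) (at t)"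
    by (intro DERIV_divide dV_powr dU UV_neq)
  also have "((- \<delta> * y t * V t powr \<delta>) * U t - V t powr \<delta> * (- x t * U t)) / (U t * U t)
      = P t * (x t - \<delta> * y t)"
    using UV_neq[of t] by (simp add: P_def field_simps)
  finally show ?thesis by (simp add: P_def[abs_def])
qed

lemma conts: "continuous_on A x" "continuous_on A y" "continuous_on A U" "continuous_on A V" "continuous_on A P"
  using dx dy dU dV dP by (meson DERIV_isCont continuous_at_imp_continuous_on)+

lemma exponents: "1 / (\<delta> + 1) + 1 / (\<mu> + 1) < 1"
proof -
  have "(\<mu> + 1) + (\<delta> + 1) < (\<delta> + 1) * (\<mu> + 1)" using superlinear by (simp add: algebra_simps)
  then show ?thesis using pos by (simp add: field_simps)
qed

text \<open>This is where E = 0 enters: P / (\<delta> + 1) + Q / (\<mu> + 1) = \<gamma> \<xi> - x y, and the weights have sum less than 1.\<close>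
lemma not_both_small:
  assumes "P t \<le> \<gamma> * \<xi>" "Q t \<le> \<gamma> * \<xi>" shows "x t * y t > 0"
proof -
  have "P t / (\<delta> + 1) + Q t / (\<mu> + 1) \<le> \<gamma> * \<xi> / (\<delta> + 1) + \<gamma> * \<xi> / (\<mu> + 1)"
    using assms pos by (intro add_mono divide_right_mono) auto
  also have "\<dots> = \<gamma> * \<xi> * (1 / (\<delta> + 1) + 1 / (\<mu> + 1))" by (simp add: algebra_simps)
  also have "\<dots> < \<gamma> * \<xi>" using exponents pos by simp
  finally show ?thesis using energy'[of t] by linarith
qed

text \<open>A nonzero limit would be an equilibrium, that is P = Q = \<gamma> \<xi>. By the energy equation x y would then have a
  positive limit, so that x would stay away from 0 and ln U could not converge.\<close>
lemma limit_zero: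
  assumes limU: "(U \<longlongrightarrow> u0) at_top" and limV: "(V \<longlongrightarrow> v0) at_top"
  shows "u0 = 0 \<and> v0 = 0"
proof -
  obtain M where M: "\<And>t. U t \<le> M" using UV_bounded by blast
  obtain M' where M': "\<And>t. V t \<le> M'" using UV_bounded by blast
  have nn: "u0 \<ge> 0" "v0 \<ge> 0"
    using tendsto_lowerbound[OF limU always_eventually] tendsto_lowerbound[OF limV always_eventually] UV_pos
    by (meson less_imp_le trivial_limit_at_top_linorder)+
  have limVp: "((\<lambda>t. V t powr \<delta>) \<longlongrightarrow> v0 powr \<delta>) at_top"
    using pos UV_pos limV by (intro tendsto_powr' tendsto_const) (auto intro!: always_eventually less_imp_le)
  have limUp: "((\<lambda>t. U t powr \<mu>) \<longlongrightarrow> u0 powr \<mu>) at_top"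
    using pos UV_pos limU by (intro tendsto_powr' tendsto_const) (auto intro!: always_eventually less_imp_le)
  have eq1: "\<gamma> * \<xi> * u0 = v0 powr \<delta>"
  proof -
    have "\<gamma> * \<xi> * u0 - v0 powr \<delta> = 0"
    proof (rule bounded_imp_deriv_limit_zero)
      \<comment> \<open>this is the bounded function U' + (\<xi> - \<gamma>) U, whose derivative is read off from the second-order equation of U\<close>
      show "((\<lambda>t. (\<xi> - \<gamma> - x t) * U t) has_real_derivative \<gamma> * \<xi> * U t - V t powr \<delta>) (at t)" for t
        using UV_neq[of t] by (auto intro!: derivative_eq_intros dU dx simp: field_simps)
      show "((\<lambda>t. \<gamma> * \<xi> * U t - V t powr \<delta>) \<longlongrightarrow> \<gamma> * \<xi> * u0 - v0 powr \<delta>) at_top"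
        by (intro tendsto_intros limU limVp)
      fix t
      have "\<bar>\<xi> - \<gamma> - x t\<bar> \<le> \<xi> + \<gamma>" using x_bounds[of t] pos by linarith
      then show "\<bar>(\<xi> - \<gamma> - x t) * U t\<bar> \<le> (\<xi> + \<gamma>) * M"
        using M[of t] UV_pos[of t] pos by (auto simp: abs_mult intro!: mult_mono)
    qed
    then show ?thesis by simp
  qed
  have eq2: "\<gamma> * \<xi> * v0 = u0 powr \<mu>"
  proof -
    have "\<gamma> * \<xi> * v0 - u0 powr \<mu> = 0"
    proof (rule bounded_imp_deriv_limit_zero)
      show "((\<lambda>t. (\<gamma> - \<xi> - y t) * V t) has_real_derivative \<gamma> * \<xi> * V t - U t powr \<mu>) (at t)" for t
        using UV_neq[of t] by (auto intro!: derivative_eq_intros dV dy simp: field_simps)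
      show "((\<lambda>t. \<gamma> * \<xi> * V t - U t powr \<mu>) \<longlongrightarrow> \<gamma> * \<xi> * v0 - u0 powr \<mu>) at_top"
        by (intro tendsto_intros limV limUp)
      fix t
      have "\<bar>\<gamma> - \<xi> - y t\<bar> \<le> \<xi> + \<gamma>" using y_bounds[of t] pos by linarith
      then show "\<bar>(\<gamma> - \<xi> - y t) * V t\<bar> \<le> (\<xi> + \<gamma>) * M'"
        using M'[of t] UV_pos[of t] pos by (auto simp: abs_mult intro!: mult_mono)
    qed
    then show ?thesis by simp
  qed
  show ?thesis
  proof (rule ccontr)
    assume "\<not> ?thesis"
    then have "u0 > 0" "v0 > 0" using nn eq1 eq2 pos by (auto simp: less_le)
    define k where "k = \<gamma> * \<xi> * (1 - 1 / (\<delta> + 1) - 1 / (\<mu> + 1))"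
    have "k > 0" using exponents pos by (simp add: k_def)
    have "((\<lambda>t. x t * y t) \<longlongrightarrow> \<gamma> * \<xi> - v0 powr \<delta> / u0 / (\<delta> + 1) - u0 powr \<mu> / v0 / (\<mu> + 1)) at_top"
      unfolding energy using \<open>u0 > 0\<close> \<open>v0 > 0\<close> pos
      by (intro tendsto_intros limU limV limUp limVp) auto
    also have "\<gamma> * \<xi> - v0 powr \<delta> / u0 / (\<delta> + 1) - u0 powr \<mu> / v0 / (\<mu> + 1) = k"
      using \<open>u0 > 0\<close> \<open>v0 > 0\<close> eq1[symmetric] eq2[symmetric] by (simp add: k_def algebra_simps)
    finally have "\<forall>\<^sub>F t in at_top. x t * y t > k / 2"
      by (rule order_tendstoD) (use \<open>k > 0\<close> in simp)
    moreover have "((\<lambda>t. ln (U t)) \<longlongrightarrow> ln u0) at_top"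
      using limU \<open>u0 > 0\<close> by (intro tendsto_ln) auto
    from tendstoD[OF this, of "k / (4 * (\<xi> + \<gamma>))"]
    have "\<forall>\<^sub>F t in at_top. \<bar>ln (U t) - ln u0\<bar> < k / (4 * (\<xi> + \<gamma>))"
      using \<open>k > 0\<close> pos by (simp add: dist_real_def)
    ultimately have "\<forall>\<^sub>F t in at_top. x t * y t > k / 2 \<and> \<bar>ln (U t) - ln u0\<bar> < k / (4 * (\<xi> + \<gamma>))"
      by eventually_elim auto
    then obtain T where T: "\<And>t. t \<ge> T \<Longrightarrow> x t * y t > k / 2"
        "\<And>t. t \<ge> T \<Longrightarrow> \<bar>ln (U t) - ln u0\<bar> < k / (4 * (\<xi> + \<gamma>))"
      by (auto simp: eventually_at_top_linorder)
    have dln: "((\<lambda>t. ln (U t)) has_real_derivative - x t) (at t)" for t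
      using UV_pos[of t] by (auto intro!: derivative_eq_intros dU)
    obtain z where z: "z > T" "ln (U (T + 1)) - ln (U T) = (T + 1 - T) * (- x z)"
      using MVT2[of T "T + 1" "\<lambda>t. ln (U t)" "\<lambda>t. - x t"] dln by auto
    define c where "c = k / (4 * (\<xi> + \<gamma>))"
    have "\<bar>ln (U (T + 1)) - ln u0\<bar> < c" "\<bar>ln (U T) - ln u0\<bar> < c"
      using T(2) by (simp_all add: c_def)
    moreover have "x z = ln (U T) - ln (U (T + 1))" using z by simp
    ultimately have "\<bar>x z\<bar> < 2 * c" by linarith
    moreover have "\<bar>y z\<bar> \<le> \<xi> + \<gamma>" using y_bounds[of z] pos by linarith
    ultimately have "\<bar>x z\<bar> * \<bar>y z\<bar> \<le> 2 * c * (\<xi> + \<gamma>)"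
      using pos by (intro mult_mono) auto
    also have "\<dots> = k / 2" using pos by (simp add: c_def field_simps)
    finally have "x z * y z \<le> k / 2" using abs_ge_self[of "x z * y z"] by (simp add: abs_mult)
    with T(1)[of z] z show False by simp
  qed
qed

lemma U_mono_interval:
  assumes "s \<le> t" "\<And>r. s \<le> r \<Longrightarrow> r \<le> t \<Longrightarrow> x r \<le> 0" shows "U s \<le> U t"
  by (rule deriv_nonneg_imp_le_closed[OF assms(1) dU])
     (use assms(2) UV_pos in \<open>auto simp: mult_nonpos_nonneg less_imp_le\<close>)

lemma V_mono_interval:
  assumes "s \<le> t" "\<And>r. s \<le> r \<Longrightarrow> r \<le> t \<Longrightarrow> y r \<le> 0" shows "V s \<le> V t"
  by (rule deriv_nonneg_imp_le_closed[OF assms(1) dV])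
     (use assms(2) UV_pos in \<open>auto simp: mult_nonpos_nonneg less_imp_le\<close>)

lemma U_antimono_interval:
  assumes "s \<le> t" "\<And>r. s \<le> r \<Longrightarrow> r \<le> t \<Longrightarrow> x r \<ge> 0" shows "U t \<le> U s"
proof -
  have "- U s \<le> - U t"
    by (rule deriv_nonneg_imp_le_closed[OF assms(1) DERIV_minus[OF dU]])
       (use assms(2) UV_pos in \<open>auto simp: less_imp_le\<close>)
  then show ?thesis by simp
qed

lemma V_antimono_interval:
  assumes "s \<le> t" "\<And>r. s \<le> r \<Longrightarrow> r \<le> t \<Longrightarrow> y r \<ge> 0" shows "V t \<le> V s"
proof -
  have "- V s \<le> - V t"
    by (rule deriv_nonneg_imp_le_closed[OF assms(1) DERIV_minus[OF dV]])
       (use assms(2) UV_pos in \<open>auto simp: less_imp_le\<close>)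
  then show ?thesis by simp
qed

lemma U_not_increasing:
  assumes xs: "\<And>t. t \<ge> T \<Longrightarrow> x t \<le> 0" and ys: "(\<forall>t\<ge>T. y t \<le> 0) \<or> (\<forall>t\<ge>T. y t \<ge> 0)"
  shows False
proof -
  obtain M where M: "\<And>t. U t \<le> M" "\<And>t. V t \<le> M" using UV_bounded by blast
  have incr: "U s \<le> U t" if "T \<le> s" "s \<le> t" for s t
    using U_mono_interval[of s t] xs that by simp
  obtain u0 where u0: "(U \<longlongrightarrow> u0) at_top" "\<And>t. T \<le> t \<Longrightarrow> U t \<le> u0"
    using incr_bounded_tendsto[of T U M] incr M by blast
  have "\<exists>v0. (V \<longlongrightarrow> v0) at_top"
    using ys
  proof
    assume "\<forall>t\<ge>T. y t \<le> 0"
    then have mono: "V s \<le> V t" if "T \<le> s" "s \<le> t" for s t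
      using V_mono_interval[of s t] that by simp
    show ?thesis by (rule incr_bounded_tendsto[of T V M, OF mono M(2)]) blast+
  next
    assume "\<forall>t\<ge>T. y t \<ge> 0"
    then have mono: "V t \<le> V s" if "T \<le> s" "s \<le> t" for s t
      using V_antimono_interval[of s t] that by simp
    show ?thesis by (rule decr_bounded_tendsto[of T V 0, OF mono less_imp_le[OF UV_pos(2)]]) blast+
  qed
  then obtain v0 where v0: "(V \<longlongrightarrow> v0) at_top" by blast
  have "u0 = 0" using limit_zero[OF u0(1) v0] by simp
  with u0(2)[of T] UV_pos[of T] show False by simp
qed

text \<open>The functions x u and y v solve the linearised radial system, because up to sign they generate its scaling.
  Up to powers of r, \<Phi> is the flux of x u, and \<Theta> the derivative of its Kelvin transform r^(n-2) x u.
  Both decrease where y > 0 and increase where y < 0.\<close>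
definition \<Theta> where "\<Theta> t = exp (- \<gamma> * t) * (V t powr \<delta> - \<gamma> * \<xi> * U t + \<gamma> * x t * U t)"
definition \<Phi> where "\<Phi> t = exp (\<xi> * t) * (V t powr \<delta> - \<xi> * (x t + \<gamma>) * U t)"

lemma d\<Theta>: "(\<Theta> has_real_derivative - \<delta> * y t * V t powr \<delta> * exp (- \<gamma> * t)) (at t)"
  unfolding \<Theta>_def using UV_neq[of t]
  by (auto intro!: derivative_eq_intros dU dV dx UV_pos simp: powr_diff less_imp_le[OF UV_pos(2)])
     (simp add: field_simps)

lemma d\<Phi>: "(\<Phi> has_real_derivative - \<delta> * y t * V t powr \<delta> * exp (\<xi> * t)) (at t)"
  unfolding \<Phi>_def using UV_neq[of t]
  by (auto intro!: derivative_eq_intros dU dV dx UV_pos simp: powr_diff less_imp_le[OF UV_pos(2)])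
     (simp add: field_simps)

lemma dxU: "((\<lambda>t. exp (\<xi> * t) * U t * x t) has_real_derivative exp ((\<xi> + \<gamma>) * t) * \<Theta> t) (at t)"
  unfolding \<Theta>_def using UV_neq[of t]
  by (auto intro!: derivative_eq_intros dU dx) (simp add: field_simps flip: exp_add)

lemma dxU': "((\<lambda>t. exp (- \<gamma> * t) * U t * x t) has_real_derivative exp (- (\<xi> + \<gamma>) * t) * \<Phi> t) (at t)"
  unfolding \<Phi>_def using UV_neq[of t]
  by (auto intro!: derivative_eq_intros dU dx) (simp add: field_simps flip: exp_add)

lemma \<Theta>_P: "\<Theta> t = exp (- \<gamma> * t) * U t * (P t - \<gamma> * \<xi> + \<gamma> * x t)"
  using UV_neq[of t] by (simp add: \<Theta>_def P_def field_simps)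

lemma \<Phi>_P: "\<Phi> t = exp (\<xi> * t) * U t * (P t - \<xi> * (x t + \<gamma>))"
  using UV_neq[of t] by (simp add: \<Phi>_def P_def field_simps)

end

context critical_flow
begin

text \<open>Under these conditions the region x \<le> 0 < y is never left: while y > 0, \<Theta> decreases and keeps
  r^(n-2) x u from increasing, and while x \<le> 0 the companion of \<Theta> keeps r^(n-2) y v from decreasing. But then U
  increases and V decreases forever, which U_not_increasing excludes. Using the
  Kelvin transforms, instead of x u and y v, is what makes the hypotheses weak enough for no_exit.\<close>
lemma trap:
  assumes t0: "x t0 = 0" "y t0 > 0" "P t0 \<le> \<gamma> * \<xi>" "Q t0 - \<gamma> * \<xi> + \<xi> * y t0 \<ge> 0"
  shows False
proof -
  interpret sw: critical_flow \<xi> \<gamma> \<mu> \<delta> y x V U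
    by (rule critical_flow_swap) unfold_locales
  have swP: "sw.P = Q" by (auto simp: sw.P_def Q_def)
  have "\<Theta> t0 \<le> 0" using t0 UV_pos[of t0] by (simp add: \<Theta>_P mult_nonneg_nonpos)
  have "sw.\<Theta> t0 \<ge> 0" using t0 UV_pos[of t0] by (simp add: sw.\<Theta>_P swP mult.commute)
  have x_le: "x t \<le> 0" if "t0 \<le> t" and ynn: "\<And>r. t0 \<le> r \<Longrightarrow> r \<le> t \<Longrightarrow> y r \<ge> 0" for t
  proof -
    have th: "\<Theta> r \<le> 0" if r: "t0 \<le> r" "r \<le> t" for r
    proof -
      have "- \<Theta> t0 \<le> - \<Theta> r"
        by (rule deriv_nonneg_imp_le_closed[OF r(1) DERIV_minus[OF d\<Theta>]])
           (use ynn r pos in \<open>auto intro!: mult_nonneg_nonneg\<close>)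
      with \<open>\<Theta> t0 \<le> 0\<close> show ?thesis by simp
    qed
    have "- (exp (\<xi> * t0) * U t0 * x t0) \<le> - (exp (\<xi> * t) * U t * x t)"
      by (rule deriv_nonneg_imp_le_closed[OF that(1) DERIV_minus[OF dxU]])
         (use th in \<open>auto simp: mult_nonneg_nonpos\<close>)
    then show ?thesis using t0 UV_pos[of t] by (simp add: mult_le_0_iff)
  qed
  have y_pos: "y t > 0" if "t0 \<le> t" for t
  proof (rule ccontr)
    assume "\<not> y t > 0"
    then have "y t \<le> 0" by simp
    obtain t3 where t3: "t0 < t3" "y t3 = 0" "\<And>r. t0 \<le> r \<Longrightarrow> r < t3 \<Longrightarrow> y r > 0"
      using first_zero[OF \<open>t0 \<le> t\<close> conts(2) t0(2) \<open>y t \<le> 0\<close>] by blast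
    then have y_nn: "y r \<ge> 0" if "t0 \<le> r" "r \<le> t3" for r
      using that by (cases "r = t3") (auto intro: less_imp_le)
    have th: "sw.\<Theta> r \<ge> 0" if r: "t0 \<le> r" "r \<le> t3" for r
    proof -
      have "sw.\<Theta> t0 \<le> sw.\<Theta> r"
      proof (rule deriv_nonneg_imp_le_closed[OF r(1) sw.d\<Theta>])
        fix z assume z: "t0 \<le> z" "z \<le> r"
        have "x z \<le> 0" using x_le[of z] y_nn z r by auto
        then show "0 \<le> - \<mu> * x z * U z powr \<mu> * exp (- \<xi> * z)"
          using pos by (simp add: mult_le_0_iff)
      qed
      with \<open>sw.\<Theta> t0 \<ge> 0\<close> show ?thesis by simp
    qed
    have "exp (\<gamma> * t0) * V t0 * y t0 \<le> exp (\<gamma> * t3) * V t3 * y t3"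
      by (rule deriv_nonneg_imp_le_closed[OF _ sw.dxU]) (use th t3 in auto)
    moreover have "0 < exp (\<gamma> * t0) * V t0 * y t0" using t0 UV_pos by simp
    ultimately show False using t3 by simp
  qed
  then have "x t \<le> 0" if "t0 \<le> t" for t
    using x_le[OF that] by (meson less_imp_le)
  then show False using U_not_increasing[of t0] y_pos by (meson less_imp_le)
qed

lemma x_nonneg_left_imp_P_le:
  assumes "t0 < t" "x t = 0" "\<And>r. t0 \<le> r \<Longrightarrow> r < t \<Longrightarrow> x r > 0" shows "P t \<le> \<gamma> * \<xi>"
proof (rule ccontr)
  assume "\<not> P t \<le> \<gamma> * \<xi>"
  then have "(x t + \<gamma>) * (x t - \<xi>) + P t > 0" using assms by simp
  from DERIV_pos_inc_left[OF dx' this] obtain d where d: "d > 0" "\<And>h. 0 < h \<Longrightarrow> h < d \<Longrightarrow> x (t - h) < x t"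
    by blast
  define h where "h = min (d / 2) (t - t0)"
  have "0 < h" "h < d" "t0 \<le> t - h" using d assms by (auto simp: h_def)
  then show False using d(2)[of h] assms(2) assms(3)[of "t - h"] by simp
qed

text \<open>When x reaches 0 from above, P \<le> \<gamma> \<xi>, so E = 0 forces Q > \<gamma> \<xi>; for y > 0 this is the trap.\<close>
lemma no_exit:
  assumes "t0 < t" "x t = 0" "y t \<ge> 0" and before: "\<And>r. t0 \<le> r \<Longrightarrow> r < t \<Longrightarrow> x r > 0 \<and> y r > 0"
  shows False
proof -
  interpret sw: critical_flow \<xi> \<gamma> \<mu> \<delta> y x V U
    by (rule critical_flow_swap) unfold_locales
  have swP: "sw.P = Q" by (auto simp: sw.P_def Q_def)
  have "P t \<le> \<gamma> * \<xi>" using x_nonneg_left_imp_P_le[of t0 t] assms by auto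
  then have "Q t > \<gamma> * \<xi>" using not_both_small[of t] assms by force
  show False
  proof (cases "y t = 0")
    case True
    then have "Q t \<le> \<xi> * \<gamma>" using sw.x_nonneg_left_imp_P_le[of t0 t] assms swP by auto
    with \<open>Q t > \<gamma> * \<xi>\<close> show False by (simp add: mult.commute)
  next
    case False
    then show False using trap[of t] \<open>P t \<le> \<gamma> * \<xi>\<close> \<open>Q t > \<gamma> * \<xi>\<close> assms pos by auto
  qed
qed

lemma positive_quadrant_invariant:
  assumes "x t0 > 0" "y t0 > 0" "t0 \<le> t" shows "x t > 0 \<and> y t > 0"
proof (rule ccontr)
  interpret sw: critical_flow \<xi> \<gamma> \<mu> \<delta> y x V U
    by (rule critical_flow_swap) unfold_locales
  assume "\<not> ?thesis"
  then have "min (x t) (y t) \<le> 0" by auto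
  moreover have "continuous_on {t0..t} (\<lambda>r. min (x r) (y r))" by (intro continuous_intros conts)
  moreover have "min (x t0) (y t0) > 0" using assms by simp
  ultimately obtain t3 where t3: "t0 < t3" "min (x t3) (y t3) = 0"
      "\<And>r. t0 \<le> r \<Longrightarrow> r < t3 \<Longrightarrow> min (x r) (y r) > 0"
    using first_zero[OF \<open>t0 \<le> t\<close>] by blast
  show False
  proof (cases "x t3 = 0")
    case True
    with t3 have "y t3 \<ge> 0" by (auto simp: min_def split: if_splits)
    with t3 True show False using no_exit[of t0 t3] by auto
  next
    case False
    with t3 have "y t3 = 0" "x t3 \<ge> 0" by (auto simp: min_def split: if_splits)
    with t3 show False using sw.no_exit[of t0 t3] by auto
  qed
qed

text \<open>As t \<rightarrow> - \<infinity>, \<Phi> tends to 0, and it increases as long as y < 0.\<close>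
lemma \<Phi>_pos:
  assumes "\<And>r. r < t \<Longrightarrow> y r < 0" shows "\<Phi> t > 0"
proof -
  have d: "0 < - \<delta> * y r * V r powr \<delta> * exp (\<xi> * r)" if "r < t" for r
    using assms[OF that] pos UV_pos[of r] by (simp add: mult_less_0_iff)
  have less: "\<Phi> r < \<Phi> s" if "r < s" "s \<le> t" for r s
  proof (rule deriv_pos_imp_less[OF that(1)])
    show "continuous_on {r..s} \<Phi>" using d\<Phi> by (meson DERIV_isCont continuous_at_imp_continuous_on)
    show "(\<Phi> has_real_derivative - \<delta> * y z * V z powr \<delta> * exp (\<xi> * z)) (at z)" for z by (rule d\<Phi>)
  qed (use d that in auto)
  obtain M where M: "\<And>t. U t \<le> M" "\<And>t. V t \<le> M" using UV_bounded by blast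
  have bd: "\<bar>V r powr \<delta> - \<xi> * (x r + \<gamma>) * U r\<bar> \<le> M powr \<delta> + \<xi> * (\<xi> + \<gamma>) * M" for r
  proof -
    have "0 \<le> V r powr \<delta>" "V r powr \<delta> \<le> M powr \<delta>"
      using M UV_pos[of r] pos by (auto intro!: powr_mono2 intro: less_imp_le)
    moreover have "0 \<le> \<xi> * (x r + \<gamma>) * U r" "\<xi> * (x r + \<gamma>) * U r \<le> \<xi> * (\<xi> + \<gamma>) * M"
      using M(1)[of r] UV_pos[of r] pos x_bounds[of r] by (auto intro!: mult_mono mult_nonneg_nonneg)
    ultimately show ?thesis by linarith
  qed
  have lim0: "((\<lambda>r. exp (\<xi> * r)) \<longlongrightarrow> 0) at_bot"
    using pos by (intro filterlim_compose[OF exp_at_bot] filterlim_tendsto_pos_mult_at_bot[OF tendsto_const _ filterlim_ident]) auto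
  have "(\<Phi> \<longlongrightarrow> 0) at_bot"
    unfolding \<Phi>_def
    by (rule Lim_null_comparison[OF _ tendsto_mult_left_zero[OF lim0, of "M powr \<delta> + \<xi> * (\<xi> + \<gamma>) * M"]])
       (use bd in \<open>auto simp: abs_mult intro!: mult_left_mono always_eventually\<close>)
  then have "0 \<le> \<Phi> (t - 1)"
    by (rule tendsto_upperbound)
       (auto simp: eventually_at_bot_linorder intro!: exI[of _ "t - 2"] less_imp_le less)
  with less[of "t - 1" t] show ?thesis by simp
qed

text \<open>After x has become positive with y < 0, the flux \<Phi> is still increasing, so x remains positive until y
  returns to 0. It must return, since otherwise V would increase forever, and it crosses 0 because of the trap
  for the exchanged system.\<close>
lemma enter_from_x:
  assumes T: "x T = 0" "y T \<le> 0" and before: "\<And>r. r < T \<Longrightarrow> x r < 0 \<and> y r < 0"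
  shows "\<exists>t. x t > 0 \<and> y t > 0"
proof -
  interpret sw: critical_flow \<xi> \<gamma> \<mu> \<delta> y x V U
    by (rule critical_flow_swap) unfold_locales
  have swP: "sw.P = Q" by (auto simp: sw.P_def Q_def)
  have swQ: "sw.Q = P" by (auto simp: sw.Q_def P_def)
  have dx0: "(x t + \<gamma>) * (x t - \<xi>) + P t > 0" if "\<Phi> t > 0" "x t = 0" for t
    using that UV_pos[of t] by (auto simp: \<Phi>_P zero_less_mult_iff mult_less_0_iff mult.commute)
  have \<Phi>T: "\<Phi> T > 0" using \<Phi>_pos[of T] before by auto
  show ?thesis
  proof (cases "y T = 0")
    case True
    have sT: "sw.\<Phi> T > 0" using sw.\<Phi>_pos[of T] before by auto
    have "(y T + \<xi>) * (y T - \<gamma>) + Q T > 0"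
      using sT True UV_pos[of T] by (auto simp: sw.\<Phi>_P swP zero_less_mult_iff mult_less_0_iff mult.commute)
    from DERIV_pos_inc_right[OF dy' this] obtain d1 where d1: "d1 > 0" "\<And>h. 0 < h \<Longrightarrow> h < d1 \<Longrightarrow> y T < y (T + h)"
      by blast
    from DERIV_pos_inc_right[OF dx' dx0[OF \<Phi>T T(1)]] obtain d2 where
      d2: "d2 > 0" "\<And>h. 0 < h \<Longrightarrow> h < d2 \<Longrightarrow> x T < x (T + h)" by blast
    have "x (T + min d1 d2 / 2) > 0 \<and> y (T + min d1 d2 / 2) > 0"
      using d1(2)[of "min d1 d2 / 2"] d2(2)[of "min d1 d2 / 2"] d1(1) d2(1) T True by (auto simp: min_def)
    then show ?thesis by blast
  next
    case False
    with T have yT: "y T < 0" by simp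
    have \<Phi>_mono: "\<Phi> t > 0" if "T \<le> t" "\<And>r. T \<le> r \<Longrightarrow> r < t \<Longrightarrow> y r < 0" for t
      using \<Phi>_pos[of t] that before by (meson not_less)
    have x_pos: "x t > 0" if "T < t" "\<And>r. T \<le> r \<Longrightarrow> r < t \<Longrightarrow> y r < 0" for t
    proof -
      have "exp (- \<gamma> * T) * U T * x T < exp (- \<gamma> * t) * U t * x t"
      proof (rule deriv_pos_imp_less[OF that(1)])
        show "continuous_on {T..t} (\<lambda>t. exp (- \<gamma> * t) * U t * x t)"
          by (intro continuous_intros conts)
        show "((\<lambda>t. exp (- \<gamma> * t) * U t * x t) has_real_derivative exp (- (\<xi> + \<gamma>) * r) * \<Phi> r) (at r)" for r
          by (rule dxU')
        show "0 < exp (- (\<xi> + \<gamma>) * r) * \<Phi> r" if "T < r" "r < t" for r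
          using \<Phi>_mono[of r] that \<open>\<And>r. T \<le> r \<Longrightarrow> r < t \<Longrightarrow> y r < 0\<close> by simp
      qed
      then show ?thesis using T UV_pos[of t] by (auto simp: zero_less_mult_iff mult_less_0_iff)
    qed
    have "\<exists>t\<ge>T. y t \<ge> 0"
    proof (rule ccontr)
      assume "\<not> ?thesis"
      then have neg: "\<And>t. t \<ge> T \<Longrightarrow> y t < 0" by force
      then have "x t \<ge> 0" if "t \<ge> T" for t using x_pos[of t] T that by (cases "t = T") (auto intro: less_imp_le)
      with neg sw.U_not_increasing[of T] show False by (meson less_imp_le)
    qed
    then obtain t where t: "t \<ge> T" "- y t \<le> 0" by auto
    have c: "continuous_on {T..t} (\<lambda>r. - y r)" by (intro continuous_intros conts)
    have p: "0 < - y T" using yT by simp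
    obtain S where "T < S" "- y S = 0" "\<And>r. T \<le> r \<Longrightarrow> r < S \<Longrightarrow> 0 < - y r"
      using first_zero[OF t(1) c p t(2)] by blast
    then have S: "T < S" "y S = 0" "\<And>r. T \<le> r \<Longrightarrow> r < S \<Longrightarrow> y r < 0" by auto
    have xS: "x S > 0" and \<Phi>S: "\<Phi> S > 0" using x_pos \<Phi>_mono S by auto
    then have PS: "P S > \<xi> * (x S + \<gamma>)" using UV_pos[of S] by (auto simp: \<Phi>_P zero_less_mult_iff mult_less_0_iff)
    have "(y S + \<xi>) * (y S - \<gamma>) + Q S > 0"
    proof (rule ccontr)
      assume "\<not> ?thesis"
      then have "Q S \<le> \<xi> * \<gamma>" using S by simp
      moreover have "P S - \<xi> * \<gamma> + \<gamma> * x S \<ge> 0"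
        using PS mult_pos_pos[OF pos(1) xS] mult_pos_pos[OF pos(2) xS] by (simp add: algebra_simps)
      ultimately show False using sw.trap[of S] S xS by (simp add: swP swQ)
    qed
    from DERIV_pos_inc_right[OF dy' this] obtain d1 where d1: "d1 > 0" "\<And>h. 0 < h \<Longrightarrow> h < d1 \<Longrightarrow> y S < y (S + h)"
      by blast
    have "\<forall>\<^sub>F r in at S. x r > 0"
      using order_tendstoD(1)[OF _ xS, of x "at S"] DERIV_isCont[OF dx, of S] by (simp add: isCont_def)
    then obtain d2 where d2: "d2 > 0" "\<And>r. r \<noteq> S \<Longrightarrow> dist r S < d2 \<Longrightarrow> x r > 0"
      by (auto simp: eventually_at)
    have "x (S + min d1 d2 / 2) > 0 \<and> y (S + min d1 d2 / 2) > 0"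
      using d1(2)[of "min d1 d2 / 2"] d2(2)[of "S + min d1 d2 / 2"] d1(1) d2(1) S by (auto simp: dist_real_def min_def)
    then show ?thesis by blast
  qed
qed

lemma eventually_positive_quadrant: "\<exists>T. \<forall>t\<ge>T. x t > 0 \<and> y t > 0"
proof -
  interpret sw: critical_flow \<xi> \<gamma> \<mu> \<delta> y x V U
    by (rule critical_flow_swap) unfold_locales
  obtain T0 where T0: "\<And>t. t \<le> T0 \<Longrightarrow> x t < 0 \<and> y t < 0" using start by blast
  have "\<exists>t\<ge>T0. \<not> (x t < 0 \<and> y t < 0)"
    using U_not_increasing[of T0] by (meson less_imp_le)
  then obtain t where t: "t \<ge> T0" "min (- x t) (- y t) \<le> 0" by (auto simp: min_def)
  have c: "continuous_on {T0..t} (\<lambda>r. min (- x r) (- y r))" by (intro continuous_intros conts)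
  have p: "0 < min (- x T0) (- y T0)" using T0[of T0] by simp
  obtain T where T: "T0 < T" "min (- x T) (- y T) = 0" "\<And>r. T0 \<le> r \<Longrightarrow> r < T \<Longrightarrow> min (- x r) (- y r) > 0"
    using first_zero[OF t(1) c p t(2)] by blast
  then have before: "x r < 0 \<and> y r < 0" if "r < T" for r
    using T0[of r] T(3)[of r] that by (cases "r \<le> T0") auto
  have "\<exists>t. x t > 0 \<and> y t > 0"
  proof (cases "x T = 0")
    case True
    with T before show ?thesis using enter_from_x[of T] by auto
  next
    case False
    with T before show ?thesis using sw.enter_from_x[of T] by (auto simp: min_def split: if_splits)
  qed
  then show ?thesis using positive_quadrant_invariant by blast
qed

lemma UV_tendsto_zero: "(U \<longlongrightarrow> 0) at_top" "(V \<longlongrightarrow> 0) at_top"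
proof -
  obtain T where T: "\<And>t. t \<ge> T \<Longrightarrow> x t > 0 \<and> y t > 0" using eventually_positive_quadrant by blast
  have U: "U t \<le> U s" and V: "V t \<le> V s" if "T \<le> s" "s \<le> t" for s t
    using U_antimono_interval[of s t] V_antimono_interval[of s t] T that by (meson less_imp_le order_trans)+
  obtain u0 where "(U \<longlongrightarrow> u0) at_top"
    by (rule decr_bounded_tendsto[of T U 0, OF U less_imp_le[OF UV_pos(1)]]) blast+
  moreover obtain v0 where "(V \<longlongrightarrow> v0) at_top"
    by (rule decr_bounded_tendsto[of T V 0, OF V less_imp_le[OF UV_pos(2)]]) blast+
  ultimately have l: "(U \<longlongrightarrow> u0) at_top" "(V \<longlongrightarrow> v0) at_top" .
  with limit_zero[OF l] show "(U \<longlongrightarrow> 0) at_top" "(V \<longlongrightarrow> 0) at_top" by auto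
qed

end

section \<open>Decay rates of the critical flow\<close>

context critical_flow
begin

text \<open>The powers of U cancel in P^\<mu> Q, leaving V^(\<delta> \<mu> - 1).\<close>
lemma PQ_tendsto_zero: "((\<lambda>t. P t powr \<mu> * Q t) \<longlongrightarrow> 0) at_top"
proof -
  have eq: "P t powr \<mu> * Q t = V t powr (\<delta> * \<mu> - 1)" for t
    using UV_pos[of t] by (simp add: P_def Q_def powr_divide powr_powr powr_diff)
  have "((\<lambda>t. V t powr (\<delta> * \<mu> - 1)) \<longlongrightarrow> 0 powr (\<delta> * \<mu> - 1)) at_top"
    using superlinear UV_pos UV_tendsto_zero
    by (intro tendsto_powr' tendsto_const) (auto intro!: always_eventually intro: less_imp_le)
  then show ?thesis by (simp add: eq)
qed

text \<open>If P is not small at a late time, then Q is small for a long time afterwards, because P^\<mu> Q \<rightarrow> 0 and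
  P decays at most exponentially. Then \<gamma> - y, which grows when Q is negligible but stays
  below \<gamma>, must be small already, and P' / P = x - \<delta> y is close to or below \<xi> - \<delta> \<gamma> < 0.\<close>
lemma P_tendsto_zero:
  assumes \<kappa>: "\<xi> < \<delta> * \<gamma>"
  shows "(P \<longlongrightarrow> 0) at_top"
proof (rule decreasing_tendsto)
  show "\<forall>\<^sub>F t in at_top. 0 \<le> P t" using PQ_pos by (auto intro!: always_eventually intro: less_imp_le)
  fix \<epsilon> :: real assume \<epsilon>: "0 < \<epsilon>"
  obtain T where T: "\<And>t. t \<ge> T \<Longrightarrow> x t > 0" "\<And>t. t \<ge> T \<Longrightarrow> y t > 0"
    using eventually_positive_quadrant by blast
  define \<kappa> where "\<kappa> = \<delta> * \<gamma> - \<xi>"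
  define \<eta> where "\<eta> = \<kappa> / (4 * \<delta>)"
  have "\<kappa> > 0" using assms by (simp add: \<kappa>_def)
  then have "\<eta> > 0" using pos by (simp add: \<eta>_def)
  \<comment> \<open>a waiting time after which the repelling rate \<xi> multiplies \<eta> to at least \<gamma>, the upper bound of \<gamma> - y\<close>
  define L where "L = max 0 (ln (\<gamma> / \<eta>) / \<xi>)"
  have L: "L \<ge> 0" "\<gamma> * exp (- \<xi> * L) \<le> \<eta>"
  proof -
    show "L \<ge> 0" by (simp add: L_def)
    have "ln (\<gamma> / \<eta>) / \<xi> \<le> L" by (simp add: L_def)
    then have "ln (\<gamma> / \<eta>) \<le> \<xi> * L" using pos by (simp add: field_simps)
    then have "\<gamma> / \<eta> \<le> exp (\<xi> * L)" using pos \<open>\<eta> > 0\<close> by (metis divide_pos_pos exp_le_cancel_iff exp_ln)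
    then show "\<gamma> * exp (- \<xi> * L) \<le> \<eta>" using \<open>\<eta> > 0\<close> by (simp add: exp_minus field_simps)
  qed
  define \<epsilon>' where "\<epsilon>' = \<epsilon> * exp (- \<delta> * \<gamma> * L)"
  have "\<epsilon>' > 0" using \<epsilon> by (simp add: \<epsilon>'_def)
  have "\<forall>\<^sub>F t in at_top. P t powr \<mu> * Q t < \<epsilon>' powr \<mu> * (\<xi> * \<eta>)"
    using order_tendstoD(2)[OF PQ_tendsto_zero] \<open>\<epsilon>' > 0\<close> \<open>\<eta> > 0\<close> pos by simp
  then obtain T1 where T1: "\<And>t. t \<ge> T1 \<Longrightarrow> P t powr \<mu> * Q t < \<epsilon>' powr \<mu> * (\<xi> * \<eta>)"
    by (auto simp: eventually_at_top_linorder)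
  show "\<forall>\<^sub>F t in at_top. P t < \<epsilon>"
  proof (rule eventually_below_of_deriv_neg[OF dP])
    show "\<epsilon> * (\<kappa> / 2) > 0" using \<epsilon> \<open>\<kappa> > 0\<close> by simp
    fix t assume t: "t \<ge> max T T1" and Pt: "P t \<ge> \<epsilon>"
    have P_lower: "P s \<ge> \<epsilon>'" if s: "t \<le> s" "s \<le> t + L" for s
    proof -
      have "P t * exp (\<delta> * \<gamma> * t) \<le> P s * exp (\<delta> * \<gamma> * s)"
      proof (rule deriv_nonneg_imp_le_closed[OF s(1)])
        show "((\<lambda>r. P r * exp (\<delta> * \<gamma> * r)) has_real_derivative
           P r * exp (\<delta> * \<gamma> * r) * (x r - \<delta> * y r + \<delta> * \<gamma>)) (at r)" for r
          by (auto intro!: derivative_eq_intros dP simp: algebra_simps)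
        fix r assume "t \<le> r"
        then have "x r > 0" using T t by auto
        moreover have "\<delta> * y r \<le> \<delta> * \<gamma>" using y_bounds[of r] pos by simp
        ultimately show "0 \<le> P r * exp (\<delta> * \<gamma> * r) * (x r - \<delta> * y r + \<delta> * \<gamma>)"
          using PQ_pos[of r] by (intro mult_nonneg_nonneg) auto
      qed
      then have "P t * exp (\<delta> * \<gamma> * (t - s)) \<le> P s"
        by (simp add: right_diff_distrib exp_diff field_simps)
      moreover have "\<delta> * \<gamma> * (- L) \<le> \<delta> * \<gamma> * (t - s)"
        using s pos by (intro mult_left_mono) auto
      then have "\<epsilon> * exp (\<delta> * \<gamma> * (- L)) \<le> P t * exp (\<delta> * \<gamma> * (t - s))"
        using Pt \<epsilon> by (intro mult_mono) auto
      ultimately show ?thesis by (simp add: \<epsilon>'_def)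
    qed
    have Q_small: "Q s \<le> \<xi> * \<eta>" if s: "t \<le> s" "s \<le> t + L" for s
    proof (rule ccontr)
      assume "\<not> Q s \<le> \<xi> * \<eta>"
      then have "\<epsilon>' powr \<mu> * (\<xi> * \<eta>) \<le> P s powr \<mu> * Q s"
        using P_lower[OF s] \<open>\<epsilon>' > 0\<close> \<open>\<eta> > 0\<close> pos by (intro mult_mono powr_mono2) auto
      with T1[of s] t s show False by auto
    qed
    have "\<gamma> - y t \<le> \<xi> * \<eta> / \<xi> + \<gamma> * exp (- \<xi> * L)"
    proof (rule repelling_bound[where f = "\<lambda>s. \<gamma> - y s" and f' = "\<lambda>s. (y s + \<xi>) * (\<gamma> - y s) - Q s"])
      show "((\<lambda>s. \<gamma> - y s) has_real_derivative (y s + \<xi>) * (\<gamma> - y s) - Q s) (at s)" for s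
        by (auto intro!: derivative_eq_intros dy' simp: algebra_simps)
      fix s assume s: "t \<le> s" "s \<le> t + L"
      have "\<xi> * (\<gamma> - y s) \<le> (y s + \<xi>) * (\<gamma> - y s)"
        using T(2)[of s] s t y_bounds[of s] by (intro mult_right_mono) auto
      with Q_small[OF s] show "\<xi> * (\<gamma> - y s) - \<xi> * \<eta> \<le> (y s + \<xi>) * (\<gamma> - y s) - Q s" by simp
    next
      have "y (t + L) > 0" using T t L by auto
      then show "\<gamma> - y (t + L) \<le> \<gamma>" by simp
    qed (use pos L \<open>\<eta> > 0\<close> in auto)
    then have "\<gamma> - y t \<le> 2 * \<eta>" using L pos by simp
    then have "\<delta> * (\<gamma> - y t) \<le> \<delta> * (2 * \<eta>)" using pos by simp
    also have "\<delta> * (2 * \<eta>) = \<kappa> / 2" using pos by (simp add: \<eta>_def)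
    finally have "\<delta> * \<gamma> - \<delta> * y t \<le> \<kappa> / 2" by (simp add: right_diff_distrib)
    moreover have "\<delta> * \<gamma> = \<kappa> + \<xi>" by (simp add: \<kappa>_def)
    ultimately have "x t - \<delta> * y t \<le> - (\<kappa> / 2)" using x_bounds(2)[of t] by linarith
    then have "P t * (x t - \<delta> * y t) \<le> P t * (- (\<kappa> / 2))"
      using PQ_pos[of t] by (intro mult_left_mono) auto
    also have "\<dots> \<le> \<epsilon> * (- (\<kappa> / 2))"
      using Pt \<open>\<kappa> > 0\<close> by (intro mult_right_mono_neg) auto
    finally show "P t * (x t - \<delta> * y t) \<le> - (\<epsilon> * (\<kappa> / 2))" by simp
  qed
qed

text \<open>When P is negligible, the energy equation gives Q \<ge> (\<mu> + 1) \<xi> (\<gamma> - y), so that the deficit z = \<gamma> - y satisfies the logistic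
  inequality z' \<le> z (\<gamma> - \<mu> \<xi> - z) up to a small error.\<close>
lemma y_deficit_eventually_small:
  assumes P0: "(P \<longlongrightarrow> 0) at_top" and \<epsilon>: "\<epsilon> > 0"
  shows "\<forall>\<^sub>F t in at_top. \<gamma> - y t < max 0 (\<gamma> - \<mu> * \<xi>) + \<epsilon>"
proof -
  obtain T where T: "\<And>t. t \<ge> T \<Longrightarrow> x t > 0" "\<And>t. t \<ge> T \<Longrightarrow> y t > 0"
    using eventually_positive_quadrant by blast
  define c where "c = (\<mu> + 1) / (\<delta> + 1)"
  have "c > 0" using pos by (simp add: c_def)
  then have "\<forall>\<^sub>F t in at_top. P t < \<epsilon>\<^sup>2 / (2 * c)"
    using order_tendstoD(2)[OF P0] \<epsilon> by simp
  then obtain T1 where T1: "\<And>t. t \<ge> T1 \<Longrightarrow> P t < \<epsilon>\<^sup>2 / (2 * c)"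
    by (auto simp: eventually_at_top_linorder)
  show ?thesis
  proof (rule eventually_below_of_deriv_neg)
    show "((\<lambda>s. \<gamma> - y s) has_real_derivative (y s + \<xi>) * (\<gamma> - y s) - Q s) (at s)" for s
      by (auto intro!: derivative_eq_intros dy' simp: algebra_simps)
    show "\<epsilon>\<^sup>2 / 2 > 0" using \<epsilon> by simp
    fix t assume t: "t \<ge> max T T1" and q: "max 0 (\<gamma> - \<mu> * \<xi>) + \<epsilon> \<le> \<gamma> - y t"
    have "Q t = (\<mu> + 1) * (\<gamma> * \<xi> - x t * y t) - c * P t"
    proof -
      have "Q t / (\<mu> + 1) = \<gamma> * \<xi> - x t * y t - P t / (\<delta> + 1)" using energy'[of t] by simp
      then have "Q t = (\<mu> + 1) * (\<gamma> * \<xi> - x t * y t - P t / (\<delta> + 1))"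
        using pos by (simp add: divide_eq_eq mult.commute)
      then show ?thesis by (simp add: c_def right_diff_distrib)
    qed
    also have "\<gamma> * \<xi> - x t * y t = \<xi> * (\<gamma> - y t) + (\<xi> - x t) * y t" by (simp add: algebra_simps)
    finally have Q: "Q t = (\<mu> + 1) * \<xi> * (\<gamma> - y t) + (\<mu> + 1) * ((\<xi> - x t) * y t) - c * P t"
      by (simp add: algebra_simps)
    have "(\<mu> + 1) * ((\<xi> - x t) * y t) \<ge> 0"
      using pos x_bounds[of t] T(2)[of t] t by (intro mult_nonneg_nonneg) auto
    then have "(y t + \<xi>) * (\<gamma> - y t) - Q t \<le> (\<gamma> - y t) * (\<gamma> - \<mu> * \<xi> - (\<gamma> - y t)) + c * P t"
      unfolding Q by (simp add: algebra_simps)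
    also have "(\<gamma> - y t) * (\<gamma> - \<mu> * \<xi> - (\<gamma> - y t)) \<le> (\<gamma> - y t) * (- \<epsilon>)"
      using q \<epsilon> by (intro mult_left_mono) auto
    also have "\<dots> \<le> \<epsilon> * (- \<epsilon>)"
      using q \<epsilon> by (intro mult_right_mono_neg) auto
    also have "c * P t \<le> c * (\<epsilon>\<^sup>2 / (2 * c))"
      using T1[of t] t \<open>c > 0\<close> by (intro mult_left_mono) auto
    also have "c * (\<epsilon>\<^sup>2 / (2 * c)) = \<epsilon>\<^sup>2 / 2" using \<open>c > 0\<close> by simp
    finally show "(y t + \<xi>) * (\<gamma> - y t) - Q t \<le> - (\<epsilon>\<^sup>2 / 2)" by (simp add: power2_eq_square)
  qed
qed

text \<open>With z = \<gamma> - y, P' / P \<le> \<xi> - \<delta> \<gamma> + \<delta> z. If z can be made small, this is negative by hypothesis; otherwise z is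
  eventually at most about \<gamma> - \<mu> \<xi>, and the rate is at most about \<xi> (1 - \<delta> \<mu>) < 0.\<close>
lemma P_exponential_decay:
  assumes \<kappa>: "\<xi> < \<delta> * \<gamma>"
  obtains c C T where "c > 0" "C > 0" "\<And>t. t \<ge> T \<Longrightarrow> P t \<le> C * exp (- c * t)"
proof -
  define k where "k = \<delta> * \<gamma> - \<xi> - \<delta> * max 0 (\<gamma> - \<mu> * \<xi>)"
  have "k > 0"
  proof (cases "\<gamma> \<le> \<mu> * \<xi>")
    case True then show ?thesis using \<kappa> by (simp add: k_def max_def)
  next
    case False
    then have "k = \<xi> * (\<delta> * \<mu> - 1)" by (simp add: k_def max_def algebra_simps)
    then show ?thesis using pos superlinear by simp
  qed
  have "\<forall>\<^sub>F t in at_top. \<gamma> - y t < max 0 (\<gamma> - \<mu> * \<xi>) + k / (2 * \<delta>)"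
    using y_deficit_eventually_small[OF P_tendsto_zero[OF \<kappa>]] \<open>k > 0\<close> pos by simp
  then obtain T where T: "\<And>t. t \<ge> T \<Longrightarrow> \<gamma> - y t < max 0 (\<gamma> - \<mu> * \<xi>) + k / (2 * \<delta>)"
    by (auto simp: eventually_at_top_linorder)
  have rate: "x t - \<delta> * y t \<le> - (k / 2)" if "t \<ge> T" for t
  proof -
    have "\<delta> * (\<gamma> - y t) \<le> \<delta> * (max 0 (\<gamma> - \<mu> * \<xi>) + k / (2 * \<delta>))"
      using T[OF that] pos by (intro mult_left_mono) auto
    also have "\<dots> = \<delta> * max 0 (\<gamma> - \<mu> * \<xi>) + k / 2" using pos by (simp add: field_simps)
    finally have "\<delta> * \<gamma> - \<delta> * y t \<le> \<delta> * max 0 (\<gamma> - \<mu> * \<xi>) + k / 2" by (simp add: algebra_simps)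
    moreover have "\<delta> * max 0 (\<gamma> - \<mu> * \<xi>) = \<delta> * \<gamma> - \<xi> - k" by (simp add: k_def)
    ultimately show ?thesis using x_bounds[of t] by linarith
  qed
  have "P t \<le> P T * exp (k / 2 * T) * exp (- (k / 2) * t)" if "t \<ge> T" for t
  proof -
    have "- (P T * exp (k / 2 * T)) \<le> - (P t * exp (k / 2 * t))"
    proof (rule deriv_nonneg_imp_le_closed[OF that])
      show "((\<lambda>r. - (P r * exp (k / 2 * r))) has_real_derivative
         P r * exp (k / 2 * r) * (- (x r - \<delta> * y r) - k / 2)) (at r)" for r
        by (auto intro!: derivative_eq_intros dP simp: algebra_simps)
      show "0 \<le> P r * exp (k / 2 * r) * (- (x r - \<delta> * y r) - k / 2)" if "T \<le> r" for r
        using rate[OF that] PQ_pos[of r] by (intro mult_nonneg_nonneg) auto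
    qed
    then show ?thesis by (simp add: exp_minus field_simps)
  qed
  with that[of "k / 2" "P T * exp (k / 2 * T)" T] \<open>k > 0\<close> PQ_pos show ?thesis by simp
qed

text \<open>The function exp (\<xi> t) U, which is r^(n-2) u, increases at the logarithmic rate \<xi> - x. As the equation of \<xi> - x is
  repelling, this deficit inherits the exponential decay of P and is integrable.\<close>
lemma U_fundamental_decay:
  assumes \<kappa>: "\<xi> < \<delta> * \<gamma>"
  obtains \<alpha> where "\<alpha> > 0" "((\<lambda>t. exp (\<xi> * t) * U t) \<longlongrightarrow> \<alpha>) at_top"
proof -
  obtain c C T0 where c: "c > 0" "C > 0" "\<And>t. t \<ge> T0 \<Longrightarrow> P t \<le> C * exp (- c * t)"
    using P_exponential_decay[OF \<kappa>] by blast
  obtain T1 where T1: "\<And>t. t \<ge> T1 \<Longrightarrow> x t > 0" using eventually_positive_quadrant by blast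
  define T where "T = max T0 T1"
  define K where "K = C / (\<gamma> * c)"
  have deficit: "\<xi> - x t \<le> C * exp (- c * t) / \<gamma>" if "t \<ge> T" for t
  proof (rule repelling_bound_infinite[where f = "\<lambda>s. \<xi> - x s" and M = "\<xi> + \<gamma>"
        and f' = "\<lambda>s. (x s + \<gamma>) * (\<xi> - x s) - P s"])
    show "((\<lambda>s. \<xi> - x s) has_real_derivative (x s + \<gamma>) * (\<xi> - x s) - P s) (at s)" for s
      by (auto intro!: derivative_eq_intros dx' simp: algebra_simps)
    show "\<xi> - x s \<le> \<xi> + \<gamma>" for s using x_bounds[of s] by simp
    fix s assume s: "t \<le> s"
    have "P s \<le> C * exp (- c * s)" using c(3)[of s] s that by (simp add: T_def)
    also have "\<dots> \<le> C * exp (- c * t)" using s c by simp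
    finally have "P s \<le> C * exp (- c * t)" .
    moreover have "\<gamma> * (\<xi> - x s) \<le> (x s + \<gamma>) * (\<xi> - x s)"
      using T1[of s] s that x_bounds[of s] by (intro mult_right_mono) (auto simp: T_def)
    ultimately show "\<gamma> * (\<xi> - x s) - C * exp (- c * t) \<le> (x s + \<gamma>) * (\<xi> - x s) - P s" by simp
  qed (use pos c in auto)
  have incr: "exp (\<xi> * s) * U s \<le> exp (\<xi> * t) * U t" if "T \<le> s" "s \<le> t" for s t
  proof (rule deriv_nonneg_imp_le_closed[OF that(2)])
    show "((\<lambda>r. exp (\<xi> * r) * U r) has_real_derivative exp (\<xi> * r) * U r * (\<xi> - x r)) (at r)" for r
      by (auto intro!: derivative_eq_intros dU simp: algebra_simps)
    show "0 \<le> exp (\<xi> * r) * U r * (\<xi> - x r)" for r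
      using x_bounds[of r] UV_pos[of r] by (intro mult_nonneg_nonneg) auto
  qed
  have bdd: "exp (\<xi> * t) * U t \<le> exp (\<xi> * T + ln (U T) + K * exp (- c * T))" if "T \<le> t" for t
  proof -
    have "- (\<xi> * T + ln (U T) + K * exp (- c * T)) \<le> - (\<xi> * t + ln (U t) + K * exp (- c * t))"
    proof (rule deriv_nonneg_imp_le_closed[OF that])
      show "((\<lambda>r. - (\<xi> * r + ln (U r) + K * exp (- c * r))) has_real_derivative
          C * exp (- c * r) / \<gamma> - (\<xi> - x r)) (at r)" for r
        using UV_pos[of r] c pos
        by (auto intro!: derivative_eq_intros dU simp: K_def field_simps)
      show "0 \<le> C * exp (- c * r) / \<gamma> - (\<xi> - x r)" if "T \<le> r" for r
        using deficit[OF that] by simp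
    qed
    moreover have "K * exp (- c * t) \<ge> 0" using c pos by (simp add: K_def)
    ultimately have "exp (\<xi> * t + ln (U t)) \<le> exp (\<xi> * T + ln (U T) + K * exp (- c * T))" by simp
    then show ?thesis using UV_pos[of t] by (simp add: exp_add)
  qed
  obtain l where l: "((\<lambda>t. exp (\<xi> * t) * U t) \<longlongrightarrow> l) at_top" "\<And>t. T \<le> t \<Longrightarrow> exp (\<xi> * t) * U t \<le> l"
    using incr_bounded_tendsto[of T "\<lambda>t. exp (\<xi> * t) * U t", OF incr bdd] by blast
  have "0 < exp (\<xi> * T) * U T" using UV_pos by simp
  also have "\<dots> \<le> l" using l(2)[of T] by simp
  finally show ?thesis using that l(1) by blast
qed

end

section \<open>Critical ground states at infinity\<close>

context ground_state
begin

definition X where "X t = - (exp ((2 - n) * t) * p (exp t) / u (exp t))"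
definition Y where "Y t = - (exp ((2 - n) * t) * q (exp t) / v (exp t))"

lemma exp_powr': "exp t powr k = exp (k * t)" for t k :: real by (simp add: powr_def)

lemma uv_exp: "u (exp t) > 0" "v (exp t) > 0" using pos[of "exp t"] by simp_all

lemma du_exp: "((\<lambda>t. u (exp t)) has_real_derivative - X t * u (exp t)) (at t)"
proof -
  have "((\<lambda>t. u (exp t)) has_real_derivative (exp t powr (1 - n) * p (exp t)) * exp t) (at t)"
    by (rule DERIV_chain2[OF du DERIV_exp]) auto
  moreover have "(exp t powr (1 - n) * p (exp t)) * exp t = - X t * u (exp t)"
  proof -
    have "exp ((1 - n) * t) * exp t = exp ((2 - n) * t)" by (simp add: algebra_simps flip: exp_add)
    then have "(exp ((1 - n) * t) * p (exp t)) * exp t = exp ((2 - n) * t) * p (exp t)" by (simp add: mult_ac)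
    then show ?thesis using uv_exp[of t] by (simp add: X_def exp_powr')
  qed
  ultimately show ?thesis by simp
qed

lemma dp_exp: "((\<lambda>t. p (exp t)) has_real_derivative - (exp ((n + a) * t) * v (exp t) powr \<delta>)) (at t)"
proof -
  have "((\<lambda>t. p (exp t)) has_real_derivative - (exp t powr (n - 1 + a) * v (exp t) powr \<delta>) * exp t) (at t)"
    by (rule DERIV_chain2[OF dp DERIV_exp]) auto
  moreover have "exp ((n - 1 + a) * t) * exp t = exp ((n + a) * t)" by (simp add: algebra_simps flip: exp_add)
  then have "(exp ((n - 1 + a) * t) * v (exp t) powr \<delta>) * exp t = exp ((n + a) * t) * v (exp t) powr \<delta>"
    by (simp add: mult_ac)
  ultimately show ?thesis by (simp add: exp_powr')
qed

lemma dX: "(X has_real_derivative X t * (X t - (n - 2)) + exp ((2 + a) * t) * v (exp t) powr \<delta> / u (exp t)) (at t)"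
proof -
  have u: "u (exp t) \<noteq> 0" using uv_exp[of t] by simp
  have "((\<lambda>t. exp ((2 - n) * t)) has_real_derivative exp ((2 - n) * t) * (2 - n)) (at t)"
    by (auto intro!: derivative_eq_intros)
  from DERIV_minus[OF DERIV_divide[OF DERIV_mult[OF this dp_exp] du_exp u]]
  have F: "((\<lambda>t. - (exp ((2 - n) * t) * p (exp t) / u (exp t))) has_real_derivative - (((exp ((2 - n) * t) * (2 - n) * p (exp t)
       + - (exp ((n + a) * t) * v (exp t) powr \<delta>) * exp ((2 - n) * t)) * u (exp t)
       - exp ((2 - n) * t) * p (exp t) * (- X t * u (exp t))) / (u (exp t) * u (exp t)))) (at t)" .
  have iff: "(X has_real_derivative d) (at t)
      = ((\<lambda>t. - (exp ((2 - n) * t) * p (exp t) / u (exp t))) has_real_derivative d) (at t)" for d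
    by (simp add: X_def[abs_def])
  have e: "exp ((n + a) * t) * exp ((2 - n) * t) = exp ((2 + a) * t)" by (simp add: algebra_simps flip: exp_add)
  have xu: "exp ((2 - n) * t) * p (exp t) = - X t * u (exp t)" using u by (simp add: X_def)
  have "(exp ((2 - n) * t) * (2 - n) * p (exp t)
       + - (exp ((n + a) * t) * v (exp t) powr \<delta>) * exp ((2 - n) * t)) * u (exp t)
       - exp ((2 - n) * t) * p (exp t) * (- X t * u (exp t))
     = ((2 - n) * (exp ((2 - n) * t) * p (exp t)) - (exp ((n + a) * t) * exp ((2 - n) * t)) * v (exp t) powr \<delta>) * u (exp t)
       + exp ((2 - n) * t) * p (exp t) * X t * u (exp t)"
    by (simp add: algebra_simps)
  also have "\<dots> = ((2 - n) * (- X t * u (exp t)) - exp ((2 + a) * t) * v (exp t) powr \<delta> - X t * u (exp t) * X t) * u (exp t)"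
    unfolding e xu by (simp add: algebra_simps)
  finally have N: "(exp ((2 - n) * t) * (2 - n) * p (exp t)
       + - (exp ((n + a) * t) * v (exp t) powr \<delta>) * exp ((2 - n) * t)) * u (exp t)
       - exp ((2 - n) * t) * p (exp t) * (- X t * u (exp t))
     = ((2 - n) * (- X t * u (exp t)) - exp ((2 + a) * t) * v (exp t) powr \<delta> - X t * u (exp t) * X t) * u (exp t)" .
  show ?thesis
    unfolding iff by (rule DERIV_cong[OF F[unfolded N]]) (use u in \<open>simp add: field_simps\<close>)
qed

lemma X_bounds: "0 \<le> X t" "X t \<le> n - 2"
proof -
  have "p (exp t) < 0" using p_neg[of "exp t"] by simp
  then show "0 \<le> X t" using uv_exp[of t] by (simp add: X_def divide_nonpos_pos mult_nonneg_nonpos)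
  have "- (exp ((2 - n) * t) * p (exp t)) \<le> (n - 2) * u (exp t)"
    using flux_le_u[of "exp t"] by (simp add: exp_powr')
  then show "X t \<le> n - 2" using uv_exp[of t] unfolding X_def by (simp add: field_simps)
qed

lemma X_start: assumes "c > 0" shows "\<forall>\<^sub>F t in at_bot. X t < c"
proof -
  define K where "K = v 0 powr \<delta> / (n + a) / u 1"
  have bound: "X t \<le> K * exp ((2 + a) * t)" if "t \<le> 0" for t
  proof -
    have u1: "u 1 > 0" "u 1 \<le> u (exp t)" using pos(1)[of 1] u_antimono[of "exp t" 1] that by simp_all
    have "- p (exp t) \<le> v 0 powr \<delta> * exp ((n + a) * t) / (n + a)"
      using flux_upper[of "exp t"] by (simp add: exp_powr')
    then have "exp ((2 - n) * t) * (- p (exp t)) \<le> exp ((2 - n) * t) * (v 0 powr \<delta> * exp ((n + a) * t) / (n + a))"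
      by (intro mult_left_mono) auto
    also have "\<dots> = v 0 powr \<delta> / (n + a) * (exp ((2 - n) * t) * exp ((n + a) * t))" by simp
    also have "exp ((2 - n) * t) * exp ((n + a) * t) = exp ((2 + a) * t)" by (simp add: algebra_simps flip: exp_add)
    finally have "exp ((2 - n) * t) * (- p (exp t)) / u (exp t) \<le> v 0 powr \<delta> / (n + a) * exp ((2 + a) * t) / u 1"
      using u1 n ab p_neg[of "exp t"] by (intro frac_le) auto
    then show ?thesis by (simp add: X_def K_def)
  qed
  have "((\<lambda>t. K * exp ((2 + a) * t)) \<longlongrightarrow> K * 0) at_bot"
    using ab by (intro tendsto_intros filterlim_compose[OF exp_at_bot]
      filterlim_tendsto_pos_mult_at_bot[OF tendsto_const _ filterlim_ident]) auto
  then have "\<forall>\<^sub>F t in at_bot. K * exp ((2 + a) * t) < c"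
    using order_tendstoD(2) assms by force
  moreover have "\<forall>\<^sub>F t in at_bot. t \<le> (0::real)" by (rule eventually_le_at_bot)
  ultimately show ?thesis
  proof eventually_elim
    case (elim t)
    then show ?case using bound[of t] by simp
  qed
qed

lemma critical_energy:
  assumes "excess = 0"
  shows "X t * Y t + exp ((2 + b) * t) * u (exp t) powr \<mu> / v (exp t) / (\<mu> + 1)
     + exp ((2 + a) * t) * v (exp t) powr \<delta> / u (exp t) / (\<delta> + 1)
     = (n + a) / (\<delta> + 1) * X t + (n + b) / (\<mu> + 1) * Y t"
proof -
  let ?u = "u (exp t)" and ?v = "v (exp t)" and ?E = "exp ((n - 2) * t)"
  have uv: "?u > 0" "?v > 0" using uv_exp[of t] by auto
  have p: "p (exp t) = - (?E * X t * ?u)" "q (exp t) = - (?E * Y t * ?v)"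
    using uv by (simp_all add: X_def Y_def field_simps flip: exp_add)
  have E1: "exp ((2 - n) * t) * ?E = 1" by (simp add: algebra_simps flip: exp_add)
  have Eb: "exp ((n + b) * t) = ?E * exp ((2 + b) * t)" by (simp add: algebra_simps flip: exp_add)
  have Ea: "exp ((n + a) * t) = ?E * exp ((2 + a) * t)" by (simp add: algebra_simps flip: exp_add)
  have up: "?u powr (\<mu> + 1) = ?u powr \<mu> * ?u" "?v powr (\<delta> + 1) = ?v powr \<delta> * ?v"
    using uv by (simp_all add: powr_add)
  have "energy (exp t) = 0" using energy_zero[OF assms, of "exp t"] by simp
  then have "exp ((2 - n) * t) * p (exp t) * q (exp t)
     + exp ((n + b) * t) * ?u powr (\<mu> + 1) / (\<mu> + 1) + exp ((n + a) * t) * ?v powr (\<delta> + 1) / (\<delta> + 1)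
     + (n + a) / (\<delta> + 1) * ?v * p (exp t) + (n + b) / (\<mu> + 1) * ?u * q (exp t) = 0"
    by (simp add: energy_def exp_powr')
  also have "exp ((2 - n) * t) * p (exp t) * q (exp t) = (exp ((2 - n) * t) * ?E) * (?E * ?u * ?v * (X t * Y t))"
    unfolding p by (simp add: mult_ac)
  also have "\<dots> = ?E * ?u * ?v * (X t * Y t)" unfolding E1 by simp
  also have "exp ((n + b) * t) * ?u powr (\<mu> + 1) / (\<mu> + 1)
     = ?E * ?u * ?v * (exp ((2 + b) * t) * ?u powr \<mu> / ?v / (\<mu> + 1))"
    unfolding Eb up using uv by simp
  also have "exp ((n + a) * t) * ?v powr (\<delta> + 1) / (\<delta> + 1)
     = ?E * ?u * ?v * (exp ((2 + a) * t) * ?v powr \<delta> / ?u / (\<delta> + 1))"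
    unfolding Ea up using uv by simp
  also have "(n + a) / (\<delta> + 1) * ?v * p (exp t) = - (?E * ?u * ?v * ((n + a) / (\<delta> + 1) * X t))"
    unfolding p by (simp add: mult_ac)
  also have "(n + b) / (\<mu> + 1) * ?u * q (exp t) = - (?E * ?u * ?v * ((n + b) / (\<mu> + 1) * Y t))"
    unfolding p by (simp add: mult_ac)
  finally have "?E * ?u * ?v * (X t * Y t + exp ((2 + b) * t) * ?u powr \<mu> / ?v / (\<mu> + 1)
     + exp ((2 + a) * t) * ?v powr \<delta> / ?u / (\<delta> + 1)
     - ((n + a) / (\<delta> + 1) * X t + (n + b) / (\<mu> + 1) * Y t)) = 0"
    by (simp only: distrib_left right_diff_distrib)
  moreover have "?E * ?u * ?v \<noteq> 0" using uv by simp
  ultimately show ?thesis by simp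
qed

lemma critical_exponents:
  assumes "excess = 0"
  shows "\<gamma> + \<xi> = n - 2" "n + a = \<xi> * (\<delta> + 1)" "n + b = \<gamma> * (\<mu> + 1)"
proof -
  have "(\<delta> * \<mu> - 1) * (\<gamma> + \<xi> - (n - 2)) = 0" using excess_eq assms by simp
  then show s: "\<gamma> + \<xi> = n - 2" using superlinear by simp
  have ne: "\<delta> * \<mu> \<noteq> 1" using superlinear by simp
  show "n + a = \<xi> * (\<delta> + 1)" "n + b = \<gamma> * (\<mu> + 1)"
    using scaling_gamma_xi[OF ne, of a b] s by (simp_all add: algebra_simps)
qed

definition U where "U t = exp (\<gamma> * t) * u (exp t)"
definition V where "V t = exp (\<xi> * t) * v (exp t)"

lemma VU_quot: "V t powr \<delta> / U t = exp ((2 + a) * t) * v (exp t) powr \<delta> / u (exp t)"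
proof -
  have ne: "\<delta> * \<mu> \<noteq> 1" using superlinear by simp
  have "V t powr \<delta> = exp (\<delta> * \<xi> * t) * v (exp t) powr \<delta>"
    using uv_exp[of t] by (simp add: V_def powr_mult exp_powr' mult_ac)
  also have "exp (\<delta> * \<xi> * t) = exp ((2 + a) * t) * exp (\<gamma> * t)"
    using scaling_gamma_xi(1)[OF ne, of a b] by (simp add: algebra_simps flip: exp_add)
  finally show ?thesis by (simp add: U_def)
qed

end

context ground_state
begin

text \<open>On the critical hyperbola n - 2 = \<gamma> + \<xi>, and the coefficients of the Pohozaev energy become \<xi> and \<gamma>;
  dividing it by r^(n-2) u v gives the energy equation of the flow.\<close>
lemma critical_flow_of_ground_state:
  assumes crit: "excess = 0"
  shows "critical_flow \<gamma> \<xi> \<delta> \<mu> (\<lambda>t. X t - \<gamma>) (\<lambda>t. Y t - \<xi>) U V"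
proof -
  interpret sw: ground_state n b a \<mu> \<delta> v u q p by (rule swapped_ground_state)
  have [simp]: "sw.\<gamma> = \<xi>" "sw.\<xi> = \<gamma>" by (simp_all add: scaling_xi_eq)
  have swX: "sw.X = Y" by (auto simp: sw.X_def Y_def)
  have swU: "sw.U = V" "sw.V = U" by (auto simp: sw.U_def V_def sw.V_def U_def)
  note ce = critical_exponents[OF crit]
  have UVp: "U t > 0" "V t > 0" for t using uv_exp[of t] by (simp_all add: U_def V_def)
  show ?thesis
  proof unfold_locales
    show "\<gamma> > 0" "\<xi> > 0" "\<delta> > 0" "\<mu> > 0" "\<delta> * \<mu> > 1" using \<gamma>\<xi>_pos \<delta>\<mu> superlinear by auto
    show "U t > 0" "V t > 0" for t by (rule UVp)+
    obtain M1 M2 where M: "\<And>r. r > 0 \<Longrightarrow> r powr \<gamma> * u r \<le> M1" "\<And>r. r > 0 \<Longrightarrow> r powr \<xi> * v r \<le> M2"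
      using u_decay sw.u_decay by auto
    have "U t \<le> max M1 M2 \<and> V t \<le> max M1 M2" for t
      using M[of "exp t"] by (auto simp: U_def V_def exp_powr')
    then show "\<exists>M. \<forall>t. U t \<le> M \<and> V t \<le> M" by blast
    have "((\<lambda>t. exp (\<gamma> * t) * u (exp t)) has_real_derivative - (X t - \<gamma>) * U t) (at t)" for t
      by (auto intro!: derivative_eq_intros du_exp simp: U_def algebra_simps)
    then show "(U has_real_derivative - (X t - \<gamma>) * U t) (at t)" for t by (simp add: U_def[abs_def])
    have "((\<lambda>t. exp (\<xi> * t) * v (exp t)) has_real_derivative - (Y t - \<xi>) * V t) (at t)" for t
      using sw.du_exp by (auto intro!: derivative_eq_intros simp: swX V_def algebra_simps)
    then show "(V has_real_derivative - (Y t - \<xi>) * V t) (at t)" for t by (simp add: V_def[abs_def])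
    show "((\<lambda>t. X t - \<gamma>) has_real_derivative (X t - \<gamma> + \<gamma>) * (X t - \<gamma> - \<xi>) + V t powr \<delta> / U t) (at t)" for t
      unfolding VU_quot
      by (rule DERIV_cong[OF DERIV_diff[OF dX DERIV_const]]) (simp add: algebra_simps flip: ce(1))
    show "((\<lambda>t. Y t - \<xi>) has_real_derivative (Y t - \<xi> + \<xi>) * (Y t - \<xi> - \<gamma>) + U t powr \<mu> / V t) (at t)" for t
      unfolding sw.VU_quot[unfolded swU]
      by (rule DERIV_cong[OF DERIV_diff[OF sw.dX[unfolded swX] DERIV_const]]) (simp add: algebra_simps flip: ce(1))
    have AB: "(n + a) / (\<delta> + 1) = \<xi>" "(n + b) / (\<mu> + 1) = \<gamma>" using ce \<delta>\<mu> by simp_all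
    show "(X t - \<gamma>) * (Y t - \<xi>) = \<gamma> * \<xi> - V t powr \<delta> / U t / (\<delta> + 1) - U t powr \<mu> / V t / (\<mu> + 1)" for t
      using critical_energy[OF crit, of t] VU_quot[of t] sw.VU_quot[of t] unfolding AB swU
      by (simp add: algebra_simps)
    show "- \<gamma> \<le> X t - \<gamma>" "X t - \<gamma> \<le> \<xi>" "- \<xi> \<le> Y t - \<xi>" "Y t - \<xi> \<le> \<gamma>" for t
      using X_bounds[of t] sw.X_bounds[of t] ce(1) by (simp_all add: swX)
    have "\<forall>\<^sub>F t in at_bot. X t < \<gamma> \<and> Y t < \<xi>"
      using X_start[of \<gamma>] sw.X_start[of \<xi>] \<gamma>\<xi>_pos unfolding swX by (auto intro: eventually_conj)
    then show "\<exists>T. \<forall>t\<le>T. X t - \<gamma> < 0 \<and> Y t - \<xi> < 0" by (auto simp: eventually_at_bot_linorder)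
  qed
qed

lemma u_fundamental_decay:
  assumes crit: "excess = 0" and \<delta>: "n + a < \<delta> * (n - 2)"
  obtains \<alpha> where "\<alpha> > 0" "((\<lambda>r. r powr (n - 2) * u r) \<longlongrightarrow> \<alpha>) at_top"
proof -
  interpret flow: critical_flow \<gamma> \<xi> \<delta> \<mu> "\<lambda>t. X t - \<gamma>" "\<lambda>t. Y t - \<xi>" U V
    by (rule critical_flow_of_ground_state[OF crit])
  note ce = critical_exponents[OF crit]
  have "\<xi> * (\<delta> + 1) < \<delta> * (\<gamma> + \<xi>)" using \<delta> by (simp only: ce(1,2))
  then have "\<xi> < \<delta> * \<gamma>" by (simp add: algebra_simps)
  then obtain \<alpha> where \<alpha>: "\<alpha> > 0" "((\<lambda>t. exp (\<xi> * t) * U t) \<longlongrightarrow> \<alpha>) at_top"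
    by (rule flow.U_fundamental_decay)
  from filterlim_compose[OF \<alpha>(2) ln_at_top]
  have "((\<lambda>r. exp (\<xi> * ln r) * U (ln r)) \<longlongrightarrow> \<alpha>) at_top" .
  moreover have "\<forall>\<^sub>F r in at_top. exp (\<xi> * ln r) * U (ln r) = r powr (n - 2) * u r"
    using eventually_gt_at_top[of 0]
  proof eventually_elim
    case (elim r)
    have "(n - 2) * ln r = \<xi> * ln r + \<gamma> * ln r" unfolding ce(1)[symmetric] by (simp add: algebra_simps)
    then have "exp (\<xi> * ln r) * exp (\<gamma> * ln r) = r powr (n - 2)"
      using elim by (simp add: powr_def exp_add)
    then show ?case using elim by (simp add: U_def flip: mult.assoc)
  qed
  ultimately have "((\<lambda>r. r powr (n - 2) * u r) \<longlongrightarrow> \<alpha>) at_top" by (rule Lim_transform_eventually)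
  with \<alpha>(1) that show ?thesis by blast
qed

text \<open>Since u behaves like \<alpha> r^(2-n), the flux q behaves like an antiderivative G of r^(n-1+b) r^(- (n-2) \<mu>).\<close>
lemma flux_at_infinity:
  assumes \<alpha>: "((\<lambda>r. r powr (n - 2) * u r) \<longlongrightarrow> \<alpha>) at_top"
    and G: "\<And>r. r > 0 \<Longrightarrow> (G has_real_derivative r powr (n + b - 1 - (n - 2) * \<mu>)) (at r)"
      "filterlim G at_top at_top" and "\<alpha> > 0"
  shows "((\<lambda>r. q r / G r) \<longlongrightarrow> - (\<alpha> powr \<mu>)) at_top"
proof (rule lhospital_at_top_at_top)
  show "\<forall>\<^sub>F r in at_top. (q has_real_derivative - (r powr (n - 1 + b) * u r powr \<mu>)) (at r)"
    using eventually_gt_at_top[of 0] by eventually_elim (auto intro: dq)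
  show "\<forall>\<^sub>F r in at_top. (G has_real_derivative r powr (n + b - 1 - (n - 2) * \<mu>)) (at r)"
    using eventually_gt_at_top[of 0] by eventually_elim (rule G)
  show "\<forall>\<^sub>F r in at_top. r powr (n + b - 1 - (n - 2) * \<mu>) \<noteq> 0"
    using eventually_gt_at_top[of 0] by eventually_elim auto
  have "((\<lambda>r. - ((r powr (n - 2) * u r) powr \<mu>)) \<longlongrightarrow> - (\<alpha> powr \<mu>)) at_top"
    using \<alpha> \<open>\<alpha> > 0\<close> by (intro tendsto_intros) auto
  moreover have "\<forall>\<^sub>F r in at_top. - ((r powr (n - 2) * u r) powr \<mu>)
      = - (r powr (n - 1 + b) * u r powr \<mu>) / r powr (n + b - 1 - (n - 2) * \<mu>)"
    using eventually_gt_at_top[of 0]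
  proof eventually_elim
    case (elim r)
    then have "u r > 0" using pos(1)[of r] by simp
    moreover have "r powr (n - 1 + b) = r powr (n + b - 1 - (n - 2) * \<mu>) * r powr ((n - 2) * \<mu>)"
      by (simp add: algebra_simps flip: powr_add)
    ultimately show ?case using elim by (simp add: powr_mult powr_powr)
  qed
  ultimately show "((\<lambda>r. - (r powr (n - 1 + b) * u r powr \<mu>) / r powr (n + b - 1 - (n - 2) * \<mu>)) \<longlongrightarrow> - (\<alpha> powr \<mu>)) at_top"
    by (rule Lim_transform_eventually)
qed (use G in auto)

lemma v_at_infinity:
  assumes q: "((\<lambda>r. q r / G r) \<longlongrightarrow> - c) at_top"
    and H: "\<forall>\<^sub>F r in at_top. (H has_real_derivative r powr (1 - n) * h r) (at r)"
      "\<forall>\<^sub>F r in at_top. h r < 0" "\<forall>\<^sub>F r in at_top. H r > 0" "(H \<longlongrightarrow> 0) at_top"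
    and hG: "((\<lambda>r. G r / h r) \<longlongrightarrow> - k) at_top" "\<forall>\<^sub>F r in at_top. G r > 0"
  shows "((\<lambda>r. v r / H r) \<longlongrightarrow> c * k) at_top"
proof (rule tendsto_ratio_at_top_of_zero)
  interpret sw: ground_state n b a \<mu> \<delta> v u q p by (rule swapped_ground_state)
  show "\<forall>\<^sub>F r in at_top. (v has_real_derivative r powr (1 - n) * q r) (at r)"
    using eventually_gt_at_top[of 0] by eventually_elim (auto intro: dv)
  show "\<forall>\<^sub>F r in at_top. r powr (1 - n) * h r < 0"
    using eventually_gt_at_top[of 0] H(2) by eventually_elim (auto simp: mult_less_0_iff)
  show "(v \<longlongrightarrow> 0) at_top" by (rule sw.u_tendsto_zero)
  have "((\<lambda>r. q r / G r * (G r / h r)) \<longlongrightarrow> - c * - k) at_top" by (intro tendsto_mult q hG)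
  moreover have "\<forall>\<^sub>F r in at_top. q r / G r * (G r / h r) = r powr (1 - n) * q r / (r powr (1 - n) * h r)"
    using eventually_gt_at_top[of 0] hG(2) by eventually_elim auto
  ultimately show "((\<lambda>r. r powr (1 - n) * q r / (r powr (1 - n) * h r)) \<longlongrightarrow> c * k) at_top"
    using Lim_transform_eventually by force
qed (use H in auto)

text \<open>The flux of v grows like r^l with l = n + b - (n - 2) \<mu> > 0, so v decays like r^(-m) with m = n - 2 - l; criticality
  gives m = \<xi> (\<mu> + 1) > 0.\<close>
lemma v_asymptotics_slow:
  assumes \<alpha>: "\<alpha> > 0" "((\<lambda>r. r powr (n - 2) * u r) \<longlongrightarrow> \<alpha>) at_top"
    and crit: "excess = 0" and \<mu>: "(n - 2) * \<mu> < n + b"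
  shows "\<exists>\<beta>>0. ((\<lambda>r. r powr ((n - 2) * \<mu> - (2 + b)) * v r) \<longlongrightarrow> \<beta>) at_top"
proof -
  define l where "l = n + b - (n - 2) * \<mu>"
  define m where "m = (n - 2) * \<mu> - (2 + b)"
  have l: "l > 0" using \<mu> by (simp add: l_def)
  have lm: "l = n - 2 - m" by (simp add: l_def m_def)
  have m: "m > 0"
  proof -
    have "m = \<xi> * (\<mu> + 1)"
      unfolding m_def critical_exponents(1)[OF crit, symmetric]
      using scaling_gamma_xi(2)[of \<delta> \<mu> a b] superlinear by (simp add: algebra_simps)
    then show ?thesis using \<gamma>\<xi>_pos \<delta>\<mu> by simp
  qed
  have q: "((\<lambda>r. q r / (r powr l / l)) \<longlongrightarrow> - (\<alpha> powr \<mu>)) at_top"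
  proof (rule flux_at_infinity[OF \<alpha>(2) _ _ \<alpha>(1)])
    show "((\<lambda>r. r powr l / l) has_real_derivative r powr (n + b - 1 - (n - 2) * \<mu>)) (at r)" if "r > 0" for r
      using deriv_powr_antideriv[of r l 1] that l by (simp add: l_def algebra_simps)
    show "filterlim (\<lambda>r. r powr l / l) at_top at_top"
      using filterlim_tendsto_pos_mult_at_top[OF tendsto_const[of "1 / l"] _ real_powr_at_top[OF l]] l by simp
  qed
  have "((\<lambda>r. v r / r powr (- m)) \<longlongrightarrow> \<alpha> powr \<mu> * (1 / (l * m))) at_top"
  proof (rule v_at_infinity[OF q, where h = "\<lambda>r. - m * r powr l"])
    show "\<forall>\<^sub>F r in at_top. ((\<lambda>r. r powr (- m)) has_real_derivative r powr (1 - n) * (- m * r powr l)) (at r)"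
      using eventually_gt_at_top[of 0]
    proof eventually_elim
      case (elim r)
      have "1 - n + l = - m - 1" by (simp add: lm)
      then have "r powr (1 - n) * r powr l = r powr (- m - 1)" by (metis powr_add)
      then have E: "- m * r powr (- m - 1) = r powr (1 - n) * (- m * r powr l)" by (simp add: mult_ac)
      show ?case using has_real_derivative_powr[OF elim, of "- m"] unfolding E .
    qed
    show "\<forall>\<^sub>F r in at_top. - m * r powr l < 0" "\<forall>\<^sub>F r in at_top. 0 < r powr (- m)" "\<forall>\<^sub>F r in at_top. r powr l / l > 0"
      by (rule eventually_mono[OF eventually_gt_at_top[of 0]], use m l in simp)+
    show "((\<lambda>r. r powr (- m)) \<longlongrightarrow> 0) at_top" using m by (intro tendsto_neg_powr filterlim_ident) auto
    have "\<forall>\<^sub>F r in at_top. - (1 / (l * m)) = r powr l / l / (- m * r powr l)"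
      by (rule eventually_mono[OF eventually_gt_at_top[of 0]]) (use m l in simp)
    then show "((\<lambda>r. r powr l / l / (- m * r powr l)) \<longlongrightarrow> - (1 / (l * m))) at_top"
      by (rule Lim_transform_eventually[OF tendsto_const])
  qed
  then have "((\<lambda>r. r powr m * v r) \<longlongrightarrow> \<alpha> powr \<mu> * (1 / (l * m))) at_top"
    by (simp add: powr_minus field_simps)
  moreover have "\<alpha> powr \<mu> * (1 / (l * m)) > 0" using \<alpha> l m by simp
  ultimately show ?thesis unfolding m_def by blast
qed

text \<open>At the borderline the flux of v grows like ln r.\<close>
lemma v_asymptotics_log:
  assumes \<alpha>: "\<alpha> > 0" "((\<lambda>r. r powr (n - 2) * u r) \<longlongrightarrow> \<alpha>) at_top"
    and \<mu>: "(n - 2) * \<mu> = n + b"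
  shows "\<exists>\<beta>>0. ((\<lambda>r. r powr (n - 2) * inverse \<bar>ln r\<bar> * v r) \<longlongrightarrow> \<beta>) at_top"
proof -
  have q: "((\<lambda>r. q r / ln r) \<longlongrightarrow> - (\<alpha> powr \<mu>)) at_top"
  proof (rule flux_at_infinity[OF \<alpha>(2) _ ln_at_top \<alpha>(1)])
    show "(ln has_real_derivative r powr (n + b - 1 - (n - 2) * \<mu>)) (at r)" if "r > 0" for r
      using DERIV_ln_divide[OF that] that by (simp add: \<mu> powr_minus divide_inverse)
  qed
  have gt: "\<forall>\<^sub>F r in at_top. ln r > (1 / (n - 2)::real)"
    using ln_at_top by (simp add: filterlim_at_top_dense)
  have gt1: "\<forall>\<^sub>F r in at_top. r > (1::real)" by (rule eventually_gt_at_top)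
  have "((\<lambda>r. v r / (r powr (2 - n) * ln r)) \<longlongrightarrow> \<alpha> powr \<mu> * (1 / (n - 2))) at_top"
  proof (rule v_at_infinity[OF q, where h = "\<lambda>r. (2 - n) * ln r + 1"])
    show "\<forall>\<^sub>F r in at_top. ((\<lambda>r. r powr (2 - n) * ln r) has_real_derivative r powr (1 - n) * ((2 - n) * ln r + 1)) (at r)"
      using gt1
    proof eventually_elim
      case (elim r)
      then have r: "r > 0" by simp
      have "r powr (2 - n) * (1 / r) = r powr (1 - n)"
        using r powr_mult_base[of r "1 - n"] by (simp add: field_simps)
      moreover have "2 - n - 1 = 1 - n" by simp
      ultimately show ?case
        by (intro DERIV_cong[OF DERIV_mult[OF has_real_derivative_powr[OF r] DERIV_ln_divide[OF r]]])
           (simp add: algebra_simps)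
    qed
    show "\<forall>\<^sub>F r in at_top. (2 - n) * ln r + 1 < 0"
      using gt by eventually_elim (use n in \<open>simp add: field_simps\<close>)
    show "\<forall>\<^sub>F r in at_top. 0 < r powr (2 - n) * ln r" "\<forall>\<^sub>F r in at_top. ln r > (0::real)"
      by (rule eventually_mono[OF gt1], simp)+
    have "n - 2 > 0" using n by simp
    from tendsto_mult_left[OF filterlim_compose[OF ln_x_over_x_tendsto_0 real_powr_at_top[OF this]], of "1 / (n - 2)"]
    have "((\<lambda>r. 1 / (n - 2) * (ln (r powr (n - 2)) / r powr (n - 2))) \<longlongrightarrow> 0) at_top" by simp
    then show "((\<lambda>r. r powr (2 - n) * ln r) \<longlongrightarrow> 0) at_top"
    proof (rule Lim_transform_eventually)
      show "\<forall>\<^sub>F r in at_top. 1 / (n - 2) * (ln (r powr (n - 2)) / r powr (n - 2)) = r powr (2 - n) * ln r"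
        using gt1
      proof eventually_elim
        case (elim r)
        have "r powr (2 - n) = 1 / r powr (n - 2)"
          using powr_minus_divide[of r "n - 2"] by simp
        then show ?case using elim n by (simp add: ln_powr)
      qed
    qed
    have "((\<lambda>r. 1 / (2 - n + inverse (ln r))) \<longlongrightarrow> 1 / (2 - n + 0)) at_top"
      using n by (intro tendsto_intros tendsto_inverse_0_at_top ln_at_top) auto
    moreover have "\<forall>\<^sub>F r in at_top. 1 / (2 - n + inverse (ln r)) = ln r / ((2 - n) * ln r + 1)"
      using gt1 by eventually_elim (simp add: field_simps)
    moreover have "1 / (2 - n + 0) = - (1 / (n - 2))" using n by (simp add: field_simps)
    ultimately show "((\<lambda>r. ln r / ((2 - n) * ln r + 1)) \<longlongrightarrow> - (1 / (n - 2))) at_top"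
      using Lim_transform_eventually by force
  qed
  then have "((\<lambda>r. r powr (n - 2) * inverse \<bar>ln r\<bar> * v r) \<longlongrightarrow> \<alpha> powr \<mu> * (1 / (n - 2))) at_top"
  proof (rule Lim_transform_eventually)
    show "\<forall>\<^sub>F r in at_top. v r / (r powr (2 - n) * ln r) = r powr (n - 2) * inverse \<bar>ln r\<bar> * v r"
      using gt1 by eventually_elim (simp add: powr_diff field_simps)
  qed
  moreover have "\<alpha> powr \<mu> * (1 / (n - 2)) > 0" using \<alpha> n by simp
  ultimately show ?thesis by blast
qed

lemma critical_asymptotics:
  assumes crit: "excess = 0" and \<delta>: "\<delta> > (n + a) / (n - 2)"
  shows "(\<exists>\<alpha>>0. ((\<lambda>r. r powr (n - 2) * u r) \<longlongrightarrow> \<alpha>) at_top) \<and>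
       (\<mu> < (n + b) / (n - 2) \<longrightarrow>
          (\<exists>\<beta>>0. ((\<lambda>r. r powr ((n - 2) * \<mu> - (2 + b)) * v r) \<longlongrightarrow> \<beta>) at_top)) \<and>
       (\<mu> > (n + b) / (n - 2) \<longrightarrow>
          (\<exists>\<beta>>0. ((\<lambda>r. r powr (n - 2) * v r) \<longlongrightarrow> \<beta>) at_top)) \<and>
       (\<mu> = (n + b) / (n - 2) \<longrightarrow>
          (\<exists>\<beta>>0. ((\<lambda>r. r powr (n - 2) * inverse \<bar>ln r\<bar> * v r) \<longlongrightarrow> \<beta>) at_top))"
proof -
  interpret sw: ground_state n b a \<mu> \<delta> v u q p by (rule swapped_ground_state)
  have swe: "sw.excess = 0" using crit by (simp add: sw.excess_def excess_def)
  have "n + a < \<delta> * (n - 2)" using \<delta> n by (simp add: field_simps)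
  then obtain \<alpha> where \<alpha>: "\<alpha> > 0" "((\<lambda>r. r powr (n - 2) * u r) \<longlongrightarrow> \<alpha>) at_top"
    using u_fundamental_decay[OF crit] by blast
  have "\<exists>\<beta>>0. ((\<lambda>r. r powr (n - 2) * v r) \<longlongrightarrow> \<beta>) at_top" if "\<mu> > (n + b) / (n - 2)"
  proof -
    have "n + b < \<mu> * (n - 2)" using that n by (simp add: field_simps)
    then show ?thesis using sw.u_fundamental_decay[OF swe] by blast
  qed
  moreover have "\<exists>\<beta>>0. ((\<lambda>r. r powr ((n - 2) * \<mu> - (2 + b)) * v r) \<longlongrightarrow> \<beta>) at_top" if "\<mu> < (n + b) / (n - 2)"
    using v_asymptotics_slow[OF \<alpha> crit] that n by (simp add: field_simps)
  moreover have "\<exists>\<beta>>0. ((\<lambda>r. r powr (n - 2) * inverse \<bar>ln r\<bar> * v r) \<longlongrightarrow> \<beta>) at_top" if "\<mu> = (n + b) / (n - 2)"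
    using v_asymptotics_log[OF \<alpha>] that n by simp
  ultimately show ?thesis using \<alpha> by blast
qed

end

section \<open>Radial solutions of the partial differential equations\<close>

lemma laplacian_radial:
  fixes x :: "'a::euclidean_space"
  assumes x: "norm x \<in> S" "norm x > 0" and S: "open S"
    and f1: "\<And>r. r \<in> S \<Longrightarrow> (f has_real_derivative f' r) (at r)"
    and f2: "(f' has_real_derivative f'') (at (norm x))"
  shows "laplacian (\<lambda>y::'a. f (norm y)) x = f'' + (real DIM('a) - 1) / norm x * f' (norm x)"
proof -
  define r where "r = norm x"
  have r: "r \<in> S" "r > 0" using x by (auto simp: r_def)
  have second: "deriv (deriv (\<lambda>t. f (norm (x + t *\<^sub>R e)))) 0
      = f'' * ((x \<bullet> e) * (x \<bullet> e)) / r\<^sup>2 + f' r * (1 / r - (x \<bullet> e) * (x \<bullet> e) / r ^ 3)" if e: "e \<in> Basis" for e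
  proof -
    define c where "c = x \<bullet> e"
    define g where "g t = norm (x + t *\<^sub>R e)" for t :: real
    have ee: "e \<bullet> e = 1" using e by (simp add: inner_Basis)
    have g0: "g 0 = r" by (simp add: g_def r_def)
    have gc: "continuous_on UNIV g" unfolding g_def by (intro continuous_intros)
    define W where "W = g -` (S \<inter> {0<..})"
    have W: "open W" unfolding W_def by (rule open_vimage[OF _ gc]) (use S in auto)
    have W0: "0 \<in> W" using g0 r by (simp add: W_def)
    have dg: "(g has_real_derivative (c + t) / g t) (at t)" if "t \<in> W" for t
    proof -
      have gp: "g t > 0" using that by (simp add: W_def)
      have sq: "g t = sqrt (r\<^sup>2 + 2 * t * c + t\<^sup>2)" for t
      proof -
        have "(x + t *\<^sub>R e) \<bullet> (x + t *\<^sub>R e) = x \<bullet> x + 2 * t * c + t * t"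
          using ee by (simp add: inner_add_left inner_add_right c_def inner_commute)
        then have "(x + t *\<^sub>R e) \<bullet> (x + t *\<^sub>R e) = r\<^sup>2 + 2 * t * c + t\<^sup>2"
          by (simp only: r_def power2_norm_eq_inner power2_eq_square[of t])
        then show ?thesis by (simp add: g_def norm_eq_sqrt_inner)
      qed
      have p: "r\<^sup>2 + 2 * t * c + t\<^sup>2 > 0" using gp unfolding sq by simp
      have "((\<lambda>t. sqrt (r\<^sup>2 + 2 * t * c + t\<^sup>2)) has_real_derivative
         (inverse (sqrt (r\<^sup>2 + 2 * t * c + t\<^sup>2)) / 2) * (2 * c + 2 * t)) (at t)"
        by (rule DERIV_chain2[where f = sqrt and g = "\<lambda>t. r\<^sup>2 + 2 * t * c + t\<^sup>2", OF DERIV_real_sqrt[OF p]]) (auto intro!: derivative_eq_intros)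
      then have "(g has_real_derivative (inverse (g t) / 2) * (2 * c + 2 * t)) (at t)"
        unfolding sq[abs_def] .
      then show ?thesis by (rule DERIV_cong) (use gp in \<open>simp add: field_simps\<close>)
    qed
    have dh: "((\<lambda>t. f (g t)) has_real_derivative f' (g t) * ((c + t) / g t)) (at t)" if "t \<in> W" for t
      by (rule DERIV_chain2[OF f1 dg[OF that]]) (use that in \<open>simp add: W_def\<close>)
    have f2': "(f' has_real_derivative f'') (at (g 0))" using f2 by (simp add: g0 r_def)
    have "((\<lambda>t. f' (g t) * ((c + t) / g t)) has_real_derivative
       (f'' * ((c + 0) / g 0)) * ((c + 0) / g 0) + ((1 * g 0 - (c + 0) * ((c + 0) / g 0)) / (g 0 * g 0)) * f' (g 0)) (at 0)"
      using g0 r by (intro DERIV_mult DERIV_divide DERIV_chain2[OF f2' dg[OF W0]] dg[OF W0])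
        (auto intro!: derivative_eq_intros)
    then have "(deriv (\<lambda>t. f (g t)) has_real_derivative
       (f'' * ((c + 0) / g 0)) * ((c + 0) / g 0) + ((1 * g 0 - (c + 0) * ((c + 0) / g 0)) / (g 0 * g 0)) * f' (g 0)) (at 0)"
      by (rule has_field_derivative_transform_within_open[OF _ W W0]) (simp add: DERIV_imp_deriv[OF dh])
    then have "deriv (deriv (\<lambda>t. f (g t))) 0 =
       (f'' * ((c + 0) / g 0)) * ((c + 0) / g 0) + ((1 * g 0 - (c + 0) * ((c + 0) / g 0)) / (g 0 * g 0)) * f' (g 0)"
      by (rule DERIV_imp_deriv)
    also have "\<dots> = f'' * (c * c) / r\<^sup>2 + f' r * (1 / r - c * c / r ^ 3)"
      using r by (simp add: g0 power2_eq_square power3_eq_cube field_simps)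
    finally show ?thesis by (simp add: g_def c_def)
  qed
  have sum: "(\<Sum>e\<in>Basis. (x \<bullet> e) * (x \<bullet> e)) = r\<^sup>2"
    by (simp add: r_def power2_norm_eq_inner euclidean_inner[of x x])
  have "laplacian (\<lambda>y. f (norm y)) x = (\<Sum>e\<in>Basis. f'' * ((x \<bullet> e) * (x \<bullet> e)) / r\<^sup>2 + f' r * (1 / r - (x \<bullet> e) * (x \<bullet> e) / r ^ 3))"
    unfolding laplacian_def by (intro sum.cong refl second)
  also have "\<dots> = f'' * (\<Sum>e\<in>Basis. (x \<bullet> e) * (x \<bullet> e)) / r\<^sup>2 + f' r * (real DIM('a) / r - (\<Sum>e\<in>Basis. (x \<bullet> e) * (x \<bullet> e)) / r ^ 3)"
    by (simp add: sum.distrib sum_subtractf flip: sum_divide_distrib sum_distrib_left)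
  also have "\<dots> = f'' + (real DIM('a) - 1) / r * f' r"
    unfolding sum using r by (simp add: power2_eq_square power3_eq_cube field_simps)
  finally show ?thesis by (simp add: r_def)
qed

lemma C2_onD:
  assumes "C2_on u S" "r \<in> S"
  shows "(u has_real_derivative deriv u r) (at r)" "(deriv u has_real_derivative deriv (deriv u) r) (at r)"
proof -
  have *: "(f has_real_derivative deriv f r) (at r)" if f: "f C1_differentiable_on S" for f :: "real \<Rightarrow> real"
  proof -
    obtain d where "(f has_vector_derivative d) (at r)" using f assms(2) unfolding C1_differentiable_on_def by blast
    then have "(f has_real_derivative d) (at r)" by (simp add: has_real_derivative_iff_has_vector_derivative)
    then show ?thesis using DERIV_imp_deriv by fastforce
  qed
  show "(u has_real_derivative deriv u r) (at r)" "(deriv u has_real_derivative deriv (deriv u) r) (at r)"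
    using * assms(1) by (auto simp: C2_on_def)
qed

lemma C2_onI:
  assumes S: "open S" and d1: "\<And>r. r \<in> S \<Longrightarrow> (u has_real_derivative u' r) (at r)"
    and d2: "\<And>r. r \<in> S \<Longrightarrow> (u' has_real_derivative u'' r) (at r)" and c: "continuous_on S u''"
  shows "C2_on u S"
proof -
  have "\<forall>r\<in>S. (u has_vector_derivative u' r) (at r)"
    using d1 by (simp add: has_real_derivative_iff_has_vector_derivative)
  moreover have "continuous_on S u'"
    using d2 by (meson DERIV_isCont continuous_at_imp_continuous_on)
  moreover have "\<forall>r\<in>S. (deriv u has_vector_derivative u'' r) (at r)"
  proof
    fix r assume r: "r \<in> S"
    have "(deriv u has_real_derivative u'' r) (at r)"
      by (rule has_field_derivative_transform_within_open[OF d2[OF r] S r])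
         (simp add: DERIV_imp_deriv[OF d1])
    then show "(deriv u has_vector_derivative u'' r) (at r)"
      by (simp add: has_real_derivative_iff_has_vector_derivative)
  qed
  ultimately show ?thesis using c unfolding C2_on_def C1_differentiable_on_def by blast
qed

text \<open>If the flux stays above \<epsilon> > 0, then w is unbounded near 0, like the fundamental solution r^(2-n).\<close>
lemma no_fundamental_singularity:
  fixes w p :: "real \<Rightarrow> real"
  assumes n: "n > 2" and r0: "r0 > 0" and c: "continuous_on {0..r0} w"
    and d: "\<And>r. 0 < r \<Longrightarrow> r \<le> r0 \<Longrightarrow> (w has_real_derivative r powr (1 - n) * p r) (at r)"
    and p: "\<And>r. 0 < r \<Longrightarrow> r \<le> r0 \<Longrightarrow> \<epsilon> \<le> p r" and \<epsilon>: "\<epsilon> > 0"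
  shows False
proof -
  have "bounded (w ` {0..r0})" by (rule compact_imp_bounded[OF compact_continuous_image[OF c compact_Icc]])
  then obtain M where "\<forall>y\<in>w ` {0..r0}. norm y \<le> M" unfolding bounded_iff by blast
  then have M: "\<bar>w r\<bar> \<le> M" if "r \<in> {0..r0}" for r using that by auto
  define h where "h r = w r + \<epsilon> * r powr (2 - n) / (n - 2)" for r
  \<comment> \<open>r^(n-2) \<le> z makes \<epsilon> r^(2-n) / (n - 2) exceed h r0 + M\<close>
  define z where "z = \<epsilon> / ((n - 2) * (\<bar>h r0\<bar> + M + 1))"
  have M0: "M \<ge> 0" using M[of 0] r0 by auto
  have z: "z > 0" using n \<epsilon> M0 by (simp add: z_def)
  define r where "r = min r0 (z powr (1 / (n - 2)))"
  have r: "0 < r" "r \<le> r0" using z r0 by (auto simp: r_def)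
  have "h r \<le> h r0"
  proof (rule deriv_nonneg_imp_le_closed[OF r(2)])
    fix t assume t: "r \<le> t" "t \<le> r0"
    have "((\<lambda>r. w r + \<epsilon> * r powr (2 - n) / (n - 2)) has_real_derivative
        t powr (1 - n) * p t + \<epsilon> * ((2 - n) * t powr (2 - n - 1)) / (n - 2)) (at t)"
      using t r by (intro DERIV_add DERIV_cdivide DERIV_cmult d has_real_derivative_powr) auto
    moreover have "2 - n - 1 = 1 - n" by simp
    moreover have "\<epsilon> * ((2 - n) * t powr (1 - n)) / (n - 2) = - (\<epsilon> * t powr (1 - n))"
      using n by (simp add: field_simps)
    ultimately show "(h has_real_derivative t powr (1 - n) * (p t - \<epsilon>)) (at t)"
      unfolding h_def[abs_def] by (simp add: algebra_simps)
    show "0 \<le> t powr (1 - n) * (p t - \<epsilon>)" using p[of t] t r by simp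
  qed
  moreover have "- M \<le> w r" using M[of r] r by force
  moreover have "\<bar>h r0\<bar> + M + 1 \<le> \<epsilon> * r powr (2 - n) / (n - 2)"
  proof -
    have "r powr (n - 2) \<le> (z powr (1 / (n - 2))) powr (n - 2)" using r n by (intro powr_mono2) (auto simp: r_def)
    also have "\<dots> = z" using z n by (simp add: powr_powr)
    finally have "1 / z \<le> 1 / r powr (n - 2)" using r z by (intro divide_left_mono) auto
    also have "1 / r powr (n - 2) = r powr (2 - n)" using powr_minus_divide[of r "n - 2"] by simp
    finally have "\<epsilon> * (1 / z) / (n - 2) \<le> \<epsilon> * r powr (2 - n) / (n - 2)"
      using \<epsilon> n by (intro divide_right_mono mult_left_mono) auto
    moreover have "\<epsilon> * (1 / z) / (n - 2) = \<bar>h r0\<bar> + M + 1" using \<epsilon> n M0 by (simp add: z_def)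
    ultimately show ?thesis by simp
  qed
  ultimately show False unfolding h_def[of r] by linarith
qed

text \<open>The flux p = r^(n-1) u' is decreasing. Continuity of u at 0 excludes fluxes bounded away from 0 of either sign, so p \<rightarrow> 0
  at the origin, and u is decreasing.\<close>
lemma flux_form:
  assumes n: "n > 2" and R: "R > 0" and C2: "C2_on u (einterval 0 R)"
    and cont: "continuous_on {r. 0 \<le> r \<and> ereal r < R} u"
    and eq: "\<And>r. 0 < r \<Longrightarrow> ereal r < R \<Longrightarrow> deriv (deriv u) r + (n - 1) / r * deriv u r = - (r powr a * v r powr \<delta>)"
    and pos: "\<And>r. 0 < r \<Longrightarrow> ereal r < R \<Longrightarrow> 0 < u r"
  defines "p \<equiv> \<lambda>r. if r = 0 then 0 else r powr (n - 1) * deriv u r"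
  shows "continuous_on {r. 0 \<le> r \<and> ereal r < R} p" "0 < u 0"
    "0 < r \<Longrightarrow> ereal r < R \<Longrightarrow> (u has_real_derivative r powr (1 - n) * p r) (at r)"
    "0 < r \<Longrightarrow> ereal r < R \<Longrightarrow> (p has_real_derivative - (r powr (n - 1 + a) * v r powr \<delta>)) (at r)"
proof -
  let ?I = "{r. 0 \<le> r \<and> ereal r < R}"
  have ei: "r \<in> einterval 0 R \<longleftrightarrow> 0 < r \<and> ereal r < R" for r by (simp add: einterval_iff)
  have lessR: "s \<le> t \<Longrightarrow> ereal t < R \<Longrightarrow> ereal s < R" for s t
    by (rule le_less_trans[of _ "ereal t"]) auto
  show du: "(u has_real_derivative r powr (1 - n) * p r) (at r)" if r: "0 < r" "ereal r < R" for r
  proof -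
    have "r powr (1 - n) * r powr (n - 1) = 1" using r by (simp flip: powr_add)
    then have "r powr (1 - n) * p r = deriv u r" using r by (simp add: p_def flip: mult.assoc)
    then show ?thesis using C2_onD(1)[OF C2, of r] r ei by simp
  qed
  show dp: "(p has_real_derivative - (r powr (n - 1 + a) * v r powr \<delta>)) (at r)" if r: "0 < r" "ereal r < R" for r
  proof -
    have F: "((\<lambda>r. r powr (n - 1) * deriv u r) has_real_derivative
       (n - 1) * r powr (n - 1 - 1) * deriv u r + deriv (deriv u) r * r powr (n - 1)) (at r)"
      using r ei by (intro DERIV_mult has_real_derivative_powr C2_onD(2)[OF C2]) auto
    have "r powr (n - 1) = r * r powr (n - 1 - 1)" using r powr_mult_base[of r "n - 1 - 1"] by simp
    then have "(n - 1) * r powr (n - 1 - 1) * deriv u r + deriv (deriv u) r * r powr (n - 1)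
       = r powr (n - 1) * (deriv (deriv u) r + (n - 1) / r * deriv u r)" using r by (simp add: field_simps)
    also have "\<dots> = - (r powr (n - 1 + a) * v r powr \<delta>)" using eq[OF r] by (simp add: powr_add)
    finally have "((\<lambda>r. r powr (n - 1) * deriv u r) has_real_derivative - (r powr (n - 1 + a) * v r powr \<delta>)) (at r)"
      using F by simp
    then show ?thesis
      by (rule has_field_derivative_transform_within_open[where S = "{0<..}"]) (use r in \<open>auto simp: p_def\<close>)
  qed
  have anti: "p t \<le> p s" if "0 < s" "s \<le> t" "ereal t < R" for s t
  proof -
    have "- p s \<le> - p t"
    proof (rule deriv_nonneg_imp_le_closed[OF that(2)])
      fix z assume z: "s \<le> z" "z \<le> t"
      then have "0 < z" "ereal z < R" using that lessR[of z t] by auto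
      from DERIV_minus[OF dp[OF this]]
      show "((\<lambda>r. - p r) has_real_derivative z powr (n - 1 + a) * v z powr \<delta>) (at z)" by simp
    qed simp
    then show ?thesis by simp
  qed
  have sub: "{0..t} \<subseteq> ?I" if "ereal t < R" for t using that lessR by auto
  have nonpos: "p t \<le> 0" if t: "0 < t" "ereal t < R" for t
  proof (rule ccontr)
    assume "\<not> p t \<le> 0"
    then show False
      using no_fundamental_singularity[OF n t(1) continuous_on_subset[OF cont sub[OF t(2)]] du, of "p t"]
        anti[of _ t] t lessR by force
  qed
  have "\<exists>t0. 0 < t0 \<and> ereal t0 < R"
  proof (cases R)
    case (real x)
    then show ?thesis using R by (intro exI[of _ "x / 2"]) auto
  next
    case PInf
    then show ?thesis by (intro exI[of _ 1]) auto
  qed (use R in auto)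
  then obtain t0 where t0: "0 < t0" "ereal t0 < R" by blast
  have small: "\<exists>t1. 0 < t1 \<and> t1 \<le> t0 \<and> - \<epsilon> < p t1" if "\<epsilon> > 0" for \<epsilon>
  proof (rule ccontr)
    assume "\<not> ?thesis"
    then have le: "p t \<le> - \<epsilon>" if "0 < t" "t \<le> t0" for t using that by force
    have cm: "continuous_on {0..t0} (\<lambda>r. - u r)"
      by (intro continuous_intros continuous_on_subset[OF cont sub[OF t0(2)]])
    show False
    proof (rule no_fundamental_singularity[OF n t0(1) cm, where p = "\<lambda>r. - p r" and \<epsilon> = \<epsilon>])
      fix r assume r: "0 < r" "r \<le> t0"
      then have "ereal r < R" using t0 lessR by blast
      from DERIV_minus[OF du[OF r(1) this]]
      show "((\<lambda>r. - u r) has_real_derivative r powr (1 - n) * - p r) (at r)" by simp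
      show "\<epsilon> \<le> - p r" using le[OF r] by simp
    qed (rule that)
  qed
  have lim0: "(p \<longlongrightarrow> 0) (at 0 within ?I)"
  proof (rule tendstoI)
    fix \<epsilon> :: real assume "\<epsilon> > 0"
    then obtain t1 where t1: "0 < t1" "t1 \<le> t0" "- \<epsilon> < p t1" using small by blast
    have t1R: "ereal t1 < R" using t1 t0 lessR by blast
    have "dist (p t) 0 < \<epsilon>" if "t \<in> ?I" "t \<noteq> 0" "dist t 0 < t1" for t
    proof -
      have "0 < t" "t \<le> t1" "ereal t < R" using that by (auto simp: dist_real_def)
      then have "p t1 \<le> p t" "p t \<le> 0" using anti t1R nonpos by auto
      then show ?thesis using t1 by (simp add: dist_real_def)
    qed
    then show "\<forall>\<^sub>F t in at 0 within ?I. dist (p t) 0 < \<epsilon>"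
      unfolding eventually_at using t1(1) by blast
  qed
  show "continuous_on ?I p"
    unfolding continuous_on_eq_continuous_within
  proof
    fix r assume r: "r \<in> ?I"
    show "continuous (at r within ?I) p"
    proof (cases "r = 0")
      case True
      then show ?thesis using lim0 by (simp add: continuous_within p_def)
    next
      case False
      then have "isCont p r" using DERIV_isCont[OF dp, of r] r by auto
      then show ?thesis by (rule continuous_at_imp_continuous_at_within)
    qed
  qed
  have "- u 0 \<le> - u t0"
  proof (rule deriv_nonneg_imp_le[OF less_imp_le[OF t0(1)]])
    show "continuous_on {0..t0} (\<lambda>r. - u r)"
      by (intro continuous_intros continuous_on_subset[OF cont sub[OF t0(2)]])
    fix r assume "0 < r" "r < t0"
    then have r: "0 < r" "ereal r < R" using t0 lessR[of r t0] by auto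
    from DERIV_minus[OF du[OF r]]
    show "((\<lambda>r. - u r) has_real_derivative - (r powr (1 - n) * p r)) (at r)" .
    show "0 \<le> - (r powr (1 - n) * p r)" using nonpos[OF r] by (simp add: mult_nonneg_nonpos)
  qed
  then show "0 < u 0" using pos[OF t0] by simp
qed

lemma radial_system_of_solution:
  assumes n: "n = real DIM('a::euclidean_space)" "n > 2" and ab: "a > -2" "b > -2" and \<delta>\<mu>: "\<delta> > 0" "\<mu> > 0" and R: "R > 0"
    and sol: "positive_radial_solution TYPE('a) a b \<delta> \<mu> R u v" "regular_at_0 R u v"
  shows "\<exists>p q. radial_system n a b \<delta> \<mu> R u v p q"
proof -
  have half: "deriv (deriv u) r + (n - 1) / r * deriv u r = - (r powr a * v r powr \<delta>)"
    if C2: "C2_on u (einterval 0 R)" and r: "0 < r" "ereal r < R"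
      and eq: "\<And>x::'a. norm x \<in> einterval 0 R \<Longrightarrow> - laplacian (\<lambda>y::'a. u (norm y)) x = norm x powr a * v (norm x) powr \<delta>"
    for u v a \<delta> r
  proof -
    obtain x :: 'a where x: "norm x = r" using vector_choose_size[of r] r by auto
    have I: "r \<in> einterval 0 R" using r by (simp add: einterval_iff)
    have "laplacian (\<lambda>y::'a. u (norm y)) x = deriv (deriv u) r + (real DIM('a) - 1) / norm x * deriv u (norm x)"
      by (rule laplacian_radial[OF _ _ open_einterval C2_onD(1)[OF C2]]) (use x I r C2_onD(2)[OF C2 I] in auto)
    with eq[of x] x I n show ?thesis by simp
  qed
  have C2: "C2_on u (einterval 0 R)" "C2_on v (einterval 0 R)"
    and pos: "\<And>r. 0 < r \<Longrightarrow> ereal r < R \<Longrightarrow> 0 < u r" "\<And>r. 0 < r \<Longrightarrow> ereal r < R \<Longrightarrow> 0 < v r"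
    and eqs: "\<And>x::'a. norm x \<in> einterval 0 R \<Longrightarrow> - laplacian (\<lambda>y::'a. u (norm y)) x = norm x powr a * v (norm x) powr \<delta>"
      "\<And>x::'a. norm x \<in> einterval 0 R \<Longrightarrow> - laplacian (\<lambda>y::'a. v (norm y)) x = norm x powr b * u (norm x) powr \<mu>"
    and cont: "continuous_on {r. 0 \<le> r \<and> ereal r < R} u" "continuous_on {r. 0 \<le> r \<and> ereal r < R} v"
    using sol by (auto simp: positive_radial_solution_def regular_at_0_def einterval_iff)
  note U = flux_form[OF n(2) R C2(1) cont(1) half[OF C2(1) _ _ eqs(1)] pos(1)]
  note V = flux_form[OF n(2) R C2(2) cont(2) half[OF C2(2) _ _ eqs(2)] pos(2)]
  have "radial_system n a b \<delta> \<mu> R u v (\<lambda>r. if r = 0 then 0 else r powr (n - 1) * deriv u r)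
     (\<lambda>r. if r = 0 then 0 else r powr (n - 1) * deriv v r)"
  proof unfold_locales
    show "0 < u r" "0 < v r" if "0 \<le> r" "ereal r < R" for r
      using pos[of r] U(2) V(2) that by (cases "r = 0"; simp)+
  qed (rule n(2) ab \<delta>\<mu> cont U V | simp; fail)+
  then show ?thesis by blast
qed

lemma solution_of_radial_system:
  assumes dim: "n = real DIM('a::euclidean_space)" and s: "radial_system n a b \<delta> \<mu> R u v p q"
  shows "positive_radial_solution TYPE('a) a b \<delta> \<mu> R u v \<and> regular_at_0 R u v"
proof -
  have half: "C2_on u (einterval 0 R) \<and> (\<forall>x::'a. norm x \<in> einterval 0 R \<longrightarrow>
      - laplacian (\<lambda>y::'a. u (norm y)) x = norm x powr a * v (norm x) powr \<delta>)"
    if s: "radial_system n a b \<delta> \<mu> R u v p q" for a b \<delta> \<mu> u v p q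
  proof -
    interpret radial_system n a b \<delta> \<mu> R u v p q by fact
    have I: "r \<in> einterval 0 R \<longleftrightarrow> 0 < r \<and> ereal r < R" for r by (simp add: einterval_iff)
    have d1: "(u has_real_derivative r powr (1 - n) * p r) (at r)" if "r \<in> einterval 0 R" for r
      using du that I by simp
    define f2 where "f2 r = (1 - n) * r powr (- n) * p r - r powr a * v r powr \<delta>" for r
    have d2: "((\<lambda>r. r powr (1 - n) * p r) has_real_derivative f2 r) (at r)" if "r \<in> einterval 0 R" for r
    proof -
      have r: "0 < r" "ereal r < R" using that I by auto
      have F: "((\<lambda>r. r powr (1 - n) * p r) has_real_derivative
         (1 - n) * r powr (1 - n - 1) * p r + - (r powr (n - 1 + a) * v r powr \<delta>) * r powr (1 - n)) (at r)"
        by (intro DERIV_mult has_real_derivative_powr dp r)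
      have "r powr (n - 1 + a) * r powr (1 - n) = r powr a" by (simp flip: powr_add)
      then have E: "- (r powr (n - 1 + a) * v r powr \<delta>) * r powr (1 - n) = - (r powr a * v r powr \<delta>)"
        by (simp add: mult_ac)
      show ?thesis by (rule DERIV_cong[OF F[unfolded E]]) (simp add: f2_def)
    qed
    have sub: "einterval 0 R \<subseteq> {r. 0 \<le> r \<and> ereal r < R}" by (auto simp: I)
    have cv: "continuous_on (einterval 0 R) (\<lambda>r. v r powr \<delta>)"
      by (intro continuous_on_powr' continuous_on_subset[OF cont(2) sub] continuous_on_const ballI conjI impI)
        (use pos \<delta>\<mu> in \<open>force simp: I intro: less_imp_le\<close>)+
    have cp: "continuous_on (einterval 0 R) (\<lambda>r. r powr k)" for k
      by (intro continuous_intros) (auto simp: I)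
    have "continuous_on (einterval 0 R) f2"
      unfolding f2_def
      by (intro continuous_on_diff continuous_on_mult cv cp continuous_on_const continuous_on_subset[OF cont(3) sub])
    then have C2: "C2_on u (einterval 0 R)" by (intro C2_onI[OF open_einterval d1 d2])
    have "- laplacian (\<lambda>y::'a. u (norm y)) x = norm x powr a * v (norm x) powr \<delta>" if x: "norm x \<in> einterval 0 R" for x :: 'a
    proof -
      have r: "norm x > 0" using x I by simp
      have "laplacian (\<lambda>y::'a. u (norm y)) x = f2 (norm x) + (real DIM('a) - 1) / norm x * (norm x powr (1 - n) * p (norm x))"
        by (rule laplacian_radial[OF x r open_einterval d1 d2[OF x]])
      also have "norm x powr (1 - n) = norm x * norm x powr (- n)" using powr_mult_base[of "norm x" "- n"] by simp
      finally show ?thesis using r unfolding dim[symmetric] f2_def by (simp add: field_simps)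
    qed
    with C2 show ?thesis by blast
  qed
  interpret radial_system n a b \<delta> \<mu> R u v p q by fact
  show ?thesis
    using half[OF s] half[OF swapped] cont(1,2) pos
    by (auto simp: positive_radial_solution_def regular_at_0_def einterval_iff)
qed

theorem theorem1p4:
  fixes a b \<delta> \<mu> :: real and N :: nat
  assumes "N = DIM('a::euclidean_space)" and "N > 2"
    and "a > -2" and "b > -2" and "\<delta> > 0" and "\<mu> > 0" and "\<delta> * \<mu> - 1 > 0"
  shows
    "((\<exists>u v. radial_ground_state TYPE('a) a b \<delta> \<mu> u v) \<longleftrightarrow>
       (\<delta>, \<mu>) \<in> above_hyperbola (real N) a b \<union> critical_hyperbola (real N) a b) \<and>
     (\<forall>u v u' v'. radial_ground_state TYPE('a) a b \<delta> \<mu> u v \<and>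
       radial_ground_state TYPE('a) a b \<delta> \<mu> u' v' \<longrightarrow>
       (\<exists>\<theta>>0. \<forall>r\<ge>0. u' r = \<theta> powr scaling_gamma a b \<delta> \<mu> * u (\<theta> * r) \<and>
                     v' r = \<theta> powr scaling_xi a b \<delta> \<mu> * v (\<theta> * r))) \<and>
     (\<forall>R>0.
       (\<exists>u v. radial_dirichlet_solution TYPE('a) a b \<delta> \<mu> R u v) \<longleftrightarrow>
       (\<delta>, \<mu>) \<in> under_hyperbola (real N) a b) \<and>
     (\<forall>u v. (\<delta>, \<mu>) \<in> critical_hyperbola (real N) a b \<and>
       radial_ground_state TYPE('a) a b \<delta> \<mu> u v \<and>
       \<delta> > (real N + a) / (real N - 2) \<longrightarrow>
       (\<exists>\<alpha>>0. ((\<lambda>r. r powr (real N - 2) * u r) \<longlongrightarrow> \<alpha>) at_top) \<and>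
       (\<mu> < (real N + b) / (real N - 2) \<longrightarrow>
          (\<exists>\<beta>>0. ((\<lambda>r. r powr ((real N - 2) * \<mu> - (2 + b)) * v r) \<longlongrightarrow> \<beta>) at_top)) \<and>
       (\<mu> > (real N + b) / (real N - 2) \<longrightarrow>
          (\<exists>\<beta>>0. ((\<lambda>r. r powr (real N - 2) * v r) \<longlongrightarrow> \<beta>) at_top)) \<and>
       (\<mu> = (real N + b) / (real N - 2) \<longrightarrow>
          (\<exists>\<beta>>0. ((\<lambda>r. r powr (real N - 2) * inverse \<bar>ln r\<bar> * v r) \<longlongrightarrow> \<beta>) at_top)))"
proof -
  define n where "n = real N"
  have n: "n = real DIM('a)" "n > 2" using assms by (simp_all add: n_def)
  have sup: "\<delta> * \<mu> > 1" using assms by simp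
  define X where "X = (n + a) / (\<delta> + 1) + (n + b) / (\<mu> + 1) + 2 - n"
  have hyp: "(\<delta>, \<mu>) \<in> above_hyperbola (real N) a b \<longleftrightarrow> X < 0"
    "(\<delta>, \<mu>) \<in> critical_hyperbola (real N) a b \<longleftrightarrow> X = 0"
    "(\<delta>, \<mu>) \<in> under_hyperbola (real N) a b \<longleftrightarrow> X > 0"
    by (auto simp: above_hyperbola_def critical_hyperbola_def under_hyperbola_def X_def n_def)
  have ex: "radial_system.excess n a b \<delta> \<mu> = X" if "radial_system n a b \<delta> \<mu> R u v p q" for R u v p q
    using radial_system.excess_def[OF that] by (simp add: X_def)
  have gsD: "\<exists>p q. ground_state n a b \<delta> \<mu> u v p q" if "radial_ground_state TYPE('a) a b \<delta> \<mu> u v" for u v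
  proof -
    have "\<exists>p q. radial_system n a b \<delta> \<mu> \<infinity> u v p q"
      using that assms n by (intro radial_system_of_solution[OF n]) (auto simp: radial_ground_state_def)
    then show ?thesis using sup by (auto simp: ground_state_def ground_state_axioms_def)
  qed
  have gsI: "radial_ground_state TYPE('a) a b \<delta> \<mu> u v" if "radial_system n a b \<delta> \<mu> \<infinity> u v p q" for u v p q
    using solution_of_radial_system[OF n(1) that] by (simp add: radial_ground_state_def)
  have gs_X: "X \<le> 0" if "radial_ground_state TYPE('a) a b \<delta> \<mu> u v" for u v
  proof -
    obtain p q where g: "ground_state n a b \<delta> \<mu> u v p q" using gsD[OF \<open>radial_ground_state TYPE('a) a b \<delta> \<mu> u v\<close>] by blast
    then show ?thesis using ground_state.excess_nonpos[OF g] ex[of \<infinity> u v p q] by (simp add: ground_state_def)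
  qed
  have at_left: "(f \<longlongrightarrow> 0) (at_left R)" if "continuous_on {0..R} f" "R > 0" "f R = 0" for f :: "real \<Rightarrow> real" and R
    using continuous_on_tendsto_at_left[OF that(1,2)] that(3) by simp
  have dir_X: "X > 0" if s: "radial_system n a b \<delta> \<mu> (ereal R) u v p q" and R: "R > 0"
    and c: "continuous_on {0..R} u" "continuous_on {0..R} v" "u R = 0" "v R = 0" for R u v p q
    using radial_system.dirichlet_imp_excess_pos[OF s refl R at_left[OF c(1) R c(3)] at_left[OF c(2) R c(4)]] ex[OF s] by simp
  have "shooting n a b \<delta> \<mu>" using n assms by unfold_locales auto
  note dich = shooting.shooting_dichotomy[OF this]
  have part1: "(\<exists>u v. radial_ground_state TYPE('a) a b \<delta> \<mu> u v) \<longleftrightarrow> X \<le> 0"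
  proof
    assume "X \<le> 0"
    then have "\<exists>u v p q. radial_system n a b \<delta> \<mu> \<infinity> u v p q" using dich dir_X by (meson not_le)
    then show "\<exists>u v. radial_ground_state TYPE('a) a b \<delta> \<mu> u v" using gsI by blast
  qed (use gs_X in blast)
  have part2: "(\<exists>u v. radial_dirichlet_solution TYPE('a) a b \<delta> \<mu> R u v) \<longleftrightarrow> X > 0" if R: "R > 0" for R
  proof
    assume "\<exists>u v. radial_dirichlet_solution TYPE('a) a b \<delta> \<mu> R u v"
    then obtain u v where d: "radial_dirichlet_solution TYPE('a) a b \<delta> \<mu> R u v" by blast
    then have "\<exists>p q. radial_system n a b \<delta> \<mu> (ereal R) u v p q"
      using assms R by (intro radial_system_of_solution[OF n]) (auto simp: radial_dirichlet_solution_def)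
    then show "X > 0" using dir_X[OF _ R, of u v] d by (auto simp: radial_dirichlet_solution_def)
  next
    assume "X > 0"
    then have "\<not> (\<exists>u v p q. radial_system n a b \<delta> \<mu> \<infinity> u v p q)" using gsI gs_X by (meson not_le)
    then obtain R0 u v p q where s: "R0 > 0" "radial_system n a b \<delta> \<mu> (ereal R0) u v p q"
      "continuous_on {0..R0} u" "continuous_on {0..R0} v" "u R0 = 0" "v R0 = 0" using dich by blast
    define \<theta> where "\<theta> = R0 / R"
    have \<theta>: "\<theta> > 0" "\<theta> * R = R0" using s R by (simp_all add: \<theta>_def)
    let ?u = "\<lambda>r. \<theta> powr scaling_gamma a b \<delta> \<mu> * u (\<theta> * r)"
    let ?v = "\<lambda>r. \<theta> powr scaling_xi a b \<delta> \<mu> * v (\<theta> * r)"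
    have eqv: "ereal r < ereal R \<longleftrightarrow> ereal (\<theta> * r) < ereal R0" for r
      using \<theta>(1) unfolding \<theta>(2)[symmetric] by simp
    from radial_system_scale[OF s(2) \<theta>(1) sup eqv]
    have sc: "\<exists>p q. radial_system n a b \<delta> \<mu> (ereal R) ?u ?v p q" by blast
    then obtain p' q' where sc: "radial_system n a b \<delta> \<mu> (ereal R) ?u ?v p' q'" by blast
    have c: "continuous_on {0..R} (\<lambda>r. f (\<theta> * r))" if "continuous_on {0..R0} f" for f :: "real \<Rightarrow> real"
      by (rule continuous_on_compose2[OF that])
        (use \<theta> in \<open>auto intro!: continuous_intros simp flip: \<theta>(2)\<close>)
    have "radial_dirichlet_solution TYPE('a) a b \<delta> \<mu> R ?u ?v"
      unfolding radial_dirichlet_solution_def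
      using solution_of_radial_system[OF n(1) sc] radial_system.pos[OF sc, of 0] R s(5,6) \<theta>(2)
      by (auto intro!: continuous_intros c[OF s(3)] c[OF s(4)])
    then show "\<exists>u v. radial_dirichlet_solution TYPE('a) a b \<delta> \<mu> R u v" by blast
  qed
  have part3: "\<exists>\<theta>>0. \<forall>r\<ge>0. u' r = \<theta> powr scaling_gamma a b \<delta> \<mu> * u (\<theta> * r) \<and>
                     v' r = \<theta> powr scaling_xi a b \<delta> \<mu> * v (\<theta> * r)"
    if "radial_ground_state TYPE('a) a b \<delta> \<mu> u v" "radial_ground_state TYPE('a) a b \<delta> \<mu> u' v'" for u v u' v'
    using gsD[OF that(1)] gsD[OF that(2)] ground_state_unique by blast
  have part4: "(\<exists>\<alpha>>0. ((\<lambda>r. r powr (n - 2) * u r) \<longlongrightarrow> \<alpha>) at_top) \<and>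
       (\<mu> < (n + b) / (n - 2) \<longrightarrow>
          (\<exists>\<beta>>0. ((\<lambda>r. r powr ((n - 2) * \<mu> - (2 + b)) * v r) \<longlongrightarrow> \<beta>) at_top)) \<and>
       (\<mu> > (n + b) / (n - 2) \<longrightarrow>
          (\<exists>\<beta>>0. ((\<lambda>r. r powr (n - 2) * v r) \<longlongrightarrow> \<beta>) at_top)) \<and>
       (\<mu> = (n + b) / (n - 2) \<longrightarrow>
          (\<exists>\<beta>>0. ((\<lambda>r. r powr (n - 2) * inverse \<bar>ln r\<bar> * v r) \<longlongrightarrow> \<beta>) at_top))"
    if X: "X = 0" and gs: "radial_ground_state TYPE('a) a b \<delta> \<mu> u v" and \<delta>: "\<delta> > (n + a) / (n - 2)" for u v
  proof -
    obtain p q where g: "ground_state n a b \<delta> \<mu> u v p q" using gsD[OF gs] by blast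
    then have "radial_system.excess n a b \<delta> \<mu> = 0" using ex[of \<infinity> u v p q] X by (simp add: ground_state_def)
    from ground_state.critical_asymptotics[OF g this \<delta>] show ?thesis .
  qed
  show ?thesis
  proof (intro conjI allI impI)
    show "(\<exists>u v. radial_ground_state TYPE('a) a b \<delta> \<mu> u v) \<longleftrightarrow>
       (\<delta>, \<mu>) \<in> above_hyperbola (real N) a b \<union> critical_hyperbola (real N) a b"
      using part1 hyp by auto
    show "(\<exists>u v. radial_dirichlet_solution TYPE('a) a b \<delta> \<mu> R u v) \<longleftrightarrow>
       (\<delta>, \<mu>) \<in> under_hyperbola (real N) a b" if "R > 0" for R
      using part2[OF that] hyp by simp
  qed (use part3 part4[folded n_def] hyp n_def in blast)+
qed

end
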